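(* Let $\ell\in\mathbb{N}^+$ and let $1=n_1<n_2<\ldots<n_{\ell+1}$ be a strictly increasing sequence of positive integers, determining the grid lengths $\frac{h}{n_1},\frac{h}{n_2},\ldots,\frac{h}{n_{\ell+1}}$. Consider the initial-value problem $y'(t)=f(t,y(t))$, $y(t_0)=y_0$, with $f:\mathbb{R}\times\mathbb{R}^m\to\mathbb{R}^m$ and unique solution $y$ on $[t_0,t_{\text{final}}]$, and a $k$-step linear multistep method (LMM) $$\sum_{j=0}^k \alpha_j y_{n+j}=\sum_{j=0}^k h\beta_j f_{n+j},\qquad \alpha_k\neq 0,$$ generating the sequence $y_n(h)$ on the uniform grid with step size $h$. Assume that (a1) the right-hand side $f$ is sufficiently smooth; (a2) the LMM has order $p\ge 1$; (a3) for any $h\in[0,h_0]$, the $k$ starting values $y_0(h),y_1(h),\ldots,y_{k-1}(h)$ used to initiate the LMM are each $\mathcal{O}(h^p)$-close to the corresponding exact solution values $y(t_0),y(t_0+h),\ldots,y(t_0+(k-1)h)$; (a4) the eigenvalues of the $k\times k$ matrix $$A=\begin{pmatrix} -\alpha_{k-1}/\alpha_k & -\alpha_{k-2}/\alpha_k & \cdots & -\alpha_1/\alpha_k & -\alpha_0/\alpha_k\\ 1&0&\cdots&0&0\\ 0&1&\cdots&0&0\\ \vdots&&\ddots&\vdots&\vdots\\ 0&0&\cdots&1&0\end{pmatrix}$$ lie in the closed unit disk of the complex plane, the only eigenvalue with modulus $1$ is $1$, and its algebraic multiplicity is also $1$. Then, for any fixed grid point $t^*=t_0+nh\in[t_0,t_{\text{final}}]$,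 the repeated global Richardson extrapolation $r_n^{[\ell]}(h)$ of the LMM sequence satisfies $$r_n^{[\ell]}(h)-y(t^* )=\mathcal{O}(h^{p+\ell}).$$
   Context: Here $m,k\in\mathbb{N}^+$; the real numbers $\alpha_j,\beta_j$ ($0\le j\le k$) are the given coefficients of the LMM; the grid is $t_n=t_0+nh$ with $h>0$; and $f_i:=f(t_i,y_i)$. The sequence $y_n(h)$ is the one produced by the LMM with step size $h$ from the starting values $y_0(h),\ldots,y_{k-1}(h)$, so that $y_n(h)\approx y(t_n)$. "Sufficiently smooth" means having continuous derivatives up to a sufficiently high order. The LMM has order $p$ in the usual sense: its local error is $\mathcal{O}(h^{p+1})$; equivalently, $\sum_{j}\alpha_j=0$ and $\sum_{j}\alpha_j j^q=q\sum_j\beta_j j^{q-1}$ for $q=1,\ldots,p$ (with $0^0=1$). Repeated global Richardson extrapolation (RGRE): for $j=1,\ldots,\ell+1$, the sequence $i\mapsto y_i\left(\frac{h}{n_j}\right)$ is computed independently by the same LMM with step size $h/n_j$, with its own starting values $y_0(h/n_j),\ldots,y_{k-1}(h/n_j)$ (so assumption (a3) applies to them with $h$ replaced by $h/n_j$). Then $$r_n^{[\ell]}(h):=\sum_{j=1}^{\ell+1}\gamma_j\, y_{n_j\cdot n}\left(\frac{h}{n_j}\right),$$ where $\gamma_1,\ldots,\gamma_{\ell+1}\in\mathbb{R}$ is the unique solution of the linear system $$\sum_{j=1}^{\ell+1}\gamma_j=1,\qquad \sum_{j=1}^{\ell+1}\gamma_j\, n_j^{-(p+i)}=0\quad (i=0,1,\ldots,\ell-1).$$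 The fixed grid point $t^*=t_0+nh$ belongs to all of the grids. Any implied constant in an $\mathcal{O}$ symbol is independent of $n$ and $h$.
   Formalization: Added: each starting value y_j(h) has an expansion in powers of h up to O(h^{p+ℓ}) as h→0 (closeness O(h^p) alone does not suffice), and, for implicit methods, the computed values stay within a fixed distance of y independent of n and h (excluding spurious roots of the implicit equation). *)

theory Defs
  imports
    "HOL-Analysis.Analysis"
    "HOL-Library.Landau_Symbols"
    "Jordan_Normal_Form.Char_Poly"
begin

text \<open>
  Continuous differentiability of order \<open>s\<close> on the whole space. Higher derivatives are taken
  direction by direction, which in finite dimension is the usual notion.
\<close>

primrec Ck :: "nat \<Rightarrow> ('a::euclidean_space \<Rightarrow> 'b::euclidean_space) \<Rightarrow> bool" where
  "Ck 0 f \<longleftrightarrow> continuous_on UNIV f"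
| "Ck (Suc s) f \<longleftrightarrow>
     (\<forall>x. f differentiable (at x)) \<and> (\<forall>v. Ck s (\<lambda>x. frechet_derivative f (at x) v))"

definition ivp_solution ::
  "(real \<Rightarrow> real ^ 'm \<Rightarrow> real ^ 'm) \<Rightarrow> real \<Rightarrow> real \<Rightarrow> real ^ 'm \<Rightarrow> (real \<Rightarrow> real ^ 'm) \<Rightarrow> bool" where
  "ivp_solution f t0 tf y0 y \<longleftrightarrow>
     y t0 = y0 \<and>
     (\<forall>t\<in>{t0..tf}. (y has_vector_derivative f t (y t)) (at t within {t0..tf}))"

definition unique_ivp_solution ::
  "(real \<Rightarrow> real ^ 'm \<Rightarrow> real ^ 'm) \<Rightarrow> real \<Rightarrow> real \<Rightarrow> real ^ 'm \<Rightarrow> (real \<Rightarrow> real ^ 'm) \<Rightarrow> bool" where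
  "unique_ivp_solution f t0 tf y0 y \<longleftrightarrow>
     ivp_solution f t0 tf y0 y \<and>
     (\<forall>z. ivp_solution f t0 tf y0 z \<longrightarrow> (\<forall>t\<in>{t0..tf}. z t = y t))"

text \<open>
  Order conditions of a linear multistep method, equivalent to a local error \<open>O(h ^ (p + 1))\<close>.
  For \<open>q = 1\<close> the right-hand side uses \<open>0 ^ 0 = 1\<close>. As usual, this says that the order is at
  least \<open>p\<close>.
\<close>

definition lmm_order :: "nat \<Rightarrow> (nat \<Rightarrow> real) \<Rightarrow> (nat \<Rightarrow> real) \<Rightarrow> nat \<Rightarrow> bool" where
  "lmm_order k \<alpha> \<beta> p \<longleftrightarrow>
     (\<Sum>j=0..k. \<alpha> j) = 0 \<and>
     (\<forall>q\<in>{1..p}. (\<Sum>j=0..k. \<alpha> j * real j ^ q) = real q * (\<Sum>j=0..k. \<beta> j * real j ^ (q - 1)))"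

text \<open>Rows and columns are numbered from \<open>0\<close>.\<close>

definition companion :: "nat \<Rightarrow> (nat \<Rightarrow> real) \<Rightarrow> complex Matrix.mat" where
  "companion k \<alpha> = Matrix.mat k k (\<lambda>(i, j).
     if i = 0 then complex_of_real (- \<alpha> (k - 1 - j) / \<alpha> k)
     else if i = j + 1 then 1 else 0)"

definition eigenvalue_condition :: "complex Matrix.mat \<Rightarrow> bool" where
  "eigenvalue_condition A \<longleftrightarrow>
     (\<forall>z. eigenvalue A z \<longrightarrow> cmod z \<le> 1 \<and> (cmod z = 1 \<longrightarrow> z = 1)) \<and>
     Polynomial.order 1 (char_poly A) = 1"

text \<open>
  The recursion is imposed only while its last grid point lies in the time interval. Starting
  values are unconstrained here. For an implicit method the recursion alone need not determine
  the sequence.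
\<close>

definition lmm_sequence ::
  "(real \<Rightarrow> real ^ 'm \<Rightarrow> real ^ 'm) \<Rightarrow> real \<Rightarrow> real \<Rightarrow> nat \<Rightarrow> (nat \<Rightarrow> real) \<Rightarrow> (nat \<Rightarrow> real) \<Rightarrow>
     real \<Rightarrow> (nat \<Rightarrow> real ^ 'm) \<Rightarrow> bool" where
  "lmm_sequence f t0 tf k \<alpha> \<beta> h u \<longleftrightarrow>
     (\<forall>n. t0 + real (n + k) * h \<le> tf \<longrightarrow>
        (\<Sum>j=0..k. \<alpha> j *\<^sub>R u (n + j)) =
        (\<Sum>j=0..k. (h * \<beta> j) *\<^sub>R f (t0 + real (n + j) * h) (u (n + j))))"

text \<open>
  \<open>Y h n\<close> is the \<open>n\<close>-th value computed with step size \<open>h\<close>. If the method is implicit, the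
  nonlinear equation for the new value may have further roots running off to infinity as
  \<open>h\<close> tends to \<open>0\<close> (for \<open>y' = y ^ 2\<close> and implicit Euler, a root of size about \<open>1 / h\<close>). The
  computed sequence is meant to approximate \<open>y\<close>; this is used only in the weak form that it
  stays within some fixed distance of \<open>y\<close>, arbitrarily large but independent of \<open>h\<close> and \<open>n\<close>.
  Explicit methods get no such condition.
\<close>

definition lmm_solution ::
  "(real \<Rightarrow> real ^ 'm \<Rightarrow> real ^ 'm) \<Rightarrow> real \<Rightarrow> real \<Rightarrow> (real \<Rightarrow> real ^ 'm) \<Rightarrow>
     nat \<Rightarrow> (nat \<Rightarrow> real) \<Rightarrow> (nat \<Rightarrow> real) \<Rightarrow> real \<Rightarrow> (real \<Rightarrow> nat \<Rightarrow> real ^ 'm) \<Rightarrow> bool" where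
  "lmm_solution f t0 tf y k \<alpha> \<beta> h0 Y \<longleftrightarrow>
     (\<forall>h\<in>{0<..h0}. lmm_sequence f t0 tf k \<alpha> \<beta> h (Y h)) \<and>
     (\<beta> k \<noteq> 0 \<longrightarrow>
        (\<exists>R. \<forall>h\<in>{0<..h0}. \<forall>n. t0 + real n * h \<le> tf \<longrightarrow>
           norm (Y h n - y (t0 + real n * h)) \<le> R))"

definition starting_values_close ::
  "real \<Rightarrow> real \<Rightarrow> (real \<Rightarrow> real ^ 'm) \<Rightarrow> nat \<Rightarrow> nat \<Rightarrow> real \<Rightarrow> (real \<Rightarrow> nat \<Rightarrow> real ^ 'm) \<Rightarrow> bool" where
  "starting_values_close t0 tf y k p h0 Y \<longleftrightarrow>
     (\<exists>C. \<forall>h\<in>{0..h0}. \<forall>j<k. t0 + real j * h \<le> tf \<longrightarrow>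
        norm (Y h j - y (t0 + real j * h)) \<le> C * h ^ p)"

text \<open>
  Regularity of the starting procedure: each starting value has a Taylor-type expansion at
  \<open>h = 0\<close> with remainder \<open>O(h ^ N)\<close>. This holds if \<open>h \<mapsto> Y h j\<close> is sufficiently smooth
  (for example if it comes from a Runge-Kutta method) and also if the starting values are
  \<open>O(h ^ N)\<close>-close to a smooth exact solution. Closeness of order \<open>h ^ p\<close> alone does not allow
  extrapolation: for \<open>y' = 0\<close>, \<open>y(0) = 0\<close> and Euler's method with starting value \<open>h\<close> if
  \<open>1 / h\<close> is an odd integer and \<open>0\<close> otherwise, the combination
  \<open>2 * Y (h / 2) (2 * n) - Y h n\<close> equals \<open>- h\<close> for all odd \<open>1 / h\<close>.
\<close>

definition starting_values_expand ::
  "nat \<Rightarrow> nat \<Rightarrow> (real \<Rightarrow> nat \<Rightarrow> real ^ 'm) \<Rightarrow> bool" where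
  "starting_values_expand k N Y \<longleftrightarrow>
     (\<forall>j<k. \<exists>c. (\<lambda>h. norm (Y h j - (\<Sum>i<N. h ^ i *\<^sub>R c i))) \<in> O[at_right 0](\<lambda>h. h ^ N))"

definition rgre_weights :: "nat \<Rightarrow> nat \<Rightarrow> (nat \<Rightarrow> nat) \<Rightarrow> (nat \<Rightarrow> real) \<Rightarrow> bool" where
  "rgre_weights p l N \<gamma> \<longleftrightarrow>
     (\<Sum>j=1..l+1. \<gamma> j) = 1 \<and>
     (\<forall>i<l. (\<Sum>j=1..l+1. \<gamma> j / real (N j) ^ (p + i)) = 0)"

definition rgre ::
  "nat \<Rightarrow> (nat \<Rightarrow> nat) \<Rightarrow> (nat \<Rightarrow> real) \<Rightarrow> (real \<Rightarrow> nat \<Rightarrow> real ^ 'm) \<Rightarrow> nat \<Rightarrow> real \<Rightarrow> real ^ 'm" where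
  "rgre l N \<gamma> Y n h = (\<Sum>j=1..l+1. \<gamma> j *\<^sub>R Y (h / real (N j)) (N j * n))"

end

theory Submission
  imports Defs "HOL-Computational_Algebra.Fundamental_Theorem_Algebra"
begin

text \<open>
  The error of the method has an asymptotic expansion (Gragg, Hairer and Lubich): with \<open>M = p + l\<close>,
  the value \<open>y_n(h)\<close> is \<open>y(t_n)\<close> plus the sum of \<open>h^i (e_i(t_n) + \<epsilon>_i(n))\<close> over \<open>p \<le> i < M\<close>, up to \<open>O(h^M)\<close>.
  Here the \<open>e_i\<close> are smooth functions and the \<open>\<epsilon>_i\<close> are geometrically decaying sequences, none of them
  depending on \<open>h\<close>. At a fixed grid point the \<open>\<epsilon>_i(n)\<close> are smaller than any power of \<open>h\<close>, and the
  weights \<open>\<gamma>\<close> cancel the powers \<open>h^p, ..., h^(M-1)\<close>.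

  The coefficients are found one order at a time. Inserting the terms already known into the
  recursion leaves a residual whose leading term splits into a smooth part \<open>h^(q+1) d(t_n)\<close> and a
  decaying part \<open>h^q \<delta>(n)\<close>. The decaying part is removed by the solution \<open>v\<close> of the constant-coefficient
  recurrence with right-hand side \<open>-\<delta>\<close> whose first values absorb the error of the starting values: by
  the eigenvalue condition \<open>v\<close> converges geometrically to some \<open>\<xi>\<close>, and \<open>\<epsilon>_q = v - \<xi>\<close>. The smooth part
  is removed by the solution \<open>e_q\<close> of a linear differential equation with \<open>e_q(0) = \<xi>\<close>. A discrete
  Gronwall argument bounds what remains.
\<close>

section \<open>Continuous differentiability and Taylor expansion\<close>

text \<open>The two kinds of terms live in different limits: e_i is examined at a fixed time,
  \<epsilon>_i at a fixed index, while stability needs estimates uniform over all grid points.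
  Orders in h are therefore found pointwise and made uniform afterwards. For smooth terms this is
  Taylor's theorem on a compact set. In the decaying part, functions of (h, n h) are expanded at the
  origin; this costs powers of n, for which the geometric factor pays. A smooth residual must be one
  order smaller than a decaying one, because about 1/h smooth residuals add up, whereas decaying
  ones form a geometric series. The recurrence for \<epsilon>_q has constant coefficients because f
  enters with a factor h, so that its effect belongs to the next order. The limit \<xi> is what a
  decaying sequence cannot carry, hence its transfer to e_q. The equation for e_q contains a
  division by the sum of the \<beta>_j; simplicity of the eigenvalue 1 makes this sum nonzero.
  Writing N for p + l, each order is granted N + 2 derivatives, whence the smoothness class (N +
  2)^2.\<close>

lemma Ck_SucI:
  assumes "\<And>x. (f has_derivative f' x) (at x)" and "\<And>v. Ck s (\<lambda>x. f' x v)"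
  shows "Ck (Suc s) f"
proof -
  have "frechet_derivative f (at x) = f' x" for x
    using frechet_derivative_at[OF assms(1)] by simp
  then show ?thesis using assms by (auto simp: differentiable_def)
qed

lemma Ck_SucD:
  assumes "Ck (Suc s) f"
  shows "(f has_derivative frechet_derivative f (at x)) (at x)"
    and "Ck s (\<lambda>x. frechet_derivative f (at x) v)"
  using assms by (auto simp: frechet_derivative_works)

lemma Ck_continuous: "Ck s f \<Longrightarrow> continuous_on A f"
proof (cases s)
  case 0
  then show "Ck s f \<Longrightarrow> ?thesis" by (auto intro: continuous_on_subset)
next
  case (Suc r)
  then show "Ck s f \<Longrightarrow> ?thesis"
    by (auto intro!: continuous_at_imp_continuous_on differentiable_imp_continuous_within)
qed

lemma Ck_Suc_imp_Ck: "Ck (Suc s) f \<Longrightarrow> Ck s f"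
proof (induction s arbitrary: f)
  case 0
  show ?case using Ck_continuous[OF 0] by simp
qed auto

lemma Ck_mono: "Ck s f \<Longrightarrow> r \<le> s \<Longrightarrow> Ck r f"
  by (induction s) (auto simp del: Ck.simps simp: le_Suc_eq dest: Ck_Suc_imp_Ck)

lemma Ck_const: "Ck s (\<lambda>x. c)"
proof (induction s arbitrary: c)
  case (Suc s)
  then show ?case by (intro Ck_SucI[where f'="\<lambda>_ _. 0"]) auto
qed simp

lemma Ck_bounded_linear: "bounded_linear L \<Longrightarrow> Ck s L"
proof (cases s)
  case (Suc r)
  assume "bounded_linear L"
  then show ?thesis unfolding Suc
    by (intro Ck_SucI[where f'="\<lambda>_. L"] bounded_linear_imp_has_derivative Ck_const)
qed (simp add: linear_continuous_on)

lemma Ck_add: "Ck s f \<Longrightarrow> Ck s g \<Longrightarrow> Ck s (\<lambda>x. f x + g x)"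
proof (induction s arbitrary: f g)
  case 0
  then show ?case by (simp add: continuous_on_add)
next
  case (Suc s)
  show ?case
    by (rule Ck_SucI[OF has_derivative_add[OF Ck_SucD(1)[OF Suc.prems(1)] Ck_SucD(1)[OF Suc.prems(2)]]])
      (intro Suc.IH Ck_SucD(2)[OF Suc.prems(1)] Ck_SucD(2)[OF Suc.prems(2)])
qed

lemma Ck_sum: "(\<And>i. i \<in> I \<Longrightarrow> Ck s (f i)) \<Longrightarrow> Ck s (\<lambda>x. \<Sum>i\<in>I. f i x)"
  by (induction I rule: infinite_finite_induct) (auto simp del: Ck.simps intro: Ck_const Ck_add)

lemma Ck_bounded_bilinear:
  assumes "bounded_bilinear B"
  shows "Ck s f \<Longrightarrow> Ck s g \<Longrightarrow> Ck s (\<lambda>x. B (f x) (g x))"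
proof (induction s arbitrary: f g)
  case 0
  then show ?case by (simp add: bounded_bilinear.continuous_on[OF assms])
next
  case (Suc s)
  show ?case
    by (rule Ck_SucI[OF bounded_bilinear.FDERIV[OF assms Ck_SucD(1)[OF Suc.prems(1)]
            Ck_SucD(1)[OF Suc.prems(2)]]])
      (intro Ck_add Suc.IH Ck_SucD(2)[OF Suc.prems(1)] Ck_SucD(2)[OF Suc.prems(2)]
        Ck_Suc_imp_Ck[OF Suc.prems(1)] Ck_Suc_imp_Ck[OF Suc.prems(2)])
qed

lemmas Ck_scaleR = Ck_bounded_bilinear[OF bounded_bilinear_scaleR]

lemma Ck_bounded_linear_compose:
  assumes L: "bounded_linear L"
  shows "Ck s f \<Longrightarrow> Ck s (\<lambda>x. L (f x))"
proof (induction s arbitrary: f)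
  case 0
  then show ?case using bounded_linear.continuous_on[OF L] by simp
next
  case (Suc s)
  show ?case
    by (rule Ck_SucI[OF bounded_linear.has_derivative[OF L Ck_SucD(1)[OF Suc.prems]]])
      (intro Suc.IH Ck_SucD(2)[OF Suc.prems])
qed

lemma Ck_Pair:
  assumes "Ck s f" "Ck s g"
  shows "Ck s (\<lambda>x. (f x, g x))"
proof -
  have "Ck s (\<lambda>x. (f x, 0) + (0, g x))"
    by (intro Ck_add Ck_bounded_linear_compose[of "\<lambda>x. (x, 0)"] Ck_bounded_linear_compose[of "\<lambda>x. (0, x)"]
        assms bounded_linear_Pair bounded_linear_ident bounded_linear_zero)
  then show ?thesis by simp
qed

lemma Ck_minus: "Ck s f \<Longrightarrow> Ck s (\<lambda>x. - f x)"
  by (rule Ck_bounded_linear_compose[OF bounded_linear_minus[OF bounded_linear_ident]])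

lemma Ck_diff: "Ck s f \<Longrightarrow> Ck s g \<Longrightarrow> Ck s (\<lambda>x. f x - g x)"
  using Ck_add[OF _ Ck_minus] by force

lemma Ck_power:
  fixes f :: "'a::euclidean_space \<Rightarrow> real"
  shows "Ck s f \<Longrightarrow> Ck s (\<lambda>x. f x ^ n)"
  by (induction n) (auto simp del: Ck.simps intro: Ck_const Ck_bounded_bilinear[OF bounded_bilinear_mult])

text \<open>\<open>Ck\<close> speaks of derivatives in fixed directions only. Expanding a moving
  direction in the basis reduces it to finitely many fixed ones with scalar coefficients.\<close>

lemma linear_sum_Basis:
  fixes L :: "'a::euclidean_space \<Rightarrow> 'b::real_vector"
  assumes "linear L"
  shows "L v = (\<Sum>i\<in>Basis. inner v i *\<^sub>R L i)"
proof -
  have "L (\<Sum>i\<in>Basis. inner v i *\<^sub>R i) = (\<Sum>i\<in>Basis. inner v i *\<^sub>R L i)"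
    by (simp add: linear_sum[OF assms] linear_cmul[OF assms])
  then show ?thesis by (simp add: euclidean_representation)
qed

lemma Ck_derivative_linear: "Ck (Suc s) g \<Longrightarrow> linear (frechet_derivative g (at x))"
  by (rule has_derivative_linear[OF Ck_SucD(1)])

text \<open>By the chain rule a derivative of the composition is a sum of coordinates of the
  derivative of \<open>f\<close> times partial derivatives of \<open>g\<close> composed with
  \<open>f\<close>. The induction hypothesis covers the latter, since it is stated for all pairs of
  class \<open>s\<close>.\<close>

lemma Ck_compose: "Ck s f \<Longrightarrow> Ck s g \<Longrightarrow> Ck s (\<lambda>x. g (f x))"
proof (induction s arbitrary: f g)
  case 0
  then show ?case using continuous_on_compose2[of UNIV g UNIV f] by simp
next
  case (Suc s)
  show ?case
  proof (rule Ck_SucI)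
    show "((\<lambda>x. g (f x)) has_derivative
        (\<lambda>v. frechet_derivative g (at (f x)) (frechet_derivative f (at x) v))) (at x)" for x
      using diff_chain_at[OF Ck_SucD(1)[OF Suc.prems(1)] Ck_SucD(1)[OF Suc.prems(2)]]
      by (simp add: o_def)
    have "Ck s (\<lambda>x. frechet_derivative g (at (f x)) i)" for i
      by (rule Suc.IH[OF Ck_Suc_imp_Ck[OF Suc.prems(1)] Ck_SucD(2)[OF Suc.prems(2)]])
    then have "Ck s (\<lambda>x. \<Sum>i\<in>Basis. inner (frechet_derivative f (at x) v) i *\<^sub>R
          frechet_derivative g (at (f x)) i)" for v
      by (intro Ck_sum Ck_scaleR Ck_bounded_bilinear[OF bounded_bilinear_inner] Ck_const
          Ck_SucD(2)[OF Suc.prems(1)])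
    then show "Ck s (\<lambda>x. frechet_derivative g (at (f x)) (frechet_derivative f (at x) v))" for v
      by (subst linear_sum_Basis[OF Ck_derivative_linear[OF Suc.prems(2)]])
  qed
qed

text \<open>Serves the linearised vector field, where base point and direction both move.\<close>

lemma Ck_derivative_apply:
  assumes "Ck (Suc s) g" "Ck s f" "Ck s w"
  shows "Ck s (\<lambda>x. frechet_derivative g (at (f x)) (w x))"
  by (subst linear_sum_Basis[OF Ck_derivative_linear[OF assms(1)]])
    (intro Ck_sum Ck_scaleR Ck_bounded_bilinear[OF bounded_bilinear_inner] Ck_const assms
      Ck_compose[OF assms(2)] Ck_SucD(2)[OF assms(1)])

lemma Ck_SucI_vector_derivative:
  fixes f :: "real \<Rightarrow> 'a::euclidean_space"
  assumes "\<And>t. (f has_vector_derivative f' t) (at t)" "Ck s f'"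
  shows "Ck (Suc s) f"
  using assms by (intro Ck_SucI[where f'="\<lambda>t v. v *\<^sub>R f' t"] Ck_scaleR Ck_const)
    (auto simp: has_vector_derivative_def)

text \<open>The \<open>r\<close>-th derivative of \<open>g\<close> at \<open>x\<close>, applied to \<open>r\<close> copies of \<open>v\<close>.\<close>

primrec iter_deriv :: "nat \<Rightarrow> ('a::euclidean_space \<Rightarrow> 'b::euclidean_space) \<Rightarrow> 'a \<Rightarrow> 'a \<Rightarrow> 'b" where
  "iter_deriv 0 g x v = g x"
| "iter_deriv (Suc r) g x v =
     (\<Sum>i\<in>Basis. inner v i *\<^sub>R iter_deriv r (\<lambda>y. frechet_derivative g (at y) i) x v)"

lemma iter_deriv_scaleR: "iter_deriv r g x (c *\<^sub>R v) = c ^ r *\<^sub>R iter_deriv r g x v"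
proof (induction r arbitrary: g)
  case (Suc r)
  show ?case
    by (simp add: Suc.IH scaleR_sum_right mult.assoc mult.commute[of _ "c ^ r"])
qed simp

lemma Ck_iter_deriv:
  assumes "Ck s a" "Ck s b"
  shows "Ck (r + s) g \<Longrightarrow> Ck s (\<lambda>z. iter_deriv r g (a z) (b z))"
proof (induction r arbitrary: g)
  case 0
  then show ?case using assms by (simp del: Ck.simps add: Ck_compose)
next
  case (Suc r)
  show ?case
    unfolding iter_deriv.simps
    by (intro Ck_sum Ck_scaleR Ck_bounded_bilinear[OF bounded_bilinear_inner] Ck_const assms Suc.IH Ck_SucD(2))
      (use Suc.prems in \<open>simp del: Ck.simps\<close>)
qed

lemma iter_deriv_has_vector_derivative:
  "Ck (Suc r) g \<Longrightarrow>
    ((\<lambda>s. iter_deriv r g (x + s *\<^sub>R v) v) has_vector_derivative iter_deriv (Suc r) g (x + s *\<^sub>R v) v) (at s)"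
proof (induction r arbitrary: g)
  case 0
  have "((\<lambda>s. g (x + s *\<^sub>R v)) has_derivative (\<lambda>c. frechet_derivative g (at (x + s *\<^sub>R v)) (c *\<^sub>R v))) (at s)"
    by (rule diff_chain_at[of "\<lambda>s. x + s *\<^sub>R v", unfolded o_def, OF _ Ck_SucD(1)[OF 0]])
      (auto intro!: derivative_eq_intros)
  moreover have "frechet_derivative g (at y) (c *\<^sub>R v) =
      c *\<^sub>R (\<Sum>i\<in>Basis. inner v i *\<^sub>R frechet_derivative g (at y) i)" for y c
    by (simp add: linear_cmul[OF Ck_derivative_linear[OF 0]] linear_sum_Basis[OF Ck_derivative_linear[OF 0], where v=v])
  ultimately show ?case by (simp add: has_vector_derivative_def)
next
  case (Suc r)
  have "((\<lambda>s. iter_deriv r (\<lambda>y. frechet_derivative g (at y) i) (x + s *\<^sub>R v) v) has_vector_derivative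
      iter_deriv (Suc r) (\<lambda>y. frechet_derivative g (at y) i) (x + s *\<^sub>R v) v) (at s)" for i
    by (intro Suc.IH Ck_SucD(2)[OF Suc.prems])
  then show ?case
    unfolding iter_deriv.simps(2)[of "Suc r"] iter_deriv.simps(2)[of "r" g]
    by (intro has_vector_derivative_sum bounded_linear.has_vector_derivative[OF bounded_linear_scaleR_right])
qed

section \<open>Taylor's formula along segments\<close>

lemma norm_le_if_derivative_bounded:
  fixes \<phi> :: "real \<Rightarrow> 'a::real_normed_vector"
  assumes "\<And>s. s \<in> {0..1} \<Longrightarrow> (\<phi> has_vector_derivative \<phi>' s) (at s)"
    and "\<And>s. s \<in> {0..1} \<Longrightarrow> norm (\<phi>' s) \<le> C" and "s \<in> {0..1}"
  shows "norm (\<phi> s - \<phi> 0) \<le> C"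
proof -
  have "norm (\<phi> s - \<phi> 0) \<le> C * norm (s - 0)"
  proof (rule differentiable_bound[of "{0..1}" \<phi> "\<lambda>s c. c *\<^sub>R \<phi>' s"])
    show "(\<phi> has_derivative (\<lambda>c. c *\<^sub>R \<phi>' x)) (at x within {0..1})" if "x \<in> {0..1}" for x
      using assms(1)[OF that] unfolding has_vector_derivative_def by (rule has_derivative_at_withinI)
    show "onorm (\<lambda>c. c *\<^sub>R \<phi>' x) \<le> C" if "x \<in> {0..1}" for x
      by (rule onorm_bound) (use assms(2)[OF that] order_trans[OF norm_ge_zero assms(2)[OF that]] in
          \<open>auto intro: mult_right_mono simp: mult.commute[of "\<bar>_\<bar>"]\<close>)
  qed (use assms in auto)
  moreover have "0 \<le> C" by (rule order_trans[OF norm_ge_zero assms(2)[of 0]]) simp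
  then have "C * norm (s - 0) \<le> C" using assms(3) by (simp add: mult_left_le)
  ultimately show ?thesis by linarith
qed

text \<open>The derivative of the remainder is the remainder of the shifted family
  \<open>\<lambda>r. \<phi> (Suc r)\<close> with one term less, so the mean value inequality carries
  the induction. The factor 1 / M! is lost, which is harmless because only the power of the
  increment matters later.\<close>

lemma taylor_remainder_unit:
  fixes \<phi> :: "nat \<Rightarrow> real \<Rightarrow> 'a::real_normed_vector"
  assumes "\<And>r s. r < M \<Longrightarrow> s \<in> {0..1} \<Longrightarrow> (\<phi> r has_vector_derivative \<phi> (Suc r) s) (at s)"
    and "\<And>s. s \<in> {0..1} \<Longrightarrow> norm (\<phi> M s) \<le> C" and "s \<in> {0..1}"
  shows "norm (\<phi> 0 s - (\<Sum>r<M. (s ^ r / fact r) *\<^sub>R \<phi> r 0)) \<le> C"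
  using assms
proof (induction M arbitrary: \<phi> s)
  case 0
  then show ?case by simp
next
  case (Suc M)
  define \<psi> where "\<psi> s = \<phi> 0 s - (\<Sum>r<Suc M. (s ^ r / fact r) *\<^sub>R \<phi> r 0)" for s
  define \<psi>' where "\<psi>' s = \<phi> 1 s - (\<Sum>r<M. (s ^ r / fact r) *\<^sub>R \<phi> (Suc r) 0)" for s
  have monomial: "((\<lambda>s. (s ^ r / fact r) *\<^sub>R \<phi> r 0) has_vector_derivative (r * s ^ (r - 1) / fact r) *\<^sub>R \<phi> r 0) (at s)"
    for r s by (auto intro!: derivative_eq_intros simp: has_vector_derivative_def)
  have "(\<Sum>r<Suc M. (r * s ^ (r - 1) / fact r) *\<^sub>R \<phi> r 0) = (\<Sum>r<M. (s ^ r / fact r) *\<^sub>R \<phi> (Suc r) 0)" for s :: real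
    unfolding sum.lessThan_Suc_shift
    by (auto intro!: sum.cong simp: divide_simps)
  then have "(\<psi> has_vector_derivative \<psi>' s) (at s)" if "s \<in> {0..1}" for s
    unfolding \<psi>_def[abs_def] \<psi>'_def
    using Suc.prems(1)[of 0 s] that
    by (auto intro!: has_vector_derivative_diff has_vector_derivative_sum[THEN has_vector_derivative_eq_rhs] monomial
        simp del: sum.lessThan_Suc)
  moreover have "norm (\<psi>' s) \<le> C" if "s \<in> {0..1}" for s
    unfolding \<psi>'_def using Suc.IH[of "\<lambda>r. \<phi> (Suc r)"] Suc.prems that by simp
  moreover have "\<psi> 0 = 0"
    unfolding \<psi>_def sum.lessThan_Suc_shift by simp
  ultimately have "norm (\<psi> s) \<le> C"
    using norm_le_if_derivative_bounded[of \<psi> \<psi>' C s] Suc.prems(3) by simp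
  then show ?case by (simp only: \<psi>_def)
qed

lemma continuous_on_compact_norm_bound:
  fixes F :: "'a::topological_space \<Rightarrow> 'b::real_normed_vector"
  assumes "continuous_on K F" "compact K"
  obtains C where "C > 0" "\<And>x. x \<in> K \<Longrightarrow> norm (F x) \<le> C"
  using compact_imp_bounded[OF compact_continuous_image[OF assms]]
  unfolding bounded_pos by auto

text \<open>Homogeneity of degree \<open>r\<close> in the direction reduces the claim to directions
  in the closed unit ball, where compactness gives the constant.\<close>

lemma iter_deriv_norm_bound:
  fixes g :: "'a::euclidean_space \<Rightarrow> 'b::euclidean_space"
  assumes "Ck r g" "compact K"
  shows "\<exists>C>0. \<forall>x\<in>K. \<forall>v. norm (iter_deriv r g x v) \<le> C * norm v ^ r"
proof -
  have "Ck 0 (\<lambda>z. iter_deriv r g (fst z) (snd z))"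
    by (rule Ck_iter_deriv[OF Ck_bounded_linear[OF bounded_linear_fst] Ck_bounded_linear[OF bounded_linear_snd]])
      (use assms in \<open>simp del: Ck.simps\<close>)
  then have "continuous_on (K \<times> cball 0 1) (\<lambda>z. iter_deriv r g (fst z) (snd z))"
    by (rule Ck_continuous)
  then obtain C where C: "C > 0"
    "\<And>x. x \<in> K \<times> cball 0 1 \<Longrightarrow> norm (iter_deriv r g (fst x) (snd x)) \<le> C"
    by (rule continuous_on_compact_norm_bound) (use assms in \<open>auto intro: compact_Times\<close>)
  have "norm (iter_deriv r g x v) \<le> C * norm v ^ r" if x: "x \<in> K" for x v
  proof (cases "v = 0")
    case True
    then show ?thesis
    proof (cases r)
      case 0
      then show ?thesis using C(2)[of "(x, 0)"] x by simp
    qed simp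
  next
    case False
    have "iter_deriv r g x v = norm v ^ r *\<^sub>R iter_deriv r g x (sgn v)"
      using False by (subst iter_deriv_scaleR[symmetric]) (simp add: sgn_div_norm)
    moreover have "norm (iter_deriv r g x (sgn v)) \<le> C"
      using C(2)[of "(x, sgn v)"] x by (simp add: norm_sgn)
    ultimately show ?thesis
      by (simp add: mult.commute[of C] mult_left_mono)
  qed
  then show ?thesis using C(1) by blast
qed

lemma taylor_iter_deriv:
  fixes g :: "'a::euclidean_space \<Rightarrow> 'b::euclidean_space"
  assumes g: "Ck M g" and K: "compact K"
  shows "\<exists>C>0. \<forall>x v. closed_segment x (x + v) \<subseteq> K \<longrightarrow>
    norm (g (x + v) - (\<Sum>r<M. iter_deriv r g x v /\<^sub>R fact r)) \<le> C * norm v ^ M"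
proof -
  obtain C where C: "C > 0" "\<And>x v. x \<in> K \<Longrightarrow> norm (iter_deriv M g x v) \<le> C * norm v ^ M"
    using iter_deriv_norm_bound[OF g K] by blast
  have "norm (g (x + v) - (\<Sum>r<M. iter_deriv r g x v /\<^sub>R fact r)) \<le> C * norm v ^ M"
    if sub: "closed_segment x (x + v) \<subseteq> K" for x v
  proof -
    define \<phi> where "\<phi> r s = iter_deriv r g (x + s *\<^sub>R v) v" for r s
    have "norm (\<phi> 0 1 - (\<Sum>r<M. (1 ^ r / fact r) *\<^sub>R \<phi> r 0)) \<le> C * norm v ^ M"
    proof (rule taylor_remainder_unit)
      show "(\<phi> r has_vector_derivative \<phi> (Suc r) s) (at s)" if "r < M" for r s
        unfolding \<phi>_def[abs_def] using Ck_mono[OF g, of "Suc r"] that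
        by (intro iter_deriv_has_vector_derivative) simp
      show "norm (\<phi> M s) \<le> C * norm v ^ M" if "s \<in> {0..1}" for s
      proof -
        have "x + s *\<^sub>R v \<in> closed_segment x (x + v)"
          unfolding in_segment using that by (auto intro!: exI[of _ s] simp: algebra_simps)
        then show ?thesis unfolding \<phi>_def using C(2) sub by blast
      qed
    qed simp
    then show ?thesis by (simp add: \<phi>_def inverse_eq_divide)
  qed
  then show ?thesis using C(1) by blast
qed

lemma taylor_iter_deriv_ball:
  fixes g :: "'a::euclidean_space \<Rightarrow> 'b::euclidean_space"
  assumes "Ck M g"
  shows "\<exists>C>0. \<forall>x y. norm x \<le> R \<longrightarrow> norm y \<le> R \<longrightarrow>
    norm (g y - (\<Sum>r<M. iter_deriv r g x (y - x) /\<^sub>R fact r)) \<le> C * norm (y - x) ^ M"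
proof -
  obtain C where C: "C > 0" "\<forall>x v. closed_segment x (x + v) \<subseteq> cball 0 R \<longrightarrow>
      norm (g (x + v) - (\<Sum>r<M. iter_deriv r g x v /\<^sub>R fact r)) \<le> C * norm v ^ M"
    using taylor_iter_deriv[OF assms compact_cball[of 0 R]] by auto
  have "norm (g y - (\<Sum>r<M. iter_deriv r g x (y - x) /\<^sub>R fact r)) \<le> C * norm (y - x) ^ M"
    if "norm x \<le> R" "norm y \<le> R" for x y
  proof -
    have "closed_segment x (x + (y - x)) \<subseteq> cball 0 R"
      using that by (intro closed_segment_subset convex_cball) auto
    then have "norm (g (x + (y - x)) - (\<Sum>r<M. iter_deriv r g x (y - x) /\<^sub>R fact r)) \<le> C * norm (y - x) ^ M"
      using C(2) by blast
    then show ?thesis by simp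
  qed
  then show ?thesis using C(1) by blast
qed

lemma Ck_lipschitz_on_ball:
  fixes g :: "'a::euclidean_space \<Rightarrow> 'b::euclidean_space"
  assumes "Ck 1 g"
  shows "\<exists>L>0. \<forall>x y. norm x \<le> R \<longrightarrow> norm y \<le> R \<longrightarrow> norm (g y - g x) \<le> L * norm (y - x)"
  using taylor_iter_deriv_ball[OF assms, of R] by simp

section \<open>Linear differential equations on an interval\<close>

lemma continuous_real_antiderivative:
  fixes F :: "real \<Rightarrow> 'a::euclidean_space"
  assumes "continuous_on UNIV F"
  obtains G where "\<And>t. (G has_vector_derivative F t) (at t)"
proof -
  have "isCont F t" for t
    using assms by (simp add: continuous_on_eq_continuous_at)
  then have "\<exists>G. \<forall>t::real. -\<infinity> < ereal t \<longrightarrow> ereal t < \<infinity> \<longrightarrow> (G has_vector_derivative F t) (at t)"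
    by (intro einterval_antiderivative) auto
  then show ?thesis using that by auto
qed

text \<open>Nothing is known about \<open>e\<close> outside the interval, so its derivative is
  continued instead: an antiderivative of \<open>F\<close> on the whole line differs from
  \<open>e\<close> by a constant on the interval.\<close>

lemma Ck_antiderivative_extension:
  fixes e :: "real \<Rightarrow> 'a::euclidean_space"
  assumes T: "0 \<le> T" and F: "Ck r F"
    and e: "\<And>t. t \<in> {0..T} \<Longrightarrow> (e has_vector_derivative F t) (at t within {0..T})"
  obtains E where "Ck (Suc r) E" "\<And>t. t \<in> {0..T} \<Longrightarrow> E t = e t"
    "\<And>t. (E has_vector_derivative F t) (at t)"
proof -
  obtain G where G: "\<And>t. (G has_vector_derivative F t) (at t)"
    using continuous_real_antiderivative[OF Ck_continuous[OF F]] by blast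
  have "\<exists>c. \<forall>t\<in>{0..T}. e t - G t = c"
  proof (rule has_derivative_zero_constant)
    show "((\<lambda>t. e t - G t) has_derivative (\<lambda>h. 0)) (at t within {0..T})" if "t \<in> {0..T}" for t
      using has_vector_derivative_diff[OF e[OF that] has_vector_derivative_at_within[OF G]]
      by (simp add: has_vector_derivative_def)
  qed simp
  then obtain c where c: "\<And>t. t \<in> {0..T} \<Longrightarrow> e t - G t = c" by blast
  define E where "E t = G t + c" for t
  have E: "(E has_vector_derivative F t) (at t)" for t
    unfolding E_def[abs_def]
    using has_vector_derivative_add[OF G has_vector_derivative_const] by simp
  show ?thesis
  proof
    show "Ck (Suc r) E" by (rule Ck_SucI_vector_derivative[OF E F])
    show "E t = e t" if "t \<in> {0..T}" for t using c[OF that] by (auto simp: E_def)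
  qed (rule E)
qed

lemma continuous_extension_interval:
  fixes e :: "real \<Rightarrow> 'a::euclidean_space"
  assumes T: "0 \<le> T" and e: "continuous_on {0..T} e"
  obtains E where "continuous_on UNIV E" "\<And>t. t \<in> {0..T} \<Longrightarrow> E t = e t"
proof
  show "continuous_on UNIV (\<lambda>t. e (max 0 (min T t)))"
    by (rule continuous_on_compose2[OF e]) (use T in \<open>auto intro!: continuous_intros\<close>)
qed auto

text \<open>Bootstrapping: if an extension \<open>E\<close> has class \<open>r\<close>, then so has
  \<open>\<lambda>t. H (t, E t)\<close>, and its antiderivative is an extension of class
  \<open>Suc r\<close>. The last round also turns the one-sided derivatives at the end points into
  two-sided ones.\<close>

lemma Ck_solution_extension:
  fixes e :: "real \<Rightarrow> 'a::euclidean_space" and H :: "real \<times> 'a \<Rightarrow> 'a"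
  assumes T: "0 \<le> T" and H: "Ck s H"
    and e: "\<And>t. t \<in> {0..T} \<Longrightarrow> (e has_vector_derivative H (t, e t)) (at t within {0..T})"
  obtains E where "Ck (Suc s) E" "\<And>t. t \<in> {0..T} \<Longrightarrow> E t = e t"
    "\<And>t. t \<in> {0..T} \<Longrightarrow> (E has_vector_derivative H (t, E t)) (at t)"
proof -
  have step: "\<exists>F. Ck (Suc r) F \<and> (\<forall>t\<in>{0..T}. F t = e t) \<and>
      (\<forall>t\<in>{0..T}. (F has_vector_derivative H (t, F t)) (at t))"
    if r: "r \<le> s" and E: "Ck r E" "\<And>t. t \<in> {0..T} \<Longrightarrow> E t = e t" for r E
  proof -
    have "Ck r (\<lambda>t. H (t, E t))"
      by (rule Ck_compose[OF Ck_Pair[OF Ck_bounded_linear[OF bounded_linear_ident] E(1)] Ck_mono[OF H r]])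
    moreover have "(e has_vector_derivative H (t, E t)) (at t within {0..T})" if "t \<in> {0..T}" for t
      using e[OF that] E(2)[OF that] by simp
    ultimately obtain F where F: "Ck (Suc r) F" "\<And>t. t \<in> {0..T} \<Longrightarrow> F t = e t"
      "\<And>t. (F has_vector_derivative H (t, E t)) (at t)"
      using Ck_antiderivative_extension[OF T] by blast
    have "(F has_vector_derivative H (t, F t)) (at t)" if "t \<in> {0..T}" for t
      using F(3)[of t] F(2)[OF that] E(2)[OF that] by simp
    then show ?thesis using F by blast
  qed
  have ext: "\<exists>E. Ck r E \<and> (\<forall>t\<in>{0..T}. E t = e t)" if "r \<le> s" for r
    using that
  proof (induction r)
    case 0
    have "continuous_on {0..T} e"
      using e has_vector_derivative_continuous continuous_on_eq_continuous_within by blast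
    then obtain E where "continuous_on UNIV E" "\<And>t. t \<in> {0..T} \<Longrightarrow> E t = e t"
      using continuous_extension_interval[OF T, of e] by blast
    then show ?case by (intro exI[of _ E]) simp
  next
    case (Suc r)
    then obtain E where "Ck r E" "\<forall>t\<in>{0..T}. E t = e t" by auto
    then show ?case using step[of r E] Suc.prems by (auto simp del: Ck.simps)
  qed
  obtain E where "Ck s E" "\<forall>t\<in>{0..T}. E t = e t" using ext[of s] by auto
  then show ?thesis using step[of s E] that by (auto simp del: Ck.simps)
qed

section \<open>Picard series for linear equations\<close>

lemma picard_iterate_norm_bound:
  fixes F :: "real \<Rightarrow> 'a::euclidean_space"
  assumes F: "continuous_on {0..T} F" and t: "t \<in> {0..T}"
    and bound: "\<And>\<tau>. \<tau> \<in> {0..T} \<Longrightarrow> norm (F \<tau>) \<le> c * (\<tau> ^ n / fact n)"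
  shows "norm (integral {0..t} F) \<le> c * (t ^ Suc n / fact (Suc n))"
proof -
  have "((\<lambda>\<tau>. c * (\<tau> ^ n / fact n)) has_integral
      c * (t ^ Suc n / fact (Suc n)) - c * (0 ^ Suc n / fact (Suc n))) {0..t}"
  proof (rule fundamental_theorem_of_calculus)
    fix \<tau> :: real
    have "((\<lambda>\<tau>. c * (\<tau> ^ Suc n / fact (Suc n))) has_real_derivative
        c * (real (Suc n) * \<tau> ^ n / fact (Suc n))) (at \<tau> within {0..t})"
      using DERIV_cmult[OF DERIV_cdivide[OF DERIV_pow[of "Suc n" \<tau> "{0..t}"], of "fact (Suc n)"], of c]
      by (simp only: diff_Suc_Suc diff_zero)
    also have "real (Suc n) * \<tau> ^ n / fact (Suc n) = \<tau> ^ n / fact n"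
      by (simp add: divide_simps)
    finally show "((\<lambda>\<tau>. c * (\<tau> ^ Suc n / fact (Suc n))) has_vector_derivative c * (\<tau> ^ n / fact n))
        (at \<tau> within {0..t})"
      by (simp add: has_real_derivative_iff_has_vector_derivative)
  qed (use t in auto)
  then have I: "((\<lambda>\<tau>. c * (\<tau> ^ n / fact n)) has_integral c * (t ^ Suc n / fact (Suc n))) {0..t}"
    by simp
  have "norm (integral {0..t} F) \<le> integral {0..t} (\<lambda>\<tau>. c * (\<tau> ^ n / fact n))"
  proof (rule integral_norm_bound_integral)
    show "F integrable_on {0..t}"
      using F t by (intro integrable_continuous_real) (auto intro: continuous_on_subset)
  qed (use I t bound in \<open>auto intro: has_integral_integrable\<close>)
  then show ?thesis unfolding integral_unique[OF I] .
qed

text \<open>These are the increments of the Picard iterates, not the iterates. For a linear equation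
  the inhomogeneity enters only the zeroth increment.\<close>

primrec picard_term :: "(real \<Rightarrow> 'a \<Rightarrow> 'a) \<Rightarrow> (real \<Rightarrow> 'a) \<Rightarrow> 'a::euclidean_space \<Rightarrow> nat \<Rightarrow> real \<Rightarrow> 'a" where
  "picard_term M d v 0 t = v + integral {0..t} d"
| "picard_term M d v (Suc n) t = integral {0..t} (\<lambda>\<tau>. M \<tau> (picard_term M d v n \<tau>))"

text \<open>Each integration contributes to the factorial, so the n-th increment is at most
  \<open>C * ((K * T) ^ n / fact n)\<close>. The series thus converges on the whole interval however
  long it is, and the same bound permits termwise differentiation.\<close>

lemma linear_ode_solution:
  fixes M :: "real \<Rightarrow> 'a::euclidean_space \<Rightarrow> 'a"
  assumes T: "0 \<le> T" and lin: "\<And>t. linear (M t)"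
    and M: "continuous_on UNIV (\<lambda>z. M (fst z) (snd z))" and d: "continuous_on UNIV d"
  obtains e where "e 0 = v"
    "\<And>t. t \<in> {0..T} \<Longrightarrow> (e has_vector_derivative M t (e t) + d t) (at t within {0..T})"
proof -
  let ?e = "picard_term M d v"
  \<comment> \<open>The derivative of the n-th increment, so that the series of the
    \<open>De n\<close> sums to \<open>M\<close> applied to the solution plus
    \<open>d\<close>.\<close>
  define De where "De n t = (case n of 0 \<Rightarrow> d t | Suc m \<Rightarrow> M t (?e m t))" for n t
  have contM: "continuous_on {0..T} (\<lambda>t. M t (w t))" if "continuous_on {0..T} w" for w
    using continuous_on_compose2[OF M continuous_on_Pair[OF continuous_on_id that]] by simp
  have De: "continuous_on {0..T} (De n) \<and>
      (\<forall>t\<in>{0..T}. (?e n has_vector_derivative De n t) (at t within {0..T}))" for n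
  proof (induction n)
    case 0
    have "continuous_on {0..T} d" using d continuous_on_subset by blast
    then show ?case
      using integral_has_vector_derivative[of 0 T d]
      by (auto simp: De_def[abs_def] intro!: has_vector_derivative_add[OF has_vector_derivative_const, simplified])
  next
    case (Suc n)
    have "continuous_on {0..T} (?e n)"
      using Suc.IH has_vector_derivative_continuous continuous_on_eq_continuous_within by blast
    then have "continuous_on {0..T} (\<lambda>t. M t (?e n t))" by (rule contM)
    then show ?case
      using integral_has_vector_derivative[of 0 T "\<lambda>t. M t (?e n t)"] by (auto simp: De_def[abs_def])
  qed
  have e_cont: "continuous_on {0..T} (?e n)" for n
    using De has_vector_derivative_continuous continuous_on_eq_continuous_within by blast
  obtain K where K: "K > 0" "\<And>z. z \<in> {0..T} \<times> cball 0 1 \<Longrightarrow> norm (M (fst z) (snd z)) \<le> K"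
    using continuous_on_compact_norm_bound[of "{0..T} \<times> cball 0 1",
        OF continuous_on_subset[OF M subset_UNIV] compact_Times[OF compact_Icc compact_cball]] by blast
  have MK: "norm (M t u) \<le> K * norm u" if "t \<in> {0..T}" for t u
  proof -
    have "M t u = norm u *\<^sub>R M t (sgn u)"
      using linear_cmul[OF lin, of t "norm u" "sgn u"] linear_0[OF lin]
      by (cases "u = 0") (simp_all add: sgn_div_norm)
    moreover have "norm (M t (sgn u)) \<le> K"
      using K(2)[of "(t, sgn u)"] that by (simp add: norm_sgn)
    ultimately show ?thesis by (simp add: mult.commute[of K] mult_left_mono)
  qed
  obtain C where C: "C > 0" "\<And>t. t \<in> {0..T} \<Longrightarrow> norm (?e 0 t) \<le> C"
    using continuous_on_compact_norm_bound[OF e_cont[of 0] compact_Icc] by blast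
  have bound: "norm (?e n t) \<le> C * K ^ n * (t ^ n / fact n)" if "t \<in> {0..T}" for n t
    using that
  proof (induction n arbitrary: t)
    case 0
    then show ?case using C(2) by simp
  next
    case (Suc n)
    have "norm (M \<tau> (?e n \<tau>)) \<le> C * K ^ Suc n * (\<tau> ^ n / fact n)" if "\<tau> \<in> {0..T}" for \<tau>
    proof -
      have "norm (M \<tau> (?e n \<tau>)) \<le> K * norm (?e n \<tau>)" by (rule MK[OF that])
      also have "\<dots> \<le> K * (C * K ^ n * (\<tau> ^ n / fact n))"
        using K(1) by (intro mult_left_mono Suc.IH[OF that]) auto
      finally show ?thesis by (simp add: mult_ac)
    qed
    from picard_iterate_norm_bound[OF contM[OF e_cont] Suc.prems this]
    show ?case by simp
  qed
  have boundT: "norm (?e n t) \<le> C * ((K * T) ^ n / fact n)" if "t \<in> {0..T}" for n t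
  proof -
    have "norm (?e n t) \<le> C * K ^ n * (t ^ n / fact n)" by (rule bound[OF that])
    also have "\<dots> \<le> C * K ^ n * (T ^ n / fact n)"
      using that C(1) K(1) by (intro mult_left_mono divide_right_mono power_mono) auto
    finally show ?thesis by (simp add: power_mult_distrib mult_ac)
  qed
  have sumexp: "summable (\<lambda>n. c * ((K * T) ^ n / fact n))" for c
    using summable_exp[of "K * T"] by (intro summable_mult) (simp add: divide_inverse mult.commute)
  obtain Cd where Cd: "Cd > 0" "\<And>t. t \<in> {0..T} \<Longrightarrow> norm (d t) \<le> Cd"
    using continuous_on_compact_norm_bound[OF continuous_on_subset[OF d subset_UNIV] compact_Icc] by blast
  \<comment> \<open>Majorant of the derivatives; the index is shifted by one because
    \<open>De (Suc m)\<close> is \<open>M\<close> applied to increment \<open>m\<close>.\<close>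
  define B where "B n = (case n of 0 \<Rightarrow> Cd | Suc m \<Rightarrow> K * C * ((K * T) ^ m / fact m))" for n
  have "summable (\<lambda>n. B (Suc n))" unfolding B_def using sumexp by simp
  then have "summable B" by (simp only: summable_Suc_iff)
  moreover have "norm (De n t) \<le> B n" if "t \<in> {0..T}" for n t
  proof (cases n)
    case (Suc m)
    have "norm (M t (?e m t)) \<le> K * (C * ((K * T) ^ m / fact m))"
      using MK[OF that, of "?e m t"] mult_left_mono[OF boundT[OF that, of m], of K] K(1) by linarith
    then show ?thesis by (simp add: De_def B_def Suc mult_ac)
  qed (use Cd that in \<open>simp add: De_def B_def\<close>)
  ultimately have unif: "uniform_limit {0..T} (\<lambda>n t. \<Sum>i<n. De i t) (\<lambda>t. suminf (\<lambda>i. De i t)) sequentially"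
    and sumDe: "\<And>t. t \<in> {0..T} \<Longrightarrow> summable (\<lambda>i. De i t)"
    by (auto intro!: Weierstrass_m_test intro: summable_comparison_test')
  have sume: "summable (\<lambda>n. ?e n t)" if "t \<in> {0..T}" for t
    by (rule summable_comparison_test'[OF sumexp[of C], of 0]) (use boundT[OF that] in auto)
  have "\<exists>g. \<forall>t\<in>{0..T}. (\<lambda>n. ?e n t) sums g t \<and>
      (g has_derivative (\<lambda>h. h *\<^sub>R suminf (\<lambda>i. De i t))) (at t within {0..T})"
  proof (rule has_derivative_series[where f'="\<lambda>n t h. h *\<^sub>R De n t" and x=0])
    show "(?e n has_derivative (\<lambda>h. h *\<^sub>R De n t)) (at t within {0..T})" if "t \<in> {0..T}" for n t
      using De that by (auto simp: has_vector_derivative_def)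
    fix \<epsilon> :: real assume "\<epsilon> > 0"
    then have "\<forall>\<^sub>F n in sequentially. \<forall>t\<in>{0..T}. dist (\<Sum>i<n. De i t) (suminf (\<lambda>i. De i t)) < \<epsilon>"
      using unif unfolding uniform_limit_iff by blast
    then show "\<forall>\<^sub>F n in sequentially. \<forall>t\<in>{0..T}. \<forall>h.
        norm ((\<Sum>i<n. h *\<^sub>R De i t) - h *\<^sub>R suminf (\<lambda>i. De i t)) \<le> \<epsilon> * norm h"
    proof eventually_elim
      case (elim n)
      have "norm ((\<Sum>i<n. h *\<^sub>R De i t) - h *\<^sub>R suminf (\<lambda>i. De i t)) \<le> \<epsilon> * norm h"
        if "t \<in> {0..T}" for t h
      proof -
        have "norm ((\<Sum>i<n. De i t) - suminf (\<lambda>i. De i t)) \<le> \<epsilon>"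
          using elim that by (force simp: dist_norm)
        then show ?thesis
          by (simp add: scaleR_sum_right[symmetric] scaleR_diff_right[symmetric]
              mult.commute[of \<epsilon>] mult_left_mono)
      qed
      then show ?case by blast
    qed
  qed (use T sume in \<open>auto intro: summable_sums\<close>)
  then obtain g where g: "\<And>t. t \<in> {0..T} \<Longrightarrow> (\<lambda>n. ?e n t) sums g t"
    "\<And>t. t \<in> {0..T} \<Longrightarrow> (g has_vector_derivative suminf (\<lambda>i. De i t)) (at t within {0..T})"
    unfolding has_vector_derivative_def by blast
  show ?thesis
  proof
    have "?e n 0 = (if n = 0 then v else 0)" for n by (cases n) auto
    then have "(\<lambda>n. if n = 0 then v else 0) sums g 0" using g(1)[of 0] T by simp
    from sums_unique2[OF this sums_single[of 0 "\<lambda>_. v"]] show "g 0 = v" .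
    show "(g has_vector_derivative M t (g t) + d t) (at t within {0..T})" if t: "t \<in> {0..T}" for t
    proof -
      have "(\<lambda>n. M t (?e n t)) sums M t (g t)"
        using bounded_linear.sums[OF linear_conv_bounded_linear[THEN iffD1, OF lin] g(1)[OF t]] by simp
      then have "(\<lambda>n. De (Suc n) t) sums M t (g t)" by (simp add: De_def)
      then have "(\<lambda>n. De n t) sums (M t (g t) + De 0 t)" by (rule sums_Suc)
      then have "suminf (\<lambda>n. De n t) = M t (g t) + d t" by (simp add: sums_iff De_def)
      then show ?thesis using g(2)[OF t] by simp
    qed
  qed
qed

section \<open>Linear recurrences under the root condition\<close>

text \<open>The polynomial \<open>P\<close> evaluated at the shift operator and applied to
  \<open>w\<close>; factorisations of \<open>P\<close> become compositions of difference
  operators.\<close>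

definition poly_shift :: "complex poly \<Rightarrow> (nat \<Rightarrow> complex) \<Rightarrow> nat \<Rightarrow> complex" where
  "poly_shift P w n = (\<Sum>j\<le>degree P. coeff P j * w (n + j))"

lemma poly_shift_altdef:
  assumes "degree P \<le> m"
  shows "poly_shift P w n = (\<Sum>j\<le>m. coeff P j * w (n + j))"
  unfolding poly_shift_def
  by (rule sum.mono_neutral_left) (use assms in \<open>auto simp: coeff_eq_0\<close>)

lemma poly_shift_linear_factor:
  "poly_shift ([:- a, 1:] * Q) w n = poly_shift Q w (Suc n) - a * poly_shift Q w n"
proof -
  have deg: "degree ([:- a, 1:] * Q) \<le> Suc (degree Q)"
    using degree_mult_le[of "[:- a, 1:]" Q] by simp
  have "poly_shift ([:- a, 1:] * Q) w n =
      (\<Sum>j\<le>Suc (degree Q). coeff (pCons 0 Q) j * w (n + j)) - a * (\<Sum>j\<le>Suc (degree Q). coeff Q j * w (n + j))"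
    unfolding poly_shift_altdef[OF deg]
    by (simp add: algebra_simps sum_subtractf sum_distrib_left del: sum.atMost_Suc)
  also have "(\<Sum>j\<le>Suc (degree Q). coeff (pCons 0 Q) j * w (n + j)) = poly_shift Q w (Suc n)"
    unfolding sum.atMost_Suc_shift poly_shift_def by simp
  also have "(\<Sum>j\<le>Suc (degree Q). coeff Q j * w (n + j)) = poly_shift Q w n"
    by (rule poly_shift_altdef[symmetric]) simp
  finally show ?thesis .
qed

text \<open>The linear factor acts first here, as the inductions over factors require: the
  hypothesis for \<open>Q\<close> is applied to the sequence of the
  \<open>w (Suc n) - a * w n\<close>. The opposite order serves to telescope when \<open>a\<close>
  is 1.\<close>

lemma poly_shift_linear_factor':
  "poly_shift ([:- a, 1:] * Q) w n = poly_shift Q (\<lambda>n. w (Suc n) - a * w n) n"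
  unfolding poly_shift_linear_factor
  by (simp add: poly_shift_def algebra_simps sum_subtractf sum_distrib_left)

definition schur_stable :: "complex poly \<Rightarrow> bool" where
  "schur_stable P \<longleftrightarrow> P \<noteq> 0 \<and> (\<forall>z. poly P z = 0 \<longrightarrow> cmod z < 1)"

text \<open>Over the complex numbers a root can be split off until a constant remains, and the
  quotient inherits the root condition.\<close>

lemma schur_stable_induct [consumes 1, case_names const factor]:
  assumes "schur_stable P"
    and const: "\<And>c. c \<noteq> 0 \<Longrightarrow> R [:c:]"
    and factor: "\<And>a Q. cmod a < 1 \<Longrightarrow> schur_stable Q \<Longrightarrow> R Q \<Longrightarrow> R ([:- a, 1:] * Q)"
  shows "R P"
  using assms(1)
proof (induction "degree P" arbitrary: P)
  case 0
  then obtain c where "P = [:c:]" using degree_eq_zeroE by metis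
  then show ?case using 0 const by (auto simp: schur_stable_def)
next
  case (Suc d)
  then have "\<not> constant (poly P)" by (simp add: constant_degree)
  then obtain a where a: "poly P a = 0" using fundamental_theorem_of_algebra by blast
  then obtain Q where Q: "P = [:- a, 1:] * Q" by (auto simp: poly_eq_0_iff_dvd dvd_def)
  have st: "schur_stable Q"
    using Suc.prems unfolding Q schur_stable_def by auto
  have "Q \<noteq> 0" using st by (simp add: schur_stable_def)
  then have "degree P = Suc (degree Q)" unfolding Q by (subst degree_mult_eq) auto
  then have "d = degree Q" using Suc.hyps(2) by simp
  moreover have "cmod a < 1" using Suc.prems a by (simp add: schur_stable_def)
  ultimately show ?case unfolding Q by (intro factor st Suc.hyps(1))
qed

text \<open>Each factor is a first-order recurrence with multiplier \<open>a\<close> inside the unit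
  disk and decaying right-hand side. The new rate must exceed \<open>cmod a\<close> strictly, since
  equal rates could bring in a factor n.\<close>

lemma schur_stable_decay:
  assumes "schur_stable P" "\<And>n. cmod (poly_shift P w n) \<le> C * \<rho> ^ n" "0 \<le> \<rho>" "\<rho> < 1"
  shows "\<exists>C \<rho>. 0 < \<rho> \<and> \<rho> < 1 \<and> (\<forall>n. cmod (w n) \<le> C * \<rho> ^ n)"
  using assms
proof (induction P arbitrary: w C \<rho> rule: schur_stable_induct)
  case (const c)
  have C: "0 \<le> C" using order_trans[OF norm_ge_zero const(2)[of 0]] by simp
  \<comment> \<open>The given rate may be 0 but the resulting one must be positive; the midpoint
    between \<rho> and 1 is positive and still below 1.\<close>
  have "cmod (w n) \<le> (C / cmod c) * ((1 + \<rho>) / 2) ^ n" for n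
  proof -
    have "cmod c * cmod (w n) \<le> C * \<rho> ^ n"
      using const(2)[of n] by (simp add: poly_shift_def norm_mult)
    also have "\<dots> \<le> C * ((1 + \<rho>) / 2) ^ n"
      using const C by (intro mult_left_mono power_mono) auto
    finally show ?thesis using const(1) by (simp add: field_simps)
  qed
  then show ?case
    using const by (intro exI[of _ "C / cmod c"] exI[of _ "(1 + \<rho>) / 2"]) auto
next
  case (factor a Q)
  have "cmod (poly_shift Q (\<lambda>n. w (Suc n) - a * w n) n) \<le> C * \<rho> ^ n" for n
    using factor.prems(1)[of n] by (simp only: poly_shift_linear_factor')
  from factor.IH[OF this factor.prems(2,3)] obtain C' \<rho>' where \<rho>': "0 < \<rho>'" "\<rho>' < 1"
    and v: "\<And>n. cmod (w (Suc n) - a * w n) \<le> C' * \<rho>' ^ n"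
    by auto
  have C': "0 \<le> C'" using order_trans[OF norm_ge_zero v[of 0]] by simp
  define \<sigma> where "\<sigma> = (max (cmod a) \<rho>' + 1) / 2"
  have \<sigma>: "0 < \<sigma>" "\<sigma> < 1" "cmod a < \<sigma>" "\<rho>' \<le> \<sigma>"
    using \<rho>' factor.hyps(1) by (auto simp: \<sigma>_def max_def)
  \<comment> \<open>The first entry of the maximum starts the induction; the second one makes
    \<open>cmod a * D + C' \<le> D * \<sigma>\<close>, which closes it.\<close>
  define D where "D = max (cmod (w 0)) (C' / (\<sigma> - cmod a))"
  have D: "cmod a * D + C' \<le> D * \<sigma>"
  proof -
    have "C' / (\<sigma> - cmod a) \<le> D" by (simp add: D_def)
    then have "C' \<le> D * (\<sigma> - cmod a)" using \<sigma>(3) by (simp add: divide_le_eq)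
    then show ?thesis by (simp add: algebra_simps)
  qed
  have "cmod (w n) \<le> D * \<sigma> ^ n" for n
  proof (induction n)
    case 0
    show ?case by (simp add: D_def)
  next
    case (Suc n)
    have "cmod (w (Suc n)) \<le> cmod a * cmod (w n) + cmod (w (Suc n) - a * w n)"
      using norm_triangle_ineq[of "a * w n" "w (Suc n) - a * w n"] by (simp add: norm_mult)
    also have "\<dots> \<le> cmod a * (D * \<sigma> ^ n) + C' * \<sigma> ^ n"
    proof (intro add_mono mult_left_mono Suc)
      show "cmod (w (Suc n) - a * w n) \<le> C' * \<sigma> ^ n"
        using v[of n] mult_left_mono[OF power_mono[OF \<sigma>(4)], of C' n] C' \<rho>' by linarith
    qed simp
    also have "\<dots> = (cmod a * D + C') * \<sigma> ^ n" by (simp add: algebra_simps)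
    also have "\<dots> \<le> D * \<sigma> * \<sigma> ^ n" using \<sigma> D by (intro mult_right_mono) auto
    finally show ?case by (simp add: mult_ac)
  qed
  then show ?case using \<sigma> by blast
qed

text \<open>A version for finite ranges whose constant depends on \<open>P\<close> alone. Only
  windows ending at or before \<open>M\<close> are controlled, because the recursion of the method
  is known only up to the final time. For each factor the geometric series in \<open>cmod a\<close>
  passes the bound from the difference sequence to \<open>w\<close>.\<close>

lemma schur_stable_bound:
  assumes "schur_stable P"
  shows "\<exists>C\<ge>0. \<forall>w M (S::real) (Z::real). 0 \<le> S \<longrightarrow> 0 \<le> Z \<longrightarrow> (\<forall>j<degree P. cmod (w j) \<le> S) \<longrightarrow>
    (\<forall>i. i + degree P \<le> M \<longrightarrow> cmod (poly_shift P w i) \<le> Z) \<longrightarrow> (\<forall>n\<le>M. cmod (w n) \<le> C * (S + Z))"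
  using assms
proof (induction P rule: schur_stable_induct)
  case (const c)
  show ?case
  proof (intro exI[of _ "1 / cmod c"] conjI allI impI)
    fix w M n and S Z :: real
    assume "0 \<le> S" "0 \<le> Z" "\<forall>i. i + degree [:c:] \<le> M \<longrightarrow> cmod (poly_shift [:c:] w i) \<le> Z" "n \<le> M"
    then have "cmod c * cmod (w n) \<le> S + Z" by (auto simp: poly_shift_def norm_mult)
    then show "cmod (w n) \<le> 1 / cmod c * (S + Z)" using const by (simp add: field_simps)
  qed simp
next
  case (factor a Q)
  obtain C where C: "C \<ge> 0"
    and IH: "\<forall>w M (S::real) (Z::real). 0 \<le> S \<longrightarrow> 0 \<le> Z \<longrightarrow> (\<forall>j<degree Q. cmod (w j) \<le> S) \<longrightarrow>
      (\<forall>i. i + degree Q \<le> M \<longrightarrow> cmod (poly_shift Q w i) \<le> Z) \<longrightarrow> (\<forall>n\<le>M. cmod (w n) \<le> C * (S + Z))"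
    using factor.IH by auto
  have "Q \<noteq> 0" using factor.hyps by (simp add: schur_stable_def)
  then have deg: "degree ([:- a, 1:] * Q) = Suc (degree Q)" by (subst degree_mult_eq) auto
  \<comment> \<open>The differences \<open>w (Suc j) - a * w j\<close> start with size at most
    \<open>2 * S\<close>; division by \<open>1 - cmod a\<close> sums the geometric series.\<close>
  define D where "D = 1 + 2 * C / (1 - cmod a)"
  have pos: "0 \<le> 2 * C / (1 - cmod a)" using C factor.hyps(1) by simp
  show ?case
  proof (intro exI[of _ D] conjI allI impI)
    show "0 \<le> D" unfolding D_def using pos by linarith
    fix w M n and S Z :: real
    assume S: "0 \<le> S" and Z: "0 \<le> Z"
      and w: "\<forall>j<degree ([:- a, 1:] * Q). cmod (w j) \<le> S"
      and z: "\<forall>i. i + degree ([:- a, 1:] * Q) \<le> M \<longrightarrow> cmod (poly_shift ([:- a, 1:] * Q) w i) \<le> Z"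
      and n: "n \<le> M"
    have w': "cmod (w j) \<le> S" if "j \<le> degree Q" for j
      using w that unfolding deg by (simp add: less_Suc_eq_le)
    have v: "cmod (w (Suc m) - a * w m) \<le> C * (2 * S + Z)" if "Suc m \<le> M" for m
    proof (rule IH[rule_format, where w="\<lambda>m. w (Suc m) - a * w m" and M="M - 1"])
      show "cmod (w (Suc j) - a * w j) \<le> 2 * S" if "j < degree Q" for j
      proof -
        have "cmod (w (Suc j) - a * w j) \<le> cmod (w (Suc j)) + cmod a * cmod (w j)"
          using norm_triangle_ineq4[of "w (Suc j)" "a * w j"] by (simp add: norm_mult)
        also have "\<dots> \<le> S + 1 * S"
          using w' that factor.hyps(1) S by (intro add_mono mult_mono) auto
        finally show ?thesis by simp
      qed
      show "cmod (poly_shift Q (\<lambda>m. w (Suc m) - a * w m) i) \<le> Z" if "i + degree Q \<le> M - 1" for i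
      proof -
        have "i + degree ([:- a, 1:] * Q) \<le> M" unfolding deg using \<open>Suc m \<le> M\<close> that by simp
        then have "cmod (poly_shift ([:- a, 1:] * Q) w i) \<le> Z" using z by blast
        then show ?thesis by (simp only: poly_shift_linear_factor')
      qed
    qed (use S Z that in auto)
    have "cmod (w n) \<le> S + C * (2 * S + Z) / (1 - cmod a)"
      using n
    proof (induction n)
      case 0
      have "0 \<le> C * (2 * S + Z) / (1 - cmod a)" using C S Z factor.hyps(1) by simp
      moreover have "cmod (w 0) \<le> S" using w' by simp
      ultimately show ?case by linarith
    next
      case (Suc m)
      \<comment> \<open>The fixed point of the affine map sending x to
        \<open>cmod a * x + C * (2 * S + Z)\<close>.\<close>
      define q where "q = C * (2 * S + Z) / (1 - cmod a)"
      have q: "C * (2 * S + Z) = q * (1 - cmod a)" using factor.hyps(1) by (simp add: q_def)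
      have "cmod (w (Suc m)) \<le> cmod a * cmod (w m) + cmod (w (Suc m) - a * w m)"
        using norm_triangle_ineq[of "a * w m" "w (Suc m) - a * w m"] by (simp add: norm_mult)
      also have "\<dots> \<le> cmod a * (S + q) + q * (1 - cmod a)"
      proof (intro add_mono mult_left_mono)
        show "cmod (w m) \<le> S + q" using Suc by (simp add: q_def)
        show "cmod (w (Suc m) - a * w m) \<le> q * (1 - cmod a)"
          unfolding q[symmetric] using v Suc.prems by blast
      qed simp
      also have "\<dots> = cmod a * S + q" by (simp add: algebra_simps)
      also have "\<dots> \<le> S + q" using factor.hyps(1) S by (simp add: mult_left_le_one_le)
      finally show ?case by (simp add: q_def)
    qed
    also have "\<dots> \<le> D * (S + Z)"
    proof -
      have "C * (2 * S + Z) / (1 - cmod a) \<le> C * (2 * (S + Z)) / (1 - cmod a)"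
        using C Z factor.hyps(1) by (intro divide_right_mono mult_left_mono) auto
      then show ?thesis using Z by (simp add: D_def algebra_simps add_divide_distrib)
    qed
    finally show "cmod (w n) \<le> D * (S + Z)" .
  qed
qed

section \<open>The characteristic polynomial of the method and its companion matrix\<close>

definition rho_poly :: "nat \<Rightarrow> (nat \<Rightarrow> real) \<Rightarrow> complex poly" where
  "rho_poly k \<alpha> = (\<Sum>j\<le>k. monom (complex_of_real (\<alpha> j)) j)"

lemma coeff_rho_poly: "coeff (rho_poly k \<alpha>) j = (if j \<le> k then complex_of_real (\<alpha> j) else 0)"
  by (simp add: rho_poly_def coeff_sum)

lemma degree_rho_poly: "\<alpha> k \<noteq> 0 \<Longrightarrow> degree (rho_poly k \<alpha>) = k"
  by (intro antisym degree_le le_degree) (auto simp: coeff_rho_poly)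

text \<open>The matrix z I - A for the companion matrix A of a monic polynomial with lower
  coefficients \<open>a\<close>. The entries come from an arbitrary commutative ring, so that
  \<open>z\<close> may be the indeterminate of a polynomial ring.\<close>

definition companion_char_mat :: "nat \<Rightarrow> 'a::comm_ring_1 \<Rightarrow> (nat \<Rightarrow> 'a) \<Rightarrow> 'a Matrix.mat" where
  "companion_char_mat k z a = Matrix.mat k k (\<lambda>(i, j).
     if i = 0 then (if j = 0 then z else 0) + a (k - 1 - j)
     else if i = j + 1 then - 1 else if i = j then z else 0)"

text \<open>Laplace expansion along the last column, where only the first and last entries can be
  nonzero. Deleting the last row and column leaves the same kind of matrix with shifted
  coefficients. Deleting the first row instead leaves a triangular matrix with -1 on the diagonal,
  whose determinant cancels the sign of the cofactor.\<close>

lemma det_companion_char_mat: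
  fixes z :: "'a::comm_ring_1"
  shows "Determinant.det (companion_char_mat (Suc k) z a) = z ^ Suc k + (\<Sum>j\<le>k. a j * z ^ j)"
proof (induction k arbitrary: a)
  case 0
  have "companion_char_mat (Suc 0) z a \<in> carrier_mat 1 1" by (simp add: companion_char_mat_def)
  then show ?case by (simp add: det_single companion_char_mat_def)
next
  case (Suc k)
  let ?n = "Suc (Suc k)"
  let ?A = "companion_char_mat ?n z a"
  let ?B = "mat_delete ?A 0 (Suc k)"
  have A: "?A \<in> carrier_mat ?n ?n" by (simp add: companion_char_mat_def)
  have "Determinant.det ?A = (\<Sum>i<?n. ?A $$ (i, Suc k) * cofactor ?A i (Suc k))"
    by (rule laplace_expansion_column[OF A]) simp
  also have "\<dots> = (\<Sum>i\<in>{0, Suc k}. ?A $$ (i, Suc k) * cofactor ?A i (Suc k))"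
    by (rule sum.mono_neutral_right) (auto simp: companion_char_mat_def)
  also have "\<dots> = a 0 * cofactor ?A 0 (Suc k) + z * cofactor ?A (Suc k) (Suc k)"
    by (simp add: companion_char_mat_def)
  also have "cofactor ?A (Suc k) (Suc k) = z ^ Suc k + (\<Sum>j\<le>k. a (Suc j) * z ^ j)"
  proof -
    have "mat_delete ?A (Suc k) (Suc k) = companion_char_mat (Suc k) z (\<lambda>j. a (Suc j))"
      by (rule eq_matI) (auto simp: companion_char_mat_def mat_delete_def Suc_diff_le)
    moreover have "(- 1 :: 'a) ^ (Suc k + Suc k) = 1"
      by (simp only: mult_2[symmetric] power_mult) simp
    ultimately show ?thesis unfolding cofactor_def using Suc.IH by simp
  qed
  also have "cofactor ?A 0 (Suc k) = 1"
  proof -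
    have B: "?B \<in> carrier_mat (Suc k) (Suc k)" by (simp add: companion_char_mat_def mat_delete_def)
    have entry: "?B $$ (i, j) = (if i = j then - 1 else if Suc i = j then z else 0)"
      if "i < Suc k" "j < Suc k" for i j
      using that by (auto simp: companion_char_mat_def mat_delete_def)
    have "Determinant.det ?B = prod_list (diag_mat ?B)"
      by (rule det_upper_triangular[OF _ B]) (use B entry in \<open>auto simp: upper_triangular_def\<close>)
    also have "diag_mat ?B = map (\<lambda>i. - 1) [0..<Suc k]"
      unfolding diag_mat_def using B entry by (intro map_cong) auto
    also have "prod_list \<dots> = (- 1) ^ Suc k"
      by (simp only: map_replicate_const prod_list_replicate length_upt diff_zero)
    finally have "cofactor ?A 0 (Suc k) = (- 1) ^ Suc k * (- 1) ^ Suc k"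
      unfolding cofactor_def by simp
    also have "\<dots> = 1" by (simp only: power_mult_distrib[symmetric]) simp
    finally show ?thesis .
  qed
  finally show ?case
    by (simp only: sum.atMost_Suc_shift) (simp add: algebra_simps sum_distrib_left)
qed

lemma char_poly_companion:
  assumes "k \<ge> 1" "\<alpha> k \<noteq> 0"
  shows "Polynomial.smult (complex_of_real (\<alpha> k)) (char_poly (companion k \<alpha>)) = rho_poly k \<alpha>"
proof -
  obtain m where m: "k = Suc m" using assms by (cases k) auto
  define a where "a j = [:complex_of_real (\<alpha> j / \<alpha> k):]" for j
  have "char_poly_matrix (companion k \<alpha>) = companion_char_mat k [:0, 1:] a"
    by (rule eq_matI)
      (auto simp: char_poly_matrix_def companion_def companion_char_mat_def a_def m one_pCons)
  then have "char_poly (companion k \<alpha>) = [:0, 1:] ^ k + (\<Sum>j\<le>m. a j * [:0, 1:] ^ j)"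
    by (simp only: char_poly_def m det_companion_char_mat)
  also have "\<dots> = monom 1 k + (\<Sum>j\<le>m. monom (complex_of_real (\<alpha> j / \<alpha> k)) j)"
    by (simp add: a_def monom_altdef)
  finally have "char_poly (companion k \<alpha>) = \<dots>" .
  then have "Polynomial.smult (complex_of_real (\<alpha> k)) (char_poly (companion k \<alpha>)) =
      monom (complex_of_real (\<alpha> k)) k + (\<Sum>j\<le>m. monom (complex_of_real (\<alpha> j)) j)"
    using assms(2) by (simp add: smult_add_right smult_monom smult_sum2)
  then show ?thesis by (simp add: rho_poly_def m)
qed

text \<open>The root 1 is simple, so it is not a root of \<open>Q\<close>, and no other root lies on
  the unit circle. The recurrence thereby splits into a pure summation, the factor for 1, and a
  strictly stable operator \<open>Q\<close>.\<close>

lemma rho_poly_factor: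
  assumes "k \<ge> 1" "\<alpha> k \<noteq> 0" "eigenvalue_condition (companion k \<alpha>)"
  obtains Q where "rho_poly k \<alpha> = [:- 1, 1:] * Q" "schur_stable Q" "poly Q 1 \<noteq> 0"
    "Suc (degree Q) = k"
proof -
  let ?A = "companion k \<alpha>" and ?P = "rho_poly k \<alpha>"
  have A: "?A \<in> carrier_mat k k" by (simp add: companion_def)
  have P0: "?P \<noteq> 0" using degree_rho_poly[where k=k and \<alpha>=\<alpha>, OF assms(2)] assms(1) by auto
  have root: "eigenvalue ?A z" if "poly ?P z = 0" for z
    using that assms(2)
    by (simp add: eigenvalue_root_char_poly[OF A] char_poly_companion[where k=k and \<alpha>=\<alpha>, OF assms(1,2), symmetric])
  have ord: "Polynomial.order 1 ?P = 1"
    using assms(2,3) by (simp add: char_poly_companion[where k=k and \<alpha>=\<alpha>, OF assms(1,2), symmetric] order_smult eigenvalue_condition_def)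
  obtain Q where Q: "?P = [:- 1, 1:] * Q" "\<not> [:- 1, 1:] dvd Q"
    using order_decomp[OF P0, of 1] by (auto simp: ord)
  have Q1: "poly Q 1 \<noteq> 0" using Q(2) by (simp add: poly_eq_0_iff_dvd)
  have "Q \<noteq> 0" using Q1 by auto
  show ?thesis
  proof
    show "schur_stable Q"
      unfolding schur_stable_def
    proof (intro conjI allI impI)
      fix z assume z: "poly Q z = 0"
      then have "eigenvalue ?A z" by (intro root) (simp add: Q(1))
      then have "cmod z \<le> 1" "cmod z = 1 \<Longrightarrow> z = 1"
        using assms(3) by (auto simp: eigenvalue_condition_def)
      then show "cmod z < 1" using z Q1 by fastforce
    qed fact
    have "degree ?P = Suc (degree Q)" unfolding Q(1) using \<open>Q \<noteq> 0\<close> by (subst degree_mult_eq) auto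
    then show "Suc (degree Q) = k" using degree_rho_poly[where k=k and \<alpha>=\<alpha>, OF assms(2)] by simp
  qed fact+
qed

section \<open>Stability and limits of vector recurrences\<close>

lemma poly_shift_rho_poly_component:
  fixes w :: "nat \<Rightarrow> 'a::euclidean_space"
  assumes "\<alpha> k \<noteq> 0"
  shows "poly_shift (rho_poly k \<alpha>) (\<lambda>n. of_real (inner (w n) b)) n =
    of_real (inner (\<Sum>j\<le>k. \<alpha> j *\<^sub>R w (n + j)) b)"
  using degree_rho_poly[where k=k and \<alpha>=\<alpha>, OF assms]
  by (simp add: poly_shift_def coeff_rho_poly inner_sum_left)

text \<open>In each coordinate the residual is the increment of \<open>poly_shift Q\<close>, so that
  sequence is bounded by its initial value plus the sum of the residuals; the stable operator
  \<open>Q\<close> then passes the bound on to \<open>w\<close>. The indices below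
  \<open>M + 1 - k\<close> are those of the windows that end at or before \<open>M\<close>.\<close>

lemma recurrence_stability:
  assumes "k \<ge> 1" "\<alpha> k \<noteq> 0" "eigenvalue_condition (companion k \<alpha>)"
  shows "\<exists>C\<ge>0. \<forall>(w :: nat \<Rightarrow> 'a::euclidean_space) S M. (\<forall>j<k. norm (w j) \<le> S) \<longrightarrow>
    norm (w M) \<le> C * (S + (\<Sum>i<M + 1 - k. norm (\<Sum>j\<le>k. \<alpha> j *\<^sub>R w (i + j))))"
proof -
  obtain Q where Q: "rho_poly k \<alpha> = [:- 1, 1:] * Q" "schur_stable Q" "Suc (degree Q) = k"
    using rho_poly_factor[where k=k and \<alpha>=\<alpha>, OF assms] by blast
  obtain C where C: "C \<ge> 0"
    and bnd: "\<forall>w M (S::real) (Z::real). 0 \<le> S \<longrightarrow> 0 \<le> Z \<longrightarrow> (\<forall>j<degree Q. cmod (w j) \<le> S) \<longrightarrow>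
      (\<forall>i. i + degree Q \<le> M \<longrightarrow> cmod (poly_shift Q w i) \<le> Z) \<longrightarrow> (\<forall>n\<le>M. cmod (w n) \<le> C * (S + Z))"
    using schur_stable_bound[OF Q(2)] by auto
  \<comment> \<open>Bounds \<open>poly_shift Q\<close> at index 0 by the starting values; its window
    consists of exactly the first \<open>k\<close> of them.\<close>
  define c where "c = (\<Sum>j\<le>degree Q. cmod (coeff Q j))"
  have c: "0 \<le> c" by (simp add: c_def sum_nonneg)
  have "norm (w M) \<le> real DIM('a) * (C * (1 + c)) * (S + (\<Sum>i<M + 1 - k. norm (\<Sum>j\<le>k. \<alpha> j *\<^sub>R w (i + j))))"
    if start: "\<forall>j<k. norm (w j) \<le> S" for w :: "nat \<Rightarrow> 'a" and S M
  proof -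
    define r where "r i = (\<Sum>j\<le>k. \<alpha> j *\<^sub>R w (i + j))" for i
    define R where "R = (\<Sum>i<M + 1 - k. norm (r i))"
    have R: "0 \<le> R" by (simp add: R_def sum_nonneg)
    have S: "0 \<le> S" using order_trans[OF norm_ge_zero start[rule_format, of 0]] assms(1) by simp
    have comp: "\<bar>inner (w M) b\<bar> \<le> C * (1 + c) * (S + R)" if b: "b \<in> Basis" for b
    proof -
      define u where "u n = complex_of_real (inner (w n) b)" for n
      have u_le: "cmod (u n) \<le> norm (w n)" for n
        using Basis_le_norm[OF b] by (simp add: u_def)
      have z0: "cmod (poly_shift Q u 0) \<le> c * S"
      proof -
        have "cmod (poly_shift Q u 0) \<le> (\<Sum>j\<le>degree Q. cmod (coeff Q j * u j))"
          unfolding poly_shift_def by (simp add: norm_sum)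
        also have "\<dots> \<le> (\<Sum>j\<le>degree Q. cmod (coeff Q j) * S)"
        proof (rule sum_mono)
          fix j assume "j \<in> {..degree Q}"
          then have "norm (w j) \<le> S" using start Q(3) by auto
          then show "cmod (coeff Q j * u j) \<le> cmod (coeff Q j) * S"
            unfolding norm_mult using u_le[of j] by (intro mult_left_mono) auto
        qed
        finally show ?thesis by (simp add: c_def sum_distrib_right)
      qed
      have incr: "cmod (poly_shift Q u (Suc i) - poly_shift Q u i) \<le> norm (r i)" for i
      proof -
        have "poly_shift Q u (Suc i) - poly_shift Q u i = of_real (inner (r i) b)"
          using poly_shift_linear_factor[of 1 Q u i] poly_shift_rho_poly_component[where k=k and \<alpha>=\<alpha> and w=w and n=i and b=b, OF assms(2)]
          by (simp only: Q(1) u_def[abs_def] r_def mult_1)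
        then show ?thesis using Basis_le_norm[OF b, of "r i"] by simp
      qed
      have z: "cmod (poly_shift Q u i) \<le> c * S + (\<Sum>m<i. norm (r m))" for i
      proof (induction i)
        case (Suc i)
        have "cmod (poly_shift Q u (Suc i)) \<le>
            cmod (poly_shift Q u i) + cmod (poly_shift Q u (Suc i) - poly_shift Q u i)"
          using norm_triangle_ineq[of "poly_shift Q u i" "poly_shift Q u (Suc i) - poly_shift Q u i"] by simp
        then show ?case using Suc incr[of i] by simp
      qed (use z0 in simp)
      have zR: "cmod (poly_shift Q u i) \<le> c * S + R" if "i + degree Q \<le> M" for i
      proof -
        have "(\<Sum>m<i. norm (r m)) \<le> R"
          unfolding R_def using that Q(3) by (intro sum_mono2) auto
        then show ?thesis using z[of i] by linarith
      qed
      have "cmod (u M) \<le> C * (S + (c * S + R))"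
      proof (rule bnd[rule_format, where w=u and M=M])
        show "cmod (u j) \<le> S" if "j < degree Q" for j
          using order_trans[OF u_le[of j] start[rule_format, of j]] that Q(3) by simp
      qed (use S c R zR in auto)
      also have "\<dots> \<le> C * ((1 + c) * (S + R))"
        using C c R by (intro mult_left_mono) (auto simp: algebra_simps)
      finally show ?thesis by (simp add: u_def mult.assoc)
    qed
    have "norm (w M) \<le> (\<Sum>b\<in>Basis. \<bar>inner (w M) b\<bar>)" by (rule norm_le_l1)
    also have "\<dots> \<le> (\<Sum>b\<in>(Basis::'a set). C * (1 + c) * (S + R))" by (rule sum_mono) (rule comp)
    finally show ?thesis by (simp add: R_def r_def mult.assoc)
  qed
  then show ?thesis using C c by (intro exI[of _ "real DIM('a) * (C * (1 + c))"]) auto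
qed

lemma geometric_increments_limit:
  fixes z :: "nat \<Rightarrow> complex"
  assumes "\<And>n. cmod (z (Suc n) - z n) \<le> C * \<rho> ^ n" "0 \<le> \<rho>" "\<rho> < 1"
  obtains \<zeta> where "\<And>n. cmod (z n - \<zeta>) \<le> C / (1 - \<rho>) * \<rho> ^ n"
proof -
  define d where "d n = z (Suc n) - z n" for n
  have geo: "(\<lambda>i. C * \<rho> ^ (i + n)) sums (C / (1 - \<rho>) * \<rho> ^ n)" for n
    using sums_mult[OF geometric_sums[of \<rho>], of "C * \<rho> ^ n"] assms by (simp add: power_add mult_ac)
  have sd: "summable (\<lambda>i. norm (d (i + n)))" for n
    by (rule summable_comparison_test'[OF sums_summable[OF geo[of n]], of 0]) (use assms in \<open>simp add: d_def\<close>)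
  have "cmod (z n - (z 0 + suminf d)) \<le> C / (1 - \<rho>) * \<rho> ^ n" for n
  proof -
    have "suminf d = (\<Sum>i. d (i + n)) + (\<Sum>i<n. d i)"
      by (rule suminf_split_initial_segment) (use summable_norm_cancel[OF sd[of 0]] in simp)
    moreover have "(\<Sum>i<n. d i) = z n - z 0" unfolding d_def by (rule sum_lessThan_telescope)
    ultimately have "cmod (z n - (z 0 + suminf d)) = cmod (\<Sum>i. d (i + n))"
      by (simp add: norm_minus_commute algebra_simps)
    also have "\<dots> \<le> (\<Sum>i. norm (d (i + n)))" by (rule summable_norm[OF sd])
    also have "\<dots> \<le> (\<Sum>i. C * \<rho> ^ (i + n))"
      by (rule suminf_le[OF _ sd sums_summable[OF geo]]) (use assms in \<open>simp add: d_def\<close>)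
    also have "\<dots> = C / (1 - \<rho>) * \<rho> ^ n" using geo sums_unique by metis
    finally show ?thesis .
  qed
  then show ?thesis using that by blast
qed

text \<open>The factor for the root 1 only sums a decaying right-hand side, so
  \<open>poly_shift Q\<close> has a limit, approached geometrically. On constant sequences the
  operator \<open>Q\<close> is multiplication by \<open>poly Q 1\<close>, which tells the limit of
  \<open>v\<close>. After subtraction of that constant the stable operator applies.\<close>

lemma recurrence_limit:
  fixes v :: "nat \<Rightarrow> 'a::euclidean_space"
  assumes "k \<ge> 1" "\<alpha> k \<noteq> 0" "eigenvalue_condition (companion k \<alpha>)"
    and decay: "\<And>n. norm (\<Sum>j\<le>k. \<alpha> j *\<^sub>R v (n + j)) \<le> C * \<rho> ^ n" and \<rho>: "0 \<le> \<rho>" "\<rho> < 1"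
  shows "\<exists>\<xi> C \<rho>. 0 < \<rho> \<and> \<rho> < 1 \<and> (\<forall>n. norm (v n - \<xi>) \<le> C * \<rho> ^ n)"
proof -
  obtain Q where Q: "rho_poly k \<alpha> = [:- 1, 1:] * Q" "schur_stable Q" "poly Q 1 \<noteq> 0"
    using rho_poly_factor[where k=k and \<alpha>=\<alpha>, OF assms(1-3)] by blast
  have comp: "\<exists>\<xi> C \<rho>. 0 < \<rho> \<and> \<rho> < 1 \<and> (\<forall>n. \<bar>inner (v n) b - \<xi>\<bar> \<le> C * \<rho> ^ n)"
    if b: "b \<in> Basis" for b
  proof -
    define u where "u n = complex_of_real (inner (v n) b)" for n
    have incr: "cmod (poly_shift Q u (Suc i) - poly_shift Q u i) \<le> C * \<rho> ^ i" for i
    proof -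
      have "poly_shift Q u (Suc i) - poly_shift Q u i = of_real (inner (\<Sum>j\<le>k. \<alpha> j *\<^sub>R v (i + j)) b)"
        using poly_shift_linear_factor[of 1 Q u i] poly_shift_rho_poly_component[where k=k and \<alpha>=\<alpha> and w=v and n=i and b=b, OF assms(2)]
        by (simp only: Q(1) u_def[abs_def] mult_1)
      then show ?thesis using Basis_le_norm[OF b, of "\<Sum>j\<le>k. \<alpha> j *\<^sub>R v (i + j)"] decay[of i] by simp
    qed
    obtain \<zeta> where \<zeta>: "\<And>n. cmod (poly_shift Q u n - \<zeta>) \<le> C / (1 - \<rho>) * \<rho> ^ n"
      using geometric_increments_limit[OF incr \<rho>] by blast
    define \<xi> where "\<xi> = \<zeta> / poly Q 1"
    have "poly_shift Q (\<lambda>n. u n - \<xi>) n = poly_shift Q u n - poly Q 1 * \<xi>" for n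
      by (simp add: poly_shift_def poly_altdef algebra_simps sum_subtractf sum_distrib_left)
    then have "cmod (poly_shift Q (\<lambda>n. u n - \<xi>) n) \<le> C / (1 - \<rho>) * \<rho> ^ n" for n
      using \<zeta>[of n] Q(3) by (simp add: \<xi>_def)
    from schur_stable_decay[OF Q(2) this \<rho>] obtain C' \<rho>' where
      "0 < \<rho>'" "\<rho>' < 1" and u: "\<And>n. cmod (u n - \<xi>) \<le> C' * \<rho>' ^ n" by auto
    moreover have "\<bar>inner (v n) b - Re \<xi>\<bar> \<le> C' * \<rho>' ^ n" for n
      using order_trans[OF abs_Re_le_cmod u[of n]] by (simp add: u_def)
    ultimately show ?thesis by blast
  qed
  then obtain \<xi> C \<rho> where lim: "\<And>b. b \<in> Basis \<Longrightarrow>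
      0 < \<rho> b \<and> \<rho> b < 1 \<and> (\<forall>n. \<bar>inner (v n) b - \<xi> b\<bar> \<le> C b * \<rho> b ^ n)"
    by metis
  \<comment> \<open>The slowest rate over the coordinates serves the whole vector.\<close>
  define r where "r = Max (\<rho> ` (Basis :: 'a set))"
  have "r \<in> \<rho> ` (Basis :: 'a set)" unfolding r_def by (rule Max_in) auto
  then have r: "0 < r" "r < 1" using lim by auto
  have r_ge: "\<rho> b \<le> r" if "b \<in> Basis" for b unfolding r_def using that by simp
  have C: "0 \<le> C b" if "b \<in> Basis" for b
  proof -
    have "\<bar>inner (v 0) b - \<xi> b\<bar> \<le> C b * \<rho> b ^ 0" using lim[OF that] by blast
    then show ?thesis by simp
  qed
  have "norm (v n - (\<Sum>b\<in>Basis. \<xi> b *\<^sub>R b)) \<le> (\<Sum>b\<in>Basis. C b) * r ^ n" for n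
  proof -
    have "norm (v n - (\<Sum>b\<in>Basis. \<xi> b *\<^sub>R b)) \<le>
        (\<Sum>b\<in>Basis. \<bar>inner (v n - (\<Sum>b\<in>Basis. \<xi> b *\<^sub>R b)) b\<bar>)" by (rule norm_le_l1)
    also have "\<dots> \<le> (\<Sum>b\<in>Basis. C b * r ^ n)"
    proof (rule sum_mono)
      fix b :: 'a assume b: "b \<in> Basis"
      have "\<bar>inner (v n) b - \<xi> b\<bar> \<le> C b * \<rho> b ^ n" using lim[OF b] by blast
      also have "\<dots> \<le> C b * r ^ n"
        using C[OF b] lim[OF b] r_ge[OF b] by (intro mult_left_mono power_mono) auto
      finally show "\<bar>inner (v n - (\<Sum>b\<in>Basis. \<xi> b *\<^sub>R b)) b\<bar> \<le> C b * r ^ n"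
        using b by (simp add: inner_diff_left inner_sum_left_Basis)
    qed
    finally show ?thesis by (simp add: sum_distrib_right)
  qed
  then show ?thesis using r by blast
qed

text \<open>The sum is the derivative of \<open>rho_poly\<close> at 1. Applying the operator to the
  sequence n, whose differences are 1, shows that it equals \<open>poly Q 1\<close>. Consistency
  later identifies it with the sum of the \<beta>_j.\<close>

lemma rho_poly_derivative_nonzero:
  assumes "k \<ge> 1" "\<alpha> k \<noteq> 0" "eigenvalue_condition (companion k \<alpha>)"
  shows "(\<Sum>j\<le>k. \<alpha> j * real j) \<noteq> 0"
proof
  assume 0: "(\<Sum>j\<le>k. \<alpha> j * real j) = 0"
  obtain Q where Q: "rho_poly k \<alpha> = [:- 1, 1:] * Q" "poly Q 1 \<noteq> 0"
    using rho_poly_factor[where k=k and \<alpha>=\<alpha>, OF assms] by blast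
  have "poly_shift (rho_poly k \<alpha>) of_nat 0 = complex_of_real (\<Sum>j\<le>k. \<alpha> j * real j)"
    using degree_rho_poly[where k=k and \<alpha>=\<alpha>, OF assms(2)] by (simp add: poly_shift_def coeff_rho_poly)
  moreover have "poly_shift (rho_poly k \<alpha>) of_nat 0 = poly Q 1"
    unfolding Q(1) poly_shift_linear_factor'
    by (simp add: poly_shift_def poly_altdef)
  ultimately show False using 0 Q(2) by simp
qed

section \<open>Expansions in the step size\<close>

text \<open>A pointwise notion: when it is used at an index or a time, both the constant and the
  range of h may depend on that index or time.\<close>

definition order_at_0 :: "nat \<Rightarrow> (real \<Rightarrow> 'a::real_normed_vector) \<Rightarrow> bool" where
  "order_at_0 q \<phi> \<longleftrightarrow> (\<exists>C. \<forall>\<^sub>F h in at_right 0. norm (\<phi> h) \<le> C * h ^ q)"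

lemma eventually_at_right_0: "(\<forall>h::real. 0 < h \<longrightarrow> h < b \<longrightarrow> P h) \<Longrightarrow> 0 < b \<Longrightarrow> eventually P (at_right 0)"
  unfolding eventually_at_right_field by blast

lemma order_at_0I:
  "(\<And>h. 0 < h \<Longrightarrow> h < b \<Longrightarrow> norm (\<phi> h) \<le> C * h ^ q) \<Longrightarrow> 0 < b \<Longrightarrow> order_at_0 q \<phi>"
  unfolding order_at_0_def by (intro exI[of _ C] eventually_at_right_0[of b]) auto

text \<open>At a fixed index the grid constraint holds for every sufficiently small h.\<close>

lemma order_at_0_grid:
  assumes "0 < T" "\<And>h. 0 < h \<Longrightarrow> h \<le> 1 \<Longrightarrow> real n * h \<le> T \<Longrightarrow> norm (\<phi> h) \<le> C * h ^ q"
  shows "order_at_0 q \<phi>"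
proof (rule order_at_0I[of "min 1 (T / (real n + 1))" _ C])
  fix h assume h: "0 < h" "h < min 1 (T / (real n + 1))"
  have "real n * h \<le> (real n + 1) * h" using h by simp
  also have "\<dots> \<le> T" using h by (simp add: field_simps)
  finally show "norm (\<phi> h) \<le> C * h ^ q" using assms(2)[of h] h by simp
qed (use assms(1) in simp)

lemma order_at_0D:
  assumes "order_at_0 q \<phi>"
  obtains C b where "0 \<le> C" "0 < b" "b \<le> 1" "\<And>h. 0 < h \<Longrightarrow> h < b \<Longrightarrow> norm (\<phi> h) \<le> C * h ^ q"
proof -
  obtain C b where b: "0 < b" "\<And>h. 0 < h \<Longrightarrow> h < b \<Longrightarrow> norm (\<phi> h) \<le> C * h ^ q"
    using assms unfolding order_at_0_def eventually_at_right_field by blast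
  have "norm (\<phi> h) \<le> max C 0 * h ^ q" if "0 < h" "h < min b 1" for h
    by (rule order_trans[OF b(2) mult_right_mono]) (use that in auto)
  then show ?thesis using b(1) by (intro that[of "max C 0" "min b 1"]) auto
qed

lemma order_at_0_cong:
  assumes "order_at_0 q \<phi>" "0 < b" "\<And>h. 0 < h \<Longrightarrow> h < b \<Longrightarrow> \<phi> h = \<psi> h"
  shows "order_at_0 q \<psi>"
proof -
  obtain C where "\<forall>\<^sub>F h in at_right 0. norm (\<phi> h) \<le> C * h ^ q"
    using assms(1) unfolding order_at_0_def by blast
  moreover have "\<forall>\<^sub>F h in at_right 0. \<phi> h = \<psi> h"
    using assms by (intro eventually_at_right_0[of b]) auto
  ultimately have "\<forall>\<^sub>F h in at_right 0. norm (\<psi> h) \<le> C * h ^ q"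
    by eventually_elim simp
  then show ?thesis unfolding order_at_0_def by blast
qed

lemma order_at_0_add:
  assumes "order_at_0 q \<phi>" "order_at_0 q \<psi>"
  shows "order_at_0 q (\<lambda>h. \<phi> h + \<psi> h)"
proof -
  obtain C D where "\<forall>\<^sub>F h in at_right 0. norm (\<phi> h) \<le> C * h ^ q"
    "\<forall>\<^sub>F h in at_right 0. norm (\<psi> h) \<le> D * h ^ q"
    using assms unfolding order_at_0_def by blast
  then have "\<forall>\<^sub>F h in at_right 0. norm (\<phi> h + \<psi> h) \<le> (C + D) * h ^ q"
    by eventually_elim (simp add: distrib_right norm_triangle_mono)
  then show ?thesis unfolding order_at_0_def by blast
qed

lemma order_at_0_bounded_linear:
  assumes "bounded_linear L" "order_at_0 q \<phi>"
  shows "order_at_0 q (\<lambda>h. L (\<phi> h))"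
proof -
  obtain C where C: "\<forall>\<^sub>F h in at_right 0. norm (\<phi> h) \<le> C * h ^ q"
    using assms(2) unfolding order_at_0_def by blast
  obtain K where K: "K > 0" "\<And>x. norm (L x) \<le> norm x * K"
    using bounded_linear.pos_bounded[OF assms(1)] by blast
  from C have "\<forall>\<^sub>F h in at_right 0. norm (L (\<phi> h)) \<le> (C * K) * h ^ q"
  proof eventually_elim
    case (elim h)
    have "norm (L (\<phi> h)) \<le> C * h ^ q * K"
      by (rule order_trans[OF K(2) mult_right_mono[OF elim]]) (use K(1) in simp)
    then show ?case by (simp add: mult_ac)
  qed
  then show ?thesis unfolding order_at_0_def by blast
qed

lemma order_at_0_minus: "order_at_0 q \<phi> \<Longrightarrow> order_at_0 q (\<lambda>h. - \<phi> h)"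
  by (rule order_at_0_bounded_linear[OF bounded_linear_minus[OF bounded_linear_ident]])

lemma order_at_0_diff:
  "order_at_0 q \<phi> \<Longrightarrow> order_at_0 q \<psi> \<Longrightarrow> order_at_0 q (\<lambda>h. \<phi> h - \<psi> h)"
  using order_at_0_add[OF _ order_at_0_minus] by force

lemma order_at_0_zero: "order_at_0 q (\<lambda>h. 0)"
  by (rule order_at_0I[of 1 _ 0]) auto

lemma order_at_0_sum: "(\<And>i. i \<in> I \<Longrightarrow> order_at_0 q (\<phi> i)) \<Longrightarrow> order_at_0 q (\<lambda>h. \<Sum>i\<in>I. \<phi> i h)"
  by (induction I rule: infinite_finite_induct) (auto intro: order_at_0_zero order_at_0_add)

lemma order_at_0_mult:
  assumes "order_at_0 q \<phi>" "order_at_0 r \<psi>"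
  shows "order_at_0 (q + r) (\<lambda>h. \<phi> h *\<^sub>R \<psi> h)"
proof -
  obtain C b where C: "0 \<le> C" "0 < b" "\<And>h. 0 < h \<Longrightarrow> h < b \<Longrightarrow> norm (\<phi> h) \<le> C * h ^ q"
    by (rule order_at_0D[OF assms(1)]) (rule that; (assumption | simp))
  obtain D c where D: "0 \<le> D" "0 < c" "\<And>h. 0 < h \<Longrightarrow> h < c \<Longrightarrow> norm (\<psi> h) \<le> D * h ^ r"
    by (rule order_at_0D[OF assms(2)]) (rule that; (assumption | simp))
  show ?thesis
  proof (rule order_at_0I[of "min b c" _ "C * D"])
    fix h :: real assume h: "0 < h" "h < min b c"
    have "norm (\<phi> h) * norm (\<psi> h) \<le> (C * h ^ q) * (D * h ^ r)"
      by (rule mult_mono[OF C(3) D(3)]) (use C(1) h in auto)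
    then show "norm (\<phi> h *\<^sub>R \<psi> h) \<le> C * D * h ^ (q + r)" by (simp add: power_add mult_ac)
  qed (use C D in auto)
qed

lemma order_at_0_power: "order_at_0 q (\<lambda>h. h ^ q)"
  by (rule order_at_0I[of 1 _ 1]) auto

lemma order_at_0_mono:
  assumes "order_at_0 q \<phi>" "r \<le> q"
  shows "order_at_0 r \<phi>"
proof -
  obtain C b where C: "0 \<le> C" "0 < b" "b \<le> 1" "\<And>h. 0 < h \<Longrightarrow> h < b \<Longrightarrow> norm (\<phi> h) \<le> C * h ^ q"
    by (rule order_at_0D[OF assms(1)]) (rule that; (assumption | simp))
  show ?thesis
  proof (rule order_at_0I[of b _ C])
    fix h :: real assume h: "0 < h" "h < b"
    have "C * h ^ q \<le> C * h ^ r"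
      using C h assms(2) by (intro mult_left_mono power_decreasing) auto
    then show "norm (\<phi> h) \<le> C * h ^ r" using C(4)[OF h] by linarith
  qed (rule C)
qed

lemma order_at_0_scaleR_power:
  assumes "order_at_0 r \<psi>"
  shows "order_at_0 (q + r) (\<lambda>h. h ^ q *\<^sub>R \<psi> h)"
  by (rule order_at_0_mult[OF order_at_0_power assms])

lemma order_at_0_const: "order_at_0 0 (\<lambda>h. c)"
  by (rule order_at_0I[of 1 _ "norm c"]) auto

text \<open>Once the lower coefficients are known to vanish, division by \<open>h ^ i\<close> and
  the limit h to 0 isolate the next one.\<close>

lemma order_at_0_coeff_eq_0:
  assumes "order_at_0 q (\<lambda>h. \<Sum>i<M. h ^ i *\<^sub>R c i)" "i < q" "i < M"
  shows "c i = 0"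
  using assms(2,3)
proof (induction i rule: less_induct)
  case (less i)
  obtain C b where C: "0 \<le> C" "0 < b" "b \<le> 1"
    "\<And>h. 0 < h \<Longrightarrow> h < b \<Longrightarrow> norm (\<Sum>i<M. h ^ i *\<^sub>R c i) \<le> C * h ^ q"
    by (rule order_at_0D[OF assms(1)]) (rule that; (assumption | simp))
  define K where "K = C + (\<Sum>j\<in>{i<..<M}. norm (c j))"
  have split: "(\<Sum>j<M. h ^ j *\<^sub>R c j) = h ^ i *\<^sub>R c i + (\<Sum>j\<in>{i<..<M}. h ^ j *\<^sub>R c j)" for h
  proof -
    have "(\<Sum>j<M. h ^ j *\<^sub>R c j) = (\<Sum>j\<in>insert i {i<..<M}. h ^ j *\<^sub>R c j)"
      by (rule sum.mono_neutral_right) (use less in auto)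
    then show ?thesis by simp
  qed
  have bound: "norm (c i) \<le> h * K" if h: "0 < h" "h < b" for h
  proof -
    have "h ^ i * norm (c i) = norm (h ^ i *\<^sub>R c i)" using h by simp
    also have "\<dots> \<le> norm (\<Sum>j<M. h ^ j *\<^sub>R c j) + norm (\<Sum>j\<in>{i<..<M}. h ^ j *\<^sub>R c j)"
      unfolding split using norm_triangle_ineq4[of "h ^ i *\<^sub>R c i + (\<Sum>j\<in>{i<..<M}. h ^ j *\<^sub>R c j)"
          "\<Sum>j\<in>{i<..<M}. h ^ j *\<^sub>R c j"] by simp
    also have "\<dots> \<le> C * h ^ Suc i + (\<Sum>j\<in>{i<..<M}. h ^ Suc i * norm (c j))"
    proof (rule add_mono)
      have "C * h ^ q \<le> C * h ^ Suc i"
        using C h less.prems by (intro mult_left_mono power_decreasing) auto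
      then show "norm (\<Sum>j<M. h ^ j *\<^sub>R c j) \<le> C * h ^ Suc i" using C(4)[OF h] by linarith
      have "norm (\<Sum>j\<in>{i<..<M}. h ^ j *\<^sub>R c j) \<le> (\<Sum>j\<in>{i<..<M}. norm (h ^ j *\<^sub>R c j))"
        by (rule norm_sum)
      also have "\<dots> \<le> (\<Sum>j\<in>{i<..<M}. h ^ Suc i * norm (c j))"
      proof (rule sum_mono)
        fix j assume "j \<in> {i<..<M}"
        then have "h ^ j \<le> h ^ Suc i" using h C by (intro power_decreasing) auto
        then show "norm (h ^ j *\<^sub>R c j) \<le> h ^ Suc i * norm (c j)"
          using h by (simp add: mult_right_mono)
      qed
      finally show "norm (\<Sum>j\<in>{i<..<M}. h ^ j *\<^sub>R c j) \<le> (\<Sum>j\<in>{i<..<M}. h ^ Suc i * norm (c j))" .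
    qed
    also have "\<dots> = h ^ i * (h * K)"
      by (simp add: K_def algebra_simps sum_distrib_left)
    finally show ?thesis using h by simp
  qed
  have "norm (c i) \<le> 0"
  proof (rule tendsto_lowerbound)
    show "((\<lambda>h. h * K) \<longlongrightarrow> 0) (at_right 0)" by (auto intro!: tendsto_eq_intros)
    show "\<forall>\<^sub>F h in at_right 0. norm (c i) \<le> h * K"
      using bound C by (intro eventually_at_right_0[of b]) auto
  qed simp
  then show ?case by simp
qed

section \<open>From pointwise to uniform orders for smooth functions of step size and time\<close>

lemma smooth_taylor_first:
  fixes F :: "real \<times> real \<Rightarrow> 'a::euclidean_space"
  assumes "Ck M F"
  shows "\<exists>C>0. \<forall>t\<in>{0..T}. \<forall>h\<in>{0..1}.
    norm (F (h, t) - (\<Sum>r<M. h ^ r *\<^sub>R (iter_deriv r F (0, t) (1, 0) /\<^sub>R fact r))) \<le> C * h ^ M"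
proof -
  have "compact ({0..1::real} \<times> {0..T})" by (intro compact_Times compact_Icc)
  from taylor_iter_deriv[OF assms this] obtain C where C: "C > 0"
    "\<forall>x v. closed_segment x (x + v) \<subseteq> {0..1} \<times> {0..T} \<longrightarrow>
      norm (F (x + v) - (\<Sum>r<M. iter_deriv r F x v /\<^sub>R fact r)) \<le> C * norm v ^ M" by auto
  have "norm (F (h, t) - (\<Sum>r<M. h ^ r *\<^sub>R (iter_deriv r F (0, t) (1, 0) /\<^sub>R fact r))) \<le> C * h ^ M"
    if "t \<in> {0..T}" "h \<in> {0..1}" for t h
  proof -
    have "closed_segment (0, t) ((0, t) + (h, 0)) \<subseteq> {0..1} \<times> {0..T}"
      using that by (intro closed_segment_subset convex_Times convex_real_interval) auto
    with C(2) have "norm (F ((0, t) + (h, 0)) - (\<Sum>r<M. iter_deriv r F (0, t) (h, 0) /\<^sub>R fact r)) \<le> C * norm (h, 0::real) ^ M"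
      by blast
    moreover have "iter_deriv r F (0, t) (h, 0) = h ^ r *\<^sub>R iter_deriv r F (0, t) (1, 0)" for r
      using iter_deriv_scaleR[of r F "(0, t)" h "(1, 0)"] by simp
    ultimately show ?thesis using that by (simp add: norm_Pair mult.commute)
  qed
  then show ?thesis using C(1) by blast
qed

text \<open>Pointwise order \<open>M\<close> annihilates the Taylor coefficients at (0, t), and the
  remaining Taylor remainder is uniform in t by compactness. The end point \<open>T\<close> is
  excluded because a residual there would look beyond the interval on which the differential
  equation holds.\<close>

lemma smooth_uniform_order:
  fixes F :: "real \<times> real \<Rightarrow> 'a::euclidean_space"
  assumes "Ck M F" "\<And>t. 0 \<le> t \<Longrightarrow> t < T \<Longrightarrow> order_at_0 M (\<lambda>h. F (h, t))"
  shows "\<exists>C\<ge>0. \<forall>t h. 0 \<le> t \<longrightarrow> t < T \<longrightarrow> 0 \<le> h \<longrightarrow> h \<le> 1 \<longrightarrow> norm (F (h, t)) \<le> C * h ^ M"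
proof -
  define d where "d r t = iter_deriv r F (0, t) (1, 0) /\<^sub>R fact r" for r t
  obtain C where C: "C > 0" "\<And>t h. t \<in> {0..T} \<Longrightarrow> h \<in> {0..1} \<Longrightarrow>
      norm (F (h, t) - (\<Sum>r<M. h ^ r *\<^sub>R d r t)) \<le> C * h ^ M"
    unfolding d_def using smooth_taylor_first[OF assms(1), of T] by blast
  have "norm (F (h, t)) \<le> C * h ^ M" if t: "0 \<le> t" "t < T" and h: "0 \<le> h" "h \<le> 1" for t h
  proof -
    have "order_at_0 M (\<lambda>h. F (h, t) - (F (h, t) - (\<Sum>r<M. h ^ r *\<^sub>R d r t)))"
      using C t by (intro order_at_0_diff assms(2) order_at_0I[of 1 _ C]) auto
    then have "d r t = 0" if "r < M" for r
      using order_at_0_coeff_eq_0[where q=M and M=M and c="\<lambda>r. d r t"] that by simp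
    then show ?thesis using C(2)[of t h] t h by simp
  qed
  then show ?thesis using C(1) by (intro exI[of _ C]) auto
qed

text \<open>The surviving coefficient is a derivative of order \<open>M\<close> in h, hence of class
  \<open>s\<close> in t if \<open>F\<close> has class \<open>M + s\<close>; the remainder asks for
  class \<open>Suc M\<close>.\<close>

lemma smooth_leading_coefficient:
  fixes F :: "real \<times> real \<Rightarrow> 'a::euclidean_space"
  assumes F: "Ck (Suc M + s) F" and ord: "\<And>t. 0 \<le> t \<Longrightarrow> t < T \<Longrightarrow> order_at_0 M (\<lambda>h. F (h, t))"
  obtains d where "Ck s d" "\<And>t. 0 \<le> t \<Longrightarrow> t < T \<Longrightarrow> order_at_0 (Suc M) (\<lambda>h. F (h, t) - h ^ M *\<^sub>R d t)"
proof
  define d where "d r t = iter_deriv r F (0, t) (1, 0) /\<^sub>R fact r" for r t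
  have "Ck s (\<lambda>t::real. iter_deriv M F (0, t) (1, 0))"
    by (rule Ck_iter_deriv[OF Ck_Pair[OF Ck_const Ck_bounded_linear[OF bounded_linear_ident]] Ck_const])
      (rule Ck_mono[OF F], simp)
  then show "Ck s (d M)"
    unfolding d_def[abs_def] by (rule Ck_bounded_linear_compose[OF bounded_linear_scaleR_right])
  have "Ck (Suc M) F" by (rule Ck_mono[OF F]) simp
  from smooth_taylor_first[OF this, of T] obtain C where C: "C > 0" "\<And>t h. t \<in> {0..T} \<Longrightarrow> h \<in> {0..1} \<Longrightarrow>
      norm (F (h, t) - (\<Sum>r<Suc M. h ^ r *\<^sub>R d r t)) \<le> C * h ^ Suc M"
    unfolding d_def by blast
  show "order_at_0 (Suc M) (\<lambda>h. F (h, t) - h ^ M *\<^sub>R d M t)" if t: "0 \<le> t" "t < T" for t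
  proof -
    have rem: "order_at_0 (Suc M) (\<lambda>h. F (h, t) - (\<Sum>r<Suc M. h ^ r *\<^sub>R d r t))"
      using C t by (intro order_at_0I[of 1 _ C]) auto
    have "order_at_0 M (\<lambda>h. F (h, t) - (F (h, t) - (\<Sum>r<Suc M. h ^ r *\<^sub>R d r t)))"
      by (rule order_at_0_diff[OF ord[OF t] order_at_0_mono[OF rem]]) simp
    then have "d r t = 0" if "r < M" for r
      using order_at_0_coeff_eq_0[where q=M and M="Suc M" and c="\<lambda>r. d r t"] that
      by (simp del: sum.lessThan_Suc)
    then show ?thesis using rem by simp
  qed
qed

text \<open>Expansion \<open>D h n = (\<Sum>i<M. h ^ i *\<^sub>R d i n) + O(h ^ M)\<close>, uniform on the grid points up to \<open>T\<close>, with
  coefficients and error constant of size \<open>w n\<close>. Splitting off one coefficient at a time makes the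
  closure properties inductions on \<open>M\<close>.\<close>

primrec expands :: "real \<Rightarrow> nat \<Rightarrow> (nat \<Rightarrow> real) \<Rightarrow> (real \<Rightarrow> nat \<Rightarrow> 'a::real_normed_vector) \<Rightarrow> bool" where
  "expands T 0 w D \<longleftrightarrow> (\<exists>C. \<forall>h n. 0 < h \<longrightarrow> h \<le> 1 \<longrightarrow> real n * h \<le> T \<longrightarrow> norm (D h n) \<le> C * w n)"
| "expands T (Suc M) w D \<longleftrightarrow> (\<exists>d C E. (\<forall>n. norm (d n) \<le> C * w n) \<and> expands T M w E \<and>
     (\<forall>h n. 0 < h \<longrightarrow> h \<le> 1 \<longrightarrow> real n * h \<le> T \<longrightarrow> D h n = d n + h *\<^sub>R E h n))"

lemma expands_0I:
  "(\<And>h n. 0 < h \<Longrightarrow> h \<le> 1 \<Longrightarrow> real n * h \<le> T \<Longrightarrow> norm (D h n) \<le> C * w n) \<Longrightarrow> expands T 0 w D"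
  by auto

lemma expands_0E:
  assumes "expands T 0 w D"
  obtains C where "\<And>h n. 0 < h \<Longrightarrow> h \<le> 1 \<Longrightarrow> real n * h \<le> T \<Longrightarrow> norm (D h n) \<le> C * w n"
  using assms by auto

lemma expands_SucI:
  assumes "\<And>n. norm (d n) \<le> C * w n" "expands T M w E"
    "\<And>h n. 0 < h \<Longrightarrow> h \<le> 1 \<Longrightarrow> real n * h \<le> T \<Longrightarrow> D h n = d n + h *\<^sub>R E h n"
  shows "expands T (Suc M) w D"
  unfolding expands.simps using assms by (intro exI[of _ d] exI[of _ C] exI[of _ E]) simp

lemma expands_SucE:
  assumes "expands T (Suc M) w D"
  obtains d C E where "\<And>n. norm (d n) \<le> C * w n" "expands T M w E"
    "\<And>h n. 0 < h \<Longrightarrow> h \<le> 1 \<Longrightarrow> real n * h \<le> T \<Longrightarrow> D h n = d n + h *\<^sub>R E h n"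
  using assms unfolding expands.simps by blast

declare expands.simps [simp del]

section \<open>Closure properties of uniform expansions\<close>

lemma expands_zero: "expands T M w (\<lambda>h n. 0)"
proof (induction M)
  case 0
  show ?case by (rule expands_0I[of _ _ 0]) simp
next
  case (Suc M)
  show ?case by (rule expands_SucI[of "\<lambda>_. 0" 0, OF _ Suc]) simp_all
qed

lemma expands_Suc_imp_expands: "expands T (Suc M) w D \<Longrightarrow> expands T M w D"
proof (induction M arbitrary: D)
  case 0
  obtain d C E where E: "\<And>n. norm (d n) \<le> C * w n" "expands T 0 w E"
    "\<And>h n. 0 < h \<Longrightarrow> h \<le> 1 \<Longrightarrow> real n * h \<le> T \<Longrightarrow> D h n = d n + h *\<^sub>R E h n"
    using expands_SucE[OF 0] by blast
  obtain K where K: "\<And>h n. 0 < h \<Longrightarrow> h \<le> 1 \<Longrightarrow> real n * h \<le> T \<Longrightarrow> norm (E h n) \<le> K * w n"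
    using expands_0E[OF E(2)] by blast
  show ?case
  proof (rule expands_0I[of _ _ "C + K"])
    fix h n assume h: "0 < h" "h \<le> 1" "real n * h \<le> T"
    have "norm (h *\<^sub>R E h n) \<le> norm (E h n)" using h by (simp add: mult_left_le_one_le)
    then show "norm (D h n) \<le> (C + K) * w n"
      using norm_triangle_mono[OF E(1)[of n], of "h *\<^sub>R E h n"] K[OF h] E(3)[OF h]
      by (simp add: distrib_right)
  qed
next
  case (Suc M)
  obtain d C E where E: "\<And>n. norm (d n) \<le> C * w n" "expands T (Suc M) w E"
    "\<And>h n. 0 < h \<Longrightarrow> h \<le> 1 \<Longrightarrow> real n * h \<le> T \<Longrightarrow> D h n = d n + h *\<^sub>R E h n"
    using expands_SucE[OF Suc.prems] by blast
  show ?case by (rule expands_SucI[OF E(1) Suc.IH[OF E(2)] E(3)])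
qed

lemma expands_imp_expands_0: "expands T M w D \<Longrightarrow> expands T 0 w D"
  by (induction M) (auto dest: expands_Suc_imp_expands)

lemma expands_add: "expands T M w D \<Longrightarrow> expands T M w E \<Longrightarrow> expands T M w (\<lambda>h n. D h n + E h n)"
proof (induction M arbitrary: D E)
  case 0
  obtain C where C: "\<And>h n. 0 < h \<Longrightarrow> h \<le> 1 \<Longrightarrow> real n * h \<le> T \<Longrightarrow> norm (D h n) \<le> C * w n"
    using expands_0E[OF 0(1)] by blast
  obtain K where K: "\<And>h n. 0 < h \<Longrightarrow> h \<le> 1 \<Longrightarrow> real n * h \<le> T \<Longrightarrow> norm (E h n) \<le> K * w n"
    using expands_0E[OF 0(2)] by blast
  show ?case
    by (rule expands_0I[of _ _ "C + K"]) (simp add: distrib_right norm_triangle_mono C K)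
next
  case (Suc M)
  obtain d C D' where D: "\<And>n. norm (d n) \<le> C * w n" "expands T M w D'"
    "\<And>h n. 0 < h \<Longrightarrow> h \<le> 1 \<Longrightarrow> real n * h \<le> T \<Longrightarrow> D h n = d n + h *\<^sub>R D' h n"
    using expands_SucE[OF Suc.prems(1)] by blast
  obtain e K E' where E: "\<And>n. norm (e n) \<le> K * w n" "expands T M w E'"
    "\<And>h n. 0 < h \<Longrightarrow> h \<le> 1 \<Longrightarrow> real n * h \<le> T \<Longrightarrow> E h n = e n + h *\<^sub>R E' h n"
    using expands_SucE[OF Suc.prems(2)] by blast
  show ?case
    by (rule expands_SucI[of "\<lambda>n. d n + e n" "C + K", OF _ Suc.IH[OF D(2) E(2)]])
      (simp_all add: distrib_right norm_triangle_mono D(1) E(1) D(3) E(3) scaleR_add_right)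
qed

lemma expands_sum: "(\<And>i. i \<in> I \<Longrightarrow> expands T M w (D i)) \<Longrightarrow> expands T M w (\<lambda>h n. \<Sum>i\<in>I. D i h n)"
  by (induction I rule: infinite_finite_induct) (auto intro: expands_zero expands_add)

lemma expands_bounded_linear:
  assumes L: "bounded_linear L"
  shows "expands T M w D \<Longrightarrow> expands T M w (\<lambda>h n. L (D h n))"
proof (induction M arbitrary: D)
  case 0
  obtain K where K: "K > 0" "\<And>x. norm (L x) \<le> norm x * K"
    using bounded_linear.pos_bounded[OF L] by blast
  obtain C where C: "\<And>h n. 0 < h \<Longrightarrow> h \<le> 1 \<Longrightarrow> real n * h \<le> T \<Longrightarrow> norm (D h n) \<le> C * w n"
    using expands_0E[OF 0] by blast
  show ?case
  proof (rule expands_0I[of _ _ "C * K"])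
    fix h n assume "0 < h" "h \<le> 1" "real n * h \<le> T"
    from order_trans[OF K(2) mult_right_mono[OF C[OF this]]] K(1)
    show "norm (L (D h n)) \<le> C * K * w n" by (simp add: mult_ac)
  qed
next
  case (Suc M)
  obtain K where K: "K > 0" "\<And>x. norm (L x) \<le> norm x * K"
    using bounded_linear.pos_bounded[OF L] by blast
  obtain d C E where E: "\<And>n. norm (d n) \<le> C * w n" "expands T M w E"
    "\<And>h n. 0 < h \<Longrightarrow> h \<le> 1 \<Longrightarrow> real n * h \<le> T \<Longrightarrow> D h n = d n + h *\<^sub>R E h n"
    using expands_SucE[OF Suc.prems] by blast
  show ?case
  proof (rule expands_SucI[of "\<lambda>n. L (d n)" "C * K", OF _ Suc.IH[OF E(2)]])
    show "norm (L (d n)) \<le> C * K * w n" for n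
      using order_trans[OF K(2) mult_right_mono[OF E(1)]] K(1) by (simp add: mult_ac)
  qed (simp add: E(3) linear_add[OF bounded_linear.linear[OF L]] linear_cmul[OF bounded_linear.linear[OF L]])
qed

lemma expands_weight_mono:
  assumes "0 \<le> c" "\<And>n. 0 \<le> w n" "\<And>n. w n \<le> c * w' n"
  shows "expands T M w D \<Longrightarrow> expands T M w' D"
proof (induction M arbitrary: D)
  case 0
  obtain C where C: "\<And>h n. 0 < h \<Longrightarrow> h \<le> 1 \<Longrightarrow> real n * h \<le> T \<Longrightarrow> norm (D h n) \<le> C * w n"
    using expands_0E[OF 0] by blast
  show ?case
  proof (rule expands_0I[of _ _ "\<bar>C\<bar> * c"])
    fix h n assume h: "0 < h" "h \<le> 1" "real n * h \<le> T"
    have "C * w n \<le> \<bar>C\<bar> * (c * w' n)" by (rule mult_mono) (use assms in auto)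
    then show "norm (D h n) \<le> \<bar>C\<bar> * c * w' n" using C[OF h] by simp
  qed
next
  case (Suc M)
  obtain d C E where E: "\<And>n. norm (d n) \<le> C * w n" "expands T M w E"
    "\<And>h n. 0 < h \<Longrightarrow> h \<le> 1 \<Longrightarrow> real n * h \<le> T \<Longrightarrow> D h n = d n + h *\<^sub>R E h n"
    using expands_SucE[OF Suc.prems] by blast
  show ?case
  proof (rule expands_SucI[of d "\<bar>C\<bar> * c", OF _ Suc.IH[OF E(2)] E(3)])
    fix n
    have "C * w n \<le> \<bar>C\<bar> * (c * w' n)" by (rule mult_mono) (use assms in auto)
    then show "norm (d n) \<le> \<bar>C\<bar> * c * w' n" using E(1)[of n] by simp
  qed
qed

lemma expands_const:
  assumes "\<And>n. norm (d n) \<le> C * w n"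
  shows "expands T M w (\<lambda>h n. d n)"
proof (cases M)
  case 0
  then show ?thesis using assms by (auto intro: expands_0I)
next
  case (Suc m)
  show ?thesis unfolding Suc by (rule expands_SucI[OF assms expands_zero]) simp
qed

lemma expands_step_size:
  assumes "expands T M w D"
  shows "expands T M w (\<lambda>h n. h *\<^sub>R D h n)"
proof (cases M)
  case 0
  obtain C where C: "\<And>h n. 0 < h \<Longrightarrow> h \<le> 1 \<Longrightarrow> real n * h \<le> T \<Longrightarrow> norm (D h n) \<le> C * w n"
    using expands_0E assms 0 by blast
  show ?thesis unfolding 0
  proof (rule expands_0I)
    fix h n assume h: "0 < h" "h \<le> 1" "real n * h \<le> T"
    have "norm (h *\<^sub>R D h n) \<le> norm (D h n)" using h by (simp add: mult_left_le_one_le)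
    then show "norm (h *\<^sub>R D h n) \<le> C * w n" using C[OF h] by simp
  qed
next
  case (Suc m)
  have "expands T m w D" using assms unfolding Suc by (rule expands_Suc_imp_expands)
  then have "norm (0 :: 'a) \<le> 0 * w n \<Longrightarrow> expands T (Suc m) w (\<lambda>h n. h *\<^sub>R D h n)" for n
    by (intro expands_SucI[of "\<lambda>_. 0" 0]) simp_all
  then show ?thesis unfolding Suc by simp
qed

lemma expands_power: "expands T M w D \<Longrightarrow> expands T M w (\<lambda>h n. h ^ i *\<^sub>R D h n)"
proof (induction i)
  case (Suc i)
  show ?case using expands_step_size[OF Suc.IH[OF Suc.prems]] by simp
qed simp

lemma expands_remainder:
  "(\<And>h n. 0 < h \<Longrightarrow> h \<le> 1 \<Longrightarrow> real n * h \<le> T \<Longrightarrow> norm (D h n) \<le> C * h ^ M * w n) \<Longrightarrow> expands T M w D"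
proof (induction M arbitrary: D)
  case 0
  show ?case by (rule expands_0I[of _ _ C]) (use 0 in simp)
next
  case (Suc M)
  have "expands T M w (\<lambda>h n. D h n /\<^sub>R h)"
  proof (rule Suc.IH)
    fix h n assume h: "0 < h" "h \<le> 1" "real n * h \<le> T"
    show "norm (D h n /\<^sub>R h) \<le> C * h ^ M * w n"
      using Suc.prems[OF h] h by (simp add: divide_inverse_commute[symmetric] divide_le_eq mult_ac)
  qed
  then show ?case by (rule expands_SucI[of "\<lambda>_. 0" 0, rotated]) simp_all
qed

lemma expandsI:
  assumes "\<And>i n. i < M \<Longrightarrow> norm (d i n) \<le> C * w n"
    "\<And>h n. 0 < h \<Longrightarrow> h \<le> 1 \<Longrightarrow> real n * h \<le> T \<Longrightarrow>
        norm (D h n - (\<Sum>i<M. h ^ i *\<^sub>R d i n)) \<le> C * h ^ M * w n"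
  shows "expands T M w D"
proof -
  have "expands T M w (\<lambda>h n. (\<Sum>i<M. h ^ i *\<^sub>R d i n))"
    by (intro expands_sum expands_power expands_const[of _ C]) (use assms(1) in simp)
  from expands_add[OF this expands_remainder[OF assms(2)]] show ?thesis by simp
qed

text \<open>A shift by \<open>j\<close> indices moves the time by \<open>j * h\<close>, which is at
  most \<open>j\<close> since h is at most 1; this fixes the longer horizon.\<close>

lemma expands_shift:
  assumes "T + real j \<le> T'"
  shows "expands T' M w D \<Longrightarrow> expands T M (\<lambda>n. w (n + j)) (\<lambda>h n. D h (n + j))"
proof -
  have le: "real (n + j) * h \<le> T'" if "0 < h" "h \<le> 1" "real n * h \<le> T" for h n
    using that assms mult_left_mono[of h 1 "real j"] by (simp add: distrib_right)
  show "expands T' M w D \<Longrightarrow> expands T M (\<lambda>n. w (n + j)) (\<lambda>h n. D h (n + j))"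
  proof (induction M arbitrary: D)
    case 0
    obtain C where C: "\<And>h n. 0 < h \<Longrightarrow> h \<le> 1 \<Longrightarrow> real n * h \<le> T' \<Longrightarrow> norm (D h n) \<le> C * w n"
      using expands_0E[OF 0] by blast
    show ?case by (rule expands_0I) (use C le in blast)
  next
    case (Suc M)
    obtain d C E where E: "\<And>n. norm (d n) \<le> C * w n" "expands T' M w E"
      "\<And>h n. 0 < h \<Longrightarrow> h \<le> 1 \<Longrightarrow> real n * h \<le> T' \<Longrightarrow> D h n = d n + h *\<^sub>R E h n"
      using expands_SucE[OF Suc.prems] by blast
    show ?case by (rule expands_SucI[OF E(1) Suc.IH[OF E(2)] E(3)[OF _ _ le]])
  qed
qed

text \<open>Instead of a Cauchy product the induction uses D E = d e + h (d E' + D' E), where D = d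
  + h D' and E = e + h E'.\<close>

lemma expands_scaleR:
  fixes D :: "real \<Rightarrow> nat \<Rightarrow> real" and E :: "real \<Rightarrow> nat \<Rightarrow> 'a::real_normed_vector"
  shows "expands T M w D \<Longrightarrow> expands T M v E \<Longrightarrow> expands T M (\<lambda>n. w n * v n) (\<lambda>h n. D h n *\<^sub>R E h n)"
proof (induction M arbitrary: D E)
  case 0
  obtain C where C: "\<And>h n. 0 < h \<Longrightarrow> h \<le> 1 \<Longrightarrow> real n * h \<le> T \<Longrightarrow> norm (D h n) \<le> C * w n"
    using expands_0E[OF 0(1)] by blast
  obtain K where K: "\<And>h n. 0 < h \<Longrightarrow> h \<le> 1 \<Longrightarrow> real n * h \<le> T \<Longrightarrow> norm (E h n) \<le> K * v n"
    using expands_0E[OF 0(2)] by blast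
  show ?case
  proof (rule expands_0I[of _ _ "C * K"])
    fix h n assume h: "0 < h" "h \<le> 1" "real n * h \<le> T"
    have "norm (D h n) * norm (E h n) \<le> (C * w n) * (K * v n)"
      by (rule mult_mono[OF C[OF h] K[OF h] order_trans[OF norm_ge_zero C[OF h]]]) simp
    then show "norm (D h n *\<^sub>R E h n) \<le> C * K * (w n * v n)" by (simp add: mult_ac)
  qed
next
  case (Suc M)
  obtain d C D' where D: "\<And>n. norm (d n) \<le> C * w n" "expands T M w D'"
    "\<And>h n. 0 < h \<Longrightarrow> h \<le> 1 \<Longrightarrow> real n * h \<le> T \<Longrightarrow> D h n = d n + h *\<^sub>R D' h n"
    using expands_SucE[OF Suc.prems(1)] by blast
  obtain e K E' where E: "\<And>n. norm (e n) \<le> K * v n" "expands T M v E'"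
    "\<And>h n. 0 < h \<Longrightarrow> h \<le> 1 \<Longrightarrow> real n * h \<le> T \<Longrightarrow> E h n = e n + h *\<^sub>R E' h n"
    using expands_SucE[OF Suc.prems(2)] by blast
  have "expands T M (\<lambda>n. w n * v n) (\<lambda>h n. d n *\<^sub>R E' h n + D' h n *\<^sub>R E h n)"
    by (intro expands_add Suc.IH D(2) E(2) expands_const[OF D(1)] expands_Suc_imp_expands[OF Suc.prems(2)])
  then show ?case
  proof (rule expands_SucI[of "\<lambda>n. d n *\<^sub>R e n" "C * K", rotated])
    show "norm (d n *\<^sub>R e n) \<le> C * K * (w n * v n)" for n
      using mult_mono[OF D(1)[of n] E(1)[of n] order_trans[OF norm_ge_zero D(1)]] by (simp add: mult_ac)
    show "D h n *\<^sub>R E h n = d n *\<^sub>R e n + h *\<^sub>R (d n *\<^sub>R E' h n + D' h n *\<^sub>R E h n)"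
      if "0 < h" "h \<le> 1" "real n * h \<le> T" for h n
    proof -
      have "D h n *\<^sub>R E h n = d n *\<^sub>R E h n + (h * D' h n) *\<^sub>R E h n"
        using D(3)[OF that] by (simp add: scaleR_add_left)
      also have "d n *\<^sub>R E h n = d n *\<^sub>R e n + (h * d n) *\<^sub>R E' h n"
        using E(3)[OF that] by (simp add: scaleR_add_right mult.commute)
      finally show ?thesis by (simp add: scaleR_add_right)
    qed
  qed
qed

text \<open>Order \<open>q\<close> at every fixed index forces the first \<open>q\<close>
  coefficient sequences to vanish, so \<open>h ^ q\<close> can be factored out with weight and
  uniformity intact.\<close>

lemma expands_order:
  assumes T: "0 < T"
  shows "expands T M w D \<Longrightarrow> (\<And>n. order_at_0 q (\<lambda>h. D h n)) \<Longrightarrow> q \<le> M \<Longrightarrow>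
    \<exists>E. expands T (M - q) w E \<and> (\<forall>h n. 0 < h \<longrightarrow> h \<le> 1 \<longrightarrow> real n * h \<le> T \<longrightarrow> D h n = h ^ q *\<^sub>R E h n)"
proof (induction q arbitrary: M D)
  case 0
  then show ?case by (intro exI[of _ D]) simp
next
  case (Suc q)
  then obtain m where m: "M = Suc m" by (cases M) auto
  obtain d C E where E: "\<And>n. norm (d n) \<le> C * w n" "expands T m w E"
    "\<And>h n. 0 < h \<Longrightarrow> h \<le> 1 \<Longrightarrow> real n * h \<le> T \<Longrightarrow> D h n = d n + h *\<^sub>R E h n"
    using expands_SucE Suc.prems(1) unfolding m by blast
  obtain K where K: "\<And>h n. 0 < h \<Longrightarrow> h \<le> 1 \<Longrightarrow> real n * h \<le> T \<Longrightarrow> norm (E h n) \<le> K * w n"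
    using expands_0E[OF expands_imp_expands_0[OF E(2)]] by blast
  have d: "d n = 0" for n
  proof -
    have "order_at_0 1 (\<lambda>h. D h n - d n)"
      by (rule order_at_0_grid[OF T, of n _ "K * w n"]) (use K E(3) in \<open>simp add: mult.commute mult_left_mono\<close>)
    from order_at_0_diff[OF order_at_0_mono[OF Suc.prems(2)[of n], of 1] this]
    have "order_at_0 1 (\<lambda>h. \<Sum>i<1. h ^ i *\<^sub>R d n)" by simp
    then show ?thesis using order_at_0_coeff_eq_0[where q=1 and M=1 and c="\<lambda>_. d n"] by blast
  qed
  have "order_at_0 q (\<lambda>h. E h n)" for n
  proof -
    obtain B b where B: "0 \<le> B" "0 < b" "b \<le> 1" "\<And>h. 0 < h \<Longrightarrow> h < b \<Longrightarrow> norm (D h n) \<le> B * h ^ Suc q"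
      by (rule order_at_0D[OF Suc.prems(2)[of n]]) (rule that; (assumption | simp))
    show ?thesis
    proof (rule order_at_0I[of "min b (T / (real n + 1))" _ B])
      fix h assume h: "0 < h" "h < min b (T / (real n + 1))"
      have "real n * h \<le> (real n + 1) * h" using h by simp
      also have "\<dots> \<le> T" using h by (simp add: field_simps)
      finally have "h * norm (E h n) = norm (D h n)" using E(3)[of h n] d h B(3) by simp
      then have "h * norm (E h n) \<le> h * (B * h ^ q)" using B(4)[of h] h by (simp add: mult_ac)
      then show "norm (E h n) \<le> B * h ^ q" using h by simp
    qed (use B T in simp)
  qed
  from Suc.IH[OF E(2) this] Suc.prems(3) obtain F where F: "expands T (m - q) w F"
    "\<And>h n. 0 < h \<Longrightarrow> h \<le> 1 \<Longrightarrow> real n * h \<le> T \<Longrightarrow> E h n = h ^ q *\<^sub>R F h n" by (auto simp: m)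
  then show ?case using E(3) d by (intro exI[of _ F]) (simp add: m)
qed

text \<open>The point (h, n h) is h times (1, n), so Taylor expansion at the origin has coefficients
  that are free of h but grow like powers of n.\<close>

lemma expands_smooth:
  fixes F :: "real \<times> real \<Rightarrow> 'a::euclidean_space"
  assumes F: "Ck M F"
  shows "expands T M (\<lambda>n. (1 + real n) ^ M) (\<lambda>h n. F (h, real n * h))"
proof -
  have "\<exists>C>0. \<forall>x\<in>{0}. \<forall>v. norm (iter_deriv r F x v) \<le> C * norm v ^ r" if "r < M" for r
    by (rule iter_deriv_norm_bound[OF Ck_mono[OF F]]) (use that in auto)
  then have "\<forall>r. \<exists>C. r < M \<longrightarrow> C > 0 \<and> (\<forall>v. norm (iter_deriv r F 0 v) \<le> C * norm v ^ r)" by blast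
  then obtain C where C: "\<And>r. r < M \<Longrightarrow> C r > 0"
    "\<And>r v. r < M \<Longrightarrow> norm (iter_deriv r F 0 v) \<le> C r * norm v ^ r" by metis
  have "compact (cball 0 (1 + \<bar>T\<bar>) :: (real \<times> real) set)" by simp
  from taylor_iter_deriv[OF F this] obtain K where K: "K > 0"
    "\<forall>x v. closed_segment x (x + v) \<subseteq> cball 0 (1 + \<bar>T\<bar>) \<longrightarrow>
      norm (F (x + v) - (\<Sum>r<M. iter_deriv r F x v /\<^sub>R fact r)) \<le> K * norm v ^ M" by auto
  define S where "S = (\<Sum>r<M. C r)"
  have S: "C r \<le> S" if "r < M" for r
    unfolding S_def by (rule member_le_sum) (use that C(1) in \<open>auto intro: less_imp_le\<close>)
  have S0: "0 \<le> S" unfolding S_def by (rule sum_nonneg) (use C(1) in \<open>auto intro: less_imp_le\<close>)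
  have norm1: "norm (1 :: real, real n) \<le> 1 + real n" for n
    using norm_Pair_le[of "1::real" "real n"] by simp
  show ?thesis
  proof (rule expandsI[where C="S + K" and d="\<lambda>r n. iter_deriv r F 0 (1, real n) /\<^sub>R fact r"])
    show "norm (iter_deriv r F 0 (1, real n) /\<^sub>R fact r) \<le> (S + K) * (1 + real n) ^ M" if r: "r < M" for r n
    proof -
      have "norm (iter_deriv r F 0 (1, real n) /\<^sub>R fact r) \<le> norm (iter_deriv r F 0 (1, real n)) / 1"
        unfolding norm_scaleR
        by (simp add: divide_inverse_commute[symmetric] divide_le_eq mult_le_cancel_left1)
      also have "\<dots> \<le> C r * norm (1 :: real, real n) ^ r" using C(2)[OF r] by simp
      also have "\<dots> \<le> (S + K) * (1 + real n) ^ M"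
      proof (rule mult_mono)
        have "norm (1 :: real, real n) ^ r \<le> (1 + real n) ^ r" by (rule power_mono[OF norm1]) simp
        also have "\<dots> \<le> (1 + real n) ^ M" using r by (intro power_increasing) auto
        finally show "norm (1 :: real, real n) ^ r \<le> (1 + real n) ^ M" .
      qed (use S[OF r] S0 K(1) in auto)
      finally show ?thesis .
    qed
    fix h :: real and n assume h: "0 < h" "h \<le> 1" "real n * h \<le> T"
    let ?v = "(h, real n * h)"
    have v: "?v = h *\<^sub>R (1, real n)" by simp
    have "norm ?v \<le> 1 + \<bar>T\<bar>" using norm_Pair_le[of h "real n * h"] h by (simp add: abs_mult)
    then have "closed_segment 0 (0 + ?v) \<subseteq> cball 0 (1 + \<bar>T\<bar>)"
      by (intro closed_segment_subset convex_cball) auto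
    then have "norm (F (0 + ?v) - (\<Sum>r<M. iter_deriv r F 0 ?v /\<^sub>R fact r)) \<le> K * norm ?v ^ M"
      using K(2) by blast
    moreover have "iter_deriv r F 0 ?v /\<^sub>R fact r = h ^ r *\<^sub>R (iter_deriv r F 0 (1, real n) /\<^sub>R fact r)" for r
      unfolding v iter_deriv_scaleR by (simp add: mult.commute)
    moreover have "K * norm ?v ^ M \<le> (S + K) * h ^ M * (1 + real n) ^ M"
    proof -
      have "norm ?v ^ M \<le> (h * (1 + real n)) ^ M"
        unfolding v norm_scaleR using h norm1[of n] by (intro power_mono mult_mono) auto
      then have "K * norm ?v ^ M \<le> (S + K) * (h * (1 + real n)) ^ M"
        using S0 K(1) h by (intro mult_mono) auto
      then show ?thesis by (simp add: power_mult_distrib mult.assoc)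
    qed
    ultimately show "norm (F (h, real n * h) - (\<Sum>r<M. h ^ r *\<^sub>R (iter_deriv r F 0 (1, real n) /\<^sub>R fact r)))
        \<le> (S + K) * h ^ M * (1 + real n) ^ M" by simp
  qed
qed

text \<open>A derivative of positive order contains \<open>B\<close> at least once. One factor keeps
  its weight, further ones are bounded by weight 1, and only the factor depending on
  \<open>A\<close> costs powers of n.\<close>

lemma expands_iter_deriv:
  fixes g :: "'a::euclidean_space \<Rightarrow> 'b::euclidean_space"
  assumes A: "Ck M A" and B: "expands T M w B" and w: "\<And>n. 0 \<le> w n" "\<And>n. w n \<le> 1"
  shows "Ck (Suc r + M) g \<Longrightarrow>
    expands T M (\<lambda>n. (1 + real n) ^ M * w n) (\<lambda>h n. iter_deriv (Suc r) g (A (h, real n * h)) (B h n))"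
proof (induction r arbitrary: g)
  case 0
  have "expands T M (\<lambda>n. w n * (1 + real n) ^ M)
      (\<lambda>h n. inner (B h n) i *\<^sub>R frechet_derivative g (at (A (h, real n * h))) i)" for i
    by (intro expands_scaleR expands_bounded_linear[OF bounded_linear_inner_left B]
        expands_smooth Ck_compose[OF A Ck_SucD(2)]) (use 0 in simp)
  then show ?case by (auto intro: expands_sum simp: mult.commute)
next
  case (Suc r)
  show ?case unfolding iter_deriv.simps(2)[of "Suc r"]
  proof (rule expands_sum)
    fix i :: 'a
    have "expands T M (\<lambda>n. w n * ((1 + real n) ^ M * w n)) (\<lambda>h n. inner (B h n) i *\<^sub>R
        iter_deriv (Suc r) (\<lambda>y. frechet_derivative g (at y) i) (A (h, real n * h)) (B h n))"
      by (intro expands_scaleR expands_bounded_linear[OF bounded_linear_inner_left B] Suc.IH Ck_SucD(2))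
        (use Suc.prems in simp)
    then show "expands T M (\<lambda>n. (1 + real n) ^ M * w n) (\<lambda>h n. inner (B h n) i *\<^sub>R
        iter_deriv (Suc r) (\<lambda>y. frechet_derivative g (at y) i) (A (h, real n * h)) (B h n))"
      by (rule expands_weight_mono[of 1, rotated -1]) (auto simp: w mult_left_le_one_le)
  qed
qed

section \<open>Geometrically decaying expansions\<close>

lemma polynomial_times_geometric:
  assumes "0 < \<rho>" "\<rho> < (1::real)"
  shows "\<exists>C \<sigma>. 0 \<le> C \<and> 0 < \<sigma> \<and> \<sigma> < 1 \<and> (\<forall>n. (1 + real n) ^ M * \<rho> ^ n \<le> C * \<sigma> ^ n)"
proof (induction M)
  case 0
  then show ?case using assms by (intro exI[of _ 1] exI[of _ \<rho>]) auto
next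
  case (Suc M)
  then obtain C \<sigma> where C: "0 \<le> C" "0 < \<sigma>" "\<sigma> < 1" "\<And>n. (1 + real n) ^ M * \<rho> ^ n \<le> C * \<sigma> ^ n"
    by blast
  \<comment> \<open>Half of the decay pays for one factor 1 + n: the product of 1 + n and
    \<open>\<tau> ^ n\<close> is at most the geometric sum of the \<open>\<tau> ^ i\<close> for i up
    to n.\<close>
  define \<tau> where "\<tau> = sqrt \<sigma>"
  have \<tau>: "0 < \<tau>" "\<tau> < 1" "\<sigma> = \<tau> * \<tau>" using C by (auto simp: \<tau>_def)
  have "(1 + real n) ^ Suc M * \<rho> ^ n \<le> C / (1 - \<tau>) * \<tau> ^ n" for n
  proof -
    have "(1 + real n) * \<tau> ^ n = (\<Sum>i\<le>n. \<tau> ^ n)" by simp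
    also have "\<dots> \<le> (\<Sum>i\<le>n. \<tau> ^ i)" using \<tau> by (intro sum_mono power_decreasing) auto
    also have "\<dots> \<le> 1 / (1 - \<tau>)"
      unfolding lessThan_Suc_atMost[symmetric] sum_gp_strict using \<tau>
      by (simp add: divide_right_mono)
    finally have *: "(1 + real n) * \<tau> ^ n \<le> 1 / (1 - \<tau>)" .
    have "(1 + real n) ^ Suc M * \<rho> ^ n \<le> (1 + real n) * (C * \<sigma> ^ n)"
      using mult_left_mono[OF C(4)[of n], of "1 + real n"] by (simp add: mult.assoc)
    also have "\<dots> = (C * \<tau> ^ n) * ((1 + real n) * \<tau> ^ n)"
      by (simp add: \<tau>(3) power_mult_distrib algebra_simps)
    also have "\<dots> \<le> (C * \<tau> ^ n) * (1 / (1 - \<tau>))"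
      using * C(1) \<tau> by (intro mult_left_mono) auto
    finally show ?thesis by simp
  qed
  then show ?case using C(1) \<tau> by (intro exI[of _ "C / (1 - \<tau>)"] exI[of _ \<tau>]) auto
qed

text \<open>The rate is hidden because it deteriorates under sums and compositions; only its
  existence matters.\<close>

definition geo_expands :: "real \<Rightarrow> nat \<Rightarrow> (real \<Rightarrow> nat \<Rightarrow> 'a::real_normed_vector) \<Rightarrow> bool" where
  "geo_expands T M D \<longleftrightarrow> (\<exists>\<rho>. 0 < \<rho> \<and> \<rho> < 1 \<and> expands T M (\<lambda>n. \<rho> ^ n) D)"

lemma geo_expandsI: "0 < \<rho> \<Longrightarrow> \<rho> < 1 \<Longrightarrow> expands T M (\<lambda>n. \<rho> ^ n) D \<Longrightarrow> geo_expands T M D"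
  unfolding geo_expands_def by blast

lemma geo_expandsE:
  assumes "geo_expands T M D"
  obtains \<rho> where "0 < \<rho>" "\<rho> < 1" "expands T M (\<lambda>n. \<rho> ^ n) D"
  using assms unfolding geo_expands_def by blast

lemma geo_expands_add:
  assumes "geo_expands T M D" "geo_expands T M E"
  shows "geo_expands T M (\<lambda>h n. D h n + E h n)"
proof -
  obtain \<rho> \<sigma> where \<rho>: "0 < \<rho>" "\<rho> < 1" "expands T M (\<lambda>n. \<rho> ^ n) D"
    and \<sigma>: "0 < \<sigma>" "\<sigma> < 1" "expands T M (\<lambda>n. \<sigma> ^ n) E"
    using assms by (auto elim!: geo_expandsE)
  have "expands T M (\<lambda>n. max \<rho> \<sigma> ^ n) D"
    by (rule expands_weight_mono[of 1, OF _ _ _ \<rho>(3)]) (use \<rho> in \<open>auto intro: power_mono\<close>)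
  moreover have "expands T M (\<lambda>n. max \<rho> \<sigma> ^ n) E"
    by (rule expands_weight_mono[of 1, OF _ _ _ \<sigma>(3)]) (use \<sigma> in \<open>auto intro: power_mono\<close>)
  ultimately show ?thesis
    using \<rho> \<sigma> by (intro geo_expandsI[of "max \<rho> \<sigma>"] expands_add) auto
qed

lemma geo_expands_zero: "geo_expands T M (\<lambda>h n. 0)"
  by (rule geo_expandsI[of "1/2"]) (auto intro: expands_zero)

lemma geo_expands_sum:
  "(\<And>i. i \<in> I \<Longrightarrow> geo_expands T M (D i)) \<Longrightarrow> geo_expands T M (\<lambda>h n. \<Sum>i\<in>I. D i h n)"
  by (induction I rule: infinite_finite_induct) (auto intro: geo_expands_zero geo_expands_add)

lemma geo_expands_scaleR_right: "geo_expands T M D \<Longrightarrow> geo_expands T M (\<lambda>h n. c *\<^sub>R D h n)"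
  by (elim geo_expandsE) (rule geo_expandsI[OF _ _ expands_bounded_linear[OF bounded_linear_scaleR_right]])

lemma geo_expands_step_size: "geo_expands T M D \<Longrightarrow> geo_expands T M (\<lambda>h n. h *\<^sub>R D h n)"
  by (elim geo_expandsE) (rule geo_expandsI[OF _ _ expands_step_size])

lemma geo_expands_diff:
  "geo_expands T M D \<Longrightarrow> geo_expands T M E \<Longrightarrow> geo_expands T M (\<lambda>h n. D h n - E h n)"
  using geo_expands_add[OF _ geo_expands_scaleR_right[of T M E "-1"]] by simp

lemma geo_expands_shift:
  assumes "geo_expands T' M D" "T + real j \<le> T'"
  shows "geo_expands T M (\<lambda>h n. D h (n + j))"
proof -
  obtain \<rho> where \<rho>: "0 < \<rho>" "\<rho> < 1" "expands T' M (\<lambda>n. \<rho> ^ n) D"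
    using geo_expandsE[OF assms(1)] by blast
  have "expands T M (\<lambda>n. \<rho> ^ n) (\<lambda>h n. D h (n + j))"
    by (rule expands_weight_mono[of 1, OF _ _ _ expands_shift[OF assms(2) \<rho>(3)]])
      (use \<rho> in \<open>auto intro: power_decreasing\<close>)
  then show ?thesis using \<rho> by (intro geo_expandsI)
qed

lemma geo_expands_order:
  assumes D: "geo_expands T M D" and T: "0 < T" and ord: "\<And>n. order_at_0 q (\<lambda>h. D h n)" and q: "q \<le> M"
  obtains C \<rho> where "0 \<le> C" "0 < \<rho>" "\<rho> < 1"
    "\<And>h n. 0 < h \<Longrightarrow> h \<le> 1 \<Longrightarrow> real n * h \<le> T \<Longrightarrow> norm (D h n) \<le> C * h ^ q * \<rho> ^ n"
proof -
  obtain \<rho> where \<rho>: "0 < \<rho>" "\<rho> < 1" "expands T M (\<lambda>n. \<rho> ^ n) D" using geo_expandsE[OF D] by blast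
  obtain E where E: "expands T (M - q) (\<lambda>n. \<rho> ^ n) E"
    "\<And>h n. 0 < h \<Longrightarrow> h \<le> 1 \<Longrightarrow> real n * h \<le> T \<Longrightarrow> D h n = h ^ q *\<^sub>R E h n"
    using expands_order[OF T \<rho>(3) ord q] by blast
  obtain C where C: "\<And>h n. 0 < h \<Longrightarrow> h \<le> 1 \<Longrightarrow> real n * h \<le> T \<Longrightarrow> norm (E h n) \<le> C * \<rho> ^ n"
    using expands_0E[OF expands_imp_expands_0[OF E(1)]] by blast
  have "norm (D h n) \<le> \<bar>C\<bar> * h ^ q * \<rho> ^ n" if "0 < h" "h \<le> 1" "real n * h \<le> T" for h n
  proof -
    have "norm (E h n) \<le> \<bar>C\<bar> * \<rho> ^ n"
      by (rule order_trans[OF C[OF that] mult_right_mono]) (use \<rho> in auto)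
    from mult_left_mono[OF this, of "h ^ q"] show ?thesis
      using E(2)[OF that] that by (simp add: mult_ac)
  qed
  then show ?thesis by (rule that[OF abs_ge_zero \<rho>(1,2)])
qed

text \<open>After \<open>h ^ q\<close> has been factored out, \<delta> is the constant coefficient
  of what remains and so inherits the geometric weight.\<close>

lemma geo_expands_leading_coefficient:
  assumes D: "geo_expands T (Suc q) D" and T: "0 < T" and ord: "\<And>n. order_at_0 q (\<lambda>h. D h n)"
  obtains \<delta> C \<rho> where "0 < \<rho>" "\<rho> < 1" "\<And>n. norm (\<delta> n) \<le> C * \<rho> ^ n"
    "\<And>n. order_at_0 (Suc q) (\<lambda>h. D h n - h ^ q *\<^sub>R \<delta> n)"
proof -
  obtain \<rho> where \<rho>: "0 < \<rho>" "\<rho> < 1" "expands T (Suc q) (\<lambda>n. \<rho> ^ n) D" using geo_expandsE[OF D] by blast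
  have "q \<le> Suc q" by simp
  from expands_order[OF T \<rho>(3) ord this] obtain E where E: "expands T (Suc 0) (\<lambda>n. \<rho> ^ n) E"
    "\<And>h n. 0 < h \<Longrightarrow> h \<le> 1 \<Longrightarrow> real n * h \<le> T \<Longrightarrow> D h n = h ^ q *\<^sub>R E h n" by auto
  obtain \<delta> C F where F: "\<And>n. norm (\<delta> n) \<le> C * \<rho> ^ n" "expands T 0 (\<lambda>n. \<rho> ^ n) F"
    "\<And>h n. 0 < h \<Longrightarrow> h \<le> 1 \<Longrightarrow> real n * h \<le> T \<Longrightarrow> E h n = \<delta> n + h *\<^sub>R F h n"
    using expands_SucE[OF E(1)] by blast
  obtain K where K: "\<And>h n. 0 < h \<Longrightarrow> h \<le> 1 \<Longrightarrow> real n * h \<le> T \<Longrightarrow> norm (F h n) \<le> K * \<rho> ^ n"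
    using expands_0E[OF F(2)] by blast
  have "order_at_0 (Suc q) (\<lambda>h. D h n - h ^ q *\<^sub>R \<delta> n)" for n
  proof (rule order_at_0_grid[OF T, of n _ "K * \<rho> ^ n"])
    fix h assume h: "0 < h" "h \<le> 1" "real n * h \<le> T"
    have "D h n - h ^ q *\<^sub>R \<delta> n = h ^ Suc q *\<^sub>R F h n"
      using E(2)[OF h] F(3)[OF h] by (simp add: scaleR_add_right mult.commute)
    then show "norm (D h n - h ^ q *\<^sub>R \<delta> n) \<le> K * \<rho> ^ n * h ^ Suc q"
      using mult_left_mono[OF K[OF h], of "h ^ Suc q"] h by (simp add: mult_ac)
  qed
  then show ?thesis by (rule that[OF \<rho>(1,2) F(1)])
qed

text \<open>Taylor expansion of \<open>g\<close> in the decaying component \<open>B\<close> turns the difference into products of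
  \<open>B\<close> with smooth functions of \<open>(h, n h)\<close>; the latter cost only powers of \<open>n\<close>, which the
  geometric weight absorbs.\<close>

lemma geo_expands_compose_diff:
  fixes g :: "'a::euclidean_space \<Rightarrow> 'b::euclidean_space"
  assumes g: "Ck (M + M) g" and A: "Ck M A" and B: "geo_expands T M B" and T: "0 < T" and M: "1 \<le> M"
    and ord: "\<And>n. order_at_0 1 (\<lambda>h. B h n)"
  shows "geo_expands T M (\<lambda>h n. g (A (h, real n * h) + B h n) - g (A (h, real n * h)))"
proof -
  obtain \<rho>' where \<rho>': "0 < \<rho>'" "\<rho>' < 1" "expands T M (\<lambda>n. \<rho>' ^ n) B" using geo_expandsE[OF B] by blast
  obtain CB \<rho>'' where CB': "0 \<le> CB" "0 < \<rho>''" "\<rho>'' < 1"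
    "\<And>h n. 0 < h \<Longrightarrow> h \<le> 1 \<Longrightarrow> real n * h \<le> T \<Longrightarrow> norm (B h n) \<le> CB * h ^ 1 * \<rho>'' ^ n"
    using geo_expands_order[OF B T ord M] by blast
  \<comment> \<open>One rate belongs to the expansion of \<open>B\<close>, the other to the estimate
    that carries a factor h; the slower serves both.\<close>
  define \<rho> where "\<rho> = max \<rho>' \<rho>''"
  have \<rho>: "0 < \<rho>" "\<rho> < 1" "\<rho>' \<le> \<rho>" "\<rho>'' \<le> \<rho>" using \<rho>' CB' by (auto simp: \<rho>_def)
  have w: "0 \<le> \<rho> ^ n" "\<rho> ^ n \<le> 1" for n using \<rho> by (auto simp: power_le_one)
  have B\<rho>: "expands T M (\<lambda>n. \<rho> ^ n) B"
    by (rule expands_weight_mono[of 1, OF _ _ _ \<rho>'(3)]) (use \<rho> \<rho>' in \<open>auto intro: power_mono\<close>)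
  have CB: "norm (B h n) \<le> CB * h * \<rho> ^ n" if "0 < h" "h \<le> 1" "real n * h \<le> T" for h n
  proof -
    have "CB * h ^ 1 * \<rho>'' ^ n \<le> CB * h * \<rho> ^ n"
      using that \<rho> CB' by (intro mult_mono power_mono) auto
    then show ?thesis using CB'(4)[OF that] by linarith
  qed
  have "compact ({0..1::real} \<times> {0..T})" by (intro compact_Times compact_Icc)
  from continuous_on_compact_norm_bound[OF Ck_continuous[OF A] this]
  obtain CA where CA: "CA > 0" "\<And>x. x \<in> {0..1} \<times> {0..T} \<Longrightarrow> norm (A x) \<le> CA"
    by (rule; blast)
  from taylor_iter_deriv_ball[OF Ck_mono[OF g], of M "CA + CB"] obtain K where K: "K > 0"
    "\<forall>x y. norm x \<le> CA + CB \<longrightarrow> norm y \<le> CA + CB \<longrightarrow>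
      norm (g y - (\<Sum>r<M. iter_deriv r g x (y - x) /\<^sub>R fact r)) \<le> K * norm (y - x) ^ M" by auto
  define W where "W n = (1 + real n) ^ M * \<rho> ^ n" for n
  have W: "0 \<le> W n" "\<rho> ^ n \<le> W n" for n
    using w(1)[of n] mult_right_mono[OF one_le_power[of "1 + real n" M] w(1)[of n]]
    by (simp_all add: W_def)
  define P where "P h n = (\<Sum>r\<in>{1..<M}. iter_deriv r g (A (h, real n * h)) (B h n) /\<^sub>R fact r)" for h n
  have "expands T M W P"
    unfolding P_def
  proof (intro expands_sum expands_bounded_linear[OF bounded_linear_scaleR_right])
    fix r assume "r \<in> {1..<M}"
    then obtain s where s: "r = Suc s" "Suc s < M" by (cases r) auto
    show "expands T M W (\<lambda>h n. iter_deriv r g (A (h, real n * h)) (B h n))"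
      unfolding W_def s(1) by (rule expands_iter_deriv[OF A B\<rho> w Ck_mono[OF g]]) (use s in simp)
  qed
  moreover have "expands T M W (\<lambda>h n. g (A (h, real n * h) + B h n) - g (A (h, real n * h)) - P h n)"
  proof (rule expands_remainder[where C="K * CB ^ M"])
    fix h :: real and n assume h: "0 < h" "h \<le> 1" "real n * h \<le> T"
    let ?a = "A (h, real n * h)"
    have a: "norm ?a \<le> CA" using h by (intro CA(2)) auto
    have b: "norm (B h n) \<le> CB * h * \<rho> ^ n" by (rule CB[OF h])
    also have "\<dots> \<le> CB * 1 * 1" using CB'(1) h w by (intro mult_mono) auto
    finally have "norm (?a + B h n) \<le> CA + CB" using a by (intro norm_triangle_mono) auto
    then have "norm (g (?a + B h n) - (\<Sum>r<M. iter_deriv r g ?a (B h n) /\<^sub>R fact r)) \<le> K * norm (B h n) ^ M"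
      using K(2)[rule_format, of ?a "?a + B h n"] a CB'(1) by simp
    moreover have "(\<Sum>r<M. iter_deriv r g ?a (B h n) /\<^sub>R fact r) = g ?a + P h n"
    proof -
      have "{..<M} = insert 0 {1..<M}" using M by auto
      then show ?thesis by (simp add: P_def)
    qed
    moreover have "K * norm (B h n) ^ M \<le> K * CB ^ M * h ^ M * W n"
    proof -
      have "norm (B h n) ^ M \<le> (CB * h * \<rho> ^ n) ^ M" by (rule power_mono[OF b]) simp
      also have "\<dots> = CB ^ M * h ^ M * (\<rho> ^ n) ^ M" by (simp add: power_mult_distrib)
      also have "\<dots> \<le> CB ^ M * h ^ M * W n"
      proof (rule mult_left_mono)
        \<comment> \<open>A single one of the \<open>M\<close> decaying factors suffices, which is
          where \<open>M\<close> being positive enters.\<close>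
        have "(\<rho> ^ n) ^ M \<le> (\<rho> ^ n) ^ 1" using w M by (intro power_decreasing) auto
        then show "(\<rho> ^ n) ^ M \<le> W n" using W(2)[of n] by simp
      qed (use CB'(1) h in simp)
      finally show ?thesis using K(1) by (simp add: mult.assoc)
    qed
    ultimately show "norm (g (?a + B h n) - g ?a - P h n) \<le> K * CB ^ M * h ^ M * W n"
      by (simp add: diff_diff_eq)
  qed
  ultimately have "expands T M W (\<lambda>h n. P h n + (g (A (h, real n * h) + B h n) - g (A (h, real n * h)) - P h n))"
    by (rule expands_add)
  then have WE: "expands T M W (\<lambda>h n. g (A (h, real n * h) + B h n) - g (A (h, real n * h)))" by simp
  obtain C \<sigma> where "0 \<le> C" "0 < \<sigma>" "\<sigma> < 1" "\<forall>n. (1 + real n) ^ M * \<rho> ^ n \<le> C * \<sigma> ^ n"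
    using polynomial_times_geometric[OF \<rho>(1,2)] by blast
  then show ?thesis
    using W(1) by (intro geo_expandsI[of \<sigma>] expands_weight_mono[of C W, OF _ _ _ WE]) (auto simp: W_def)
qed

section \<open>Pointwise expansions at step size zero\<close>

lemma smooth_taylor_at_0:
  fixes \<phi> :: "real \<Rightarrow> 'a::euclidean_space"
  assumes "Ck M \<phi>"
  shows "order_at_0 M (\<lambda>h. \<phi> (real j * h) - (\<Sum>r<M. (real j * h) ^ r *\<^sub>R (iter_deriv r \<phi> 0 1 /\<^sub>R fact r)))"
proof -
  from taylor_iter_deriv[OF assms compact_Icc[of 0 1]] obtain C where C: "C > 0"
    "\<forall>x v. closed_segment x (x + v) \<subseteq> {0..1} \<longrightarrow>
      norm (\<phi> (x + v) - (\<Sum>r<M. iter_deriv r \<phi> x v /\<^sub>R fact r)) \<le> C * norm v ^ M" by auto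
  show ?thesis
  proof (rule order_at_0I[of "1 / (real j + 1)" _ "C * real j ^ M"])
    fix h :: real assume h: "0 < h" "h < 1 / (real j + 1)"
    then have "real j * h + h \<le> 1" by (simp add: field_simps)
    then have "closed_segment 0 (0 + real j * h) \<subseteq> {0..1}"
      using h by (auto simp: closed_segment_eq_real_ivl)
    then have "norm (\<phi> (0 + real j * h) - (\<Sum>r<M. iter_deriv r \<phi> 0 (real j * h) /\<^sub>R fact r)) \<le> C * norm (real j * h) ^ M"
      using C(2) by blast
    moreover have "iter_deriv r \<phi> 0 (real j * h) = (real j * h) ^ r *\<^sub>R iter_deriv r \<phi> 0 1" for r
      using iter_deriv_scaleR[of r \<phi> 0 "real j * h" 1] by simp
    ultimately show "norm (\<phi> (real j * h) - (\<Sum>r<M. (real j * h) ^ r *\<^sub>R (iter_deriv r \<phi> 0 1 /\<^sub>R fact r)))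
        \<le> C * real j ^ M * h ^ M"
      using h by (simp add: mult.commute[of "inverse _"] abs_mult power_mult_distrib mult.assoc)
  qed simp
qed

lemma frechet_derivative_real_eq:
  assumes "(\<phi> has_vector_derivative v) (at s)"
  shows "frechet_derivative \<phi> (at s) 1 = v"
proof -
  have "(\<lambda>c. c *\<^sub>R v) = frechet_derivative \<phi> (at s)"
    using assms frechet_derivative_at unfolding has_vector_derivative_def by blast
  then show ?thesis by (metis scaleR_one)
qed

lemma smooth_zeroth_order:
  fixes \<phi> :: "real \<Rightarrow> 'a::euclidean_space"
  assumes "Ck 1 \<phi>"
  shows "order_at_0 1 (\<lambda>h. \<phi> h - \<phi> 0)"
  using smooth_taylor_at_0[OF assms, of 1] by simp

lemma smooth_first_order:
  fixes \<phi> :: "real \<Rightarrow> 'a::euclidean_space"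
  assumes "Ck 2 \<phi>" "(\<phi> has_vector_derivative \<phi>') (at 0)"
  shows "order_at_0 2 (\<lambda>h. \<phi> h - \<phi> 0 - h *\<^sub>R \<phi>')"
proof -
  have "(\<Sum>r<2. h ^ r *\<^sub>R (iter_deriv r \<phi> 0 1 /\<^sub>R fact r)) = \<phi> 0 + h *\<^sub>R \<phi>'" for h
    using frechet_derivative_real_eq[OF assms(2)] by (simp add: numeral_2_eq_2)
  then show ?thesis using smooth_taylor_at_0[OF assms(1), of 1] by (simp add: diff_diff_eq)
qed

lemma order_at_0_compose_diff:
  fixes g :: "'a::euclidean_space \<Rightarrow> 'b::euclidean_space"
  assumes g: "Ck 1 g" and a: "order_at_0 0 a" and ab: "order_at_0 q (\<lambda>h. b h - a h)"
  shows "order_at_0 q (\<lambda>h. g (b h) - g (a h))"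
proof -
  obtain Ca ha where Ca: "0 \<le> Ca" "0 < ha" "\<And>h. 0 < h \<Longrightarrow> h < ha \<Longrightarrow> norm (a h) \<le> Ca * h ^ 0"
    by (rule order_at_0D[OF a]) (rule that; (assumption | simp))
  obtain Cb hb where Cb: "0 \<le> Cb" "0 < hb" "hb \<le> 1" "\<And>h. 0 < h \<Longrightarrow> h < hb \<Longrightarrow> norm (b h - a h) \<le> Cb * h ^ q"
    by (rule order_at_0D[OF ab]) (rule that; (assumption | simp))
  obtain L where L: "L > 0" "\<forall>x y. norm x \<le> Ca + Cb \<longrightarrow> norm y \<le> Ca + Cb \<longrightarrow> norm (g y - g x) \<le> L * norm (y - x)"
    using Ck_lipschitz_on_ball[OF g] by blast
  show ?thesis
  proof (rule order_at_0I[of "min ha hb" _ "L * Cb"])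
    fix h assume h: "0 < h" "h < min ha hb"
    have a: "norm (a h) \<le> Ca" using Ca(3)[of h] h by simp
    have d: "norm (b h - a h) \<le> Cb * h ^ q" using Cb(4)[of h] h by simp
    also have "\<dots> \<le> Cb * 1" using Cb h by (intro mult_left_mono) (auto simp: power_le_one)
    finally have "norm (a h + (b h - a h)) \<le> Ca + Cb" using a by (intro norm_triangle_mono) auto
    then have "norm (g (b h) - g (a h)) \<le> L * norm (b h - a h)" using L(2) a Cb(1) by simp
    also have "\<dots> \<le> L * (Cb * h ^ q)" using d L(1) by simp
    finally show "norm (g (b h) - g (a h)) \<le> L * Cb * h ^ q" by (simp add: mult.assoc)
  qed (use Ca Cb in simp)
qed

text \<open>Two errors arise. The quadratic Taylor remainder is of size h^(2 q), and 2 q is at least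
  q + 1. Freezing base point and direction at h = 0 costs one factor h on top of
  \<open>h ^ q\<close>.\<close>

lemma order_at_0_linearization:
  fixes g :: "'a::euclidean_space \<Rightarrow> 'b::euclidean_space" and a b :: "real \<Rightarrow> 'a"
  assumes g: "Ck 2 g" and a: "Ck 1 a" and b: "Ck 1 b" and q: "1 \<le> q"
  shows "order_at_0 (Suc q)
    (\<lambda>h. g (a h + h ^ q *\<^sub>R b h) - g (a h) - h ^ q *\<^sub>R frechet_derivative g (at (a 0)) (b 0))"
proof -
  have "Ck (Suc 1) g" using g by (simp add: numeral_2_eq_2)
  then have "Ck 1 (\<lambda>h. frechet_derivative g (at (a h)) (b h))"
    by (rule Ck_derivative_apply[OF _ a b])
  then have "order_at_0 1 (\<lambda>h. frechet_derivative g (at (a h)) (b h) - frechet_derivative g (at (a 0)) (b 0))"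
    by (rule smooth_zeroth_order)
  from order_at_0_scaleR_power[OF this, of q]
  have lin: "order_at_0 (Suc q) (\<lambda>h. h ^ q *\<^sub>R
      (frechet_derivative g (at (a h)) (b h) - frechet_derivative g (at (a 0)) (b 0)))" by simp
  obtain Ca where Ca: "Ca > 0" "\<And>h. h \<in> {0..1} \<Longrightarrow> norm (a h) \<le> Ca"
    using continuous_on_compact_norm_bound[OF Ck_continuous[OF a] compact_Icc] by blast
  obtain Cb where Cb: "Cb > 0" "\<And>h. h \<in> {0..1} \<Longrightarrow> norm (b h) \<le> Cb"
    using continuous_on_compact_norm_bound[OF Ck_continuous[OF b] compact_Icc] by blast
  from taylor_iter_deriv_ball[OF g, of "Ca + Cb"] obtain K where K: "K > 0"
    "\<forall>x y. norm x \<le> Ca + Cb \<longrightarrow> norm y \<le> Ca + Cb \<longrightarrow>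
      norm (g y - (\<Sum>r<2. iter_deriv r g x (y - x) /\<^sub>R fact r)) \<le> K * norm (y - x) ^ 2" by auto
  have "order_at_0 (Suc q) (\<lambda>h. g (a h + h ^ q *\<^sub>R b h) - g (a h) - h ^ q *\<^sub>R frechet_derivative g (at (a h)) (b h))"
  proof (rule order_at_0I[of 1 _ "K * Cb ^ 2"])
    fix h :: real assume h: "0 < h" "h < 1"
    let ?v = "h ^ q *\<^sub>R b h"
    have ah: "norm (a h) \<le> Ca" using Ca(2) h by simp
    have v: "norm ?v \<le> h ^ q * Cb" using Cb(2)[of h] h by simp
    also have "\<dots> \<le> 1 * Cb" using Cb(1) h by (intro mult_right_mono) (auto simp: power_le_one)
    finally have "norm (a h + ?v) \<le> Ca + Cb" using ah by (intro norm_triangle_mono) auto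
    then have "norm (g (a h + ?v) - (\<Sum>r<2. iter_deriv r g (a h) (a h + ?v - a h) /\<^sub>R fact r)) \<le> K * norm (a h + ?v - a h) ^ 2"
      using K(2)[rule_format, of "a h" "a h + ?v"] ah Cb(1) by simp
    then have "norm (g (a h + ?v) - (\<Sum>r<2. iter_deriv r g (a h) ?v /\<^sub>R fact r)) \<le> K * norm ?v ^ 2"
      unfolding add_diff_cancel_left' .
    moreover have "frechet_derivative g (at (a h)) (b h) =
        (\<Sum>i\<in>Basis. inner (b h) i *\<^sub>R frechet_derivative g (at (a h)) i)"
      by (rule linear_sum_Basis[OF Ck_derivative_linear[OF \<open>Ck (Suc 1) g\<close>]])
    then have "(\<Sum>r<2. iter_deriv r g (a h) ?v /\<^sub>R fact r) = g (a h) + h ^ q *\<^sub>R frechet_derivative g (at (a h)) (b h)"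
      by (simp add: numeral_2_eq_2 scaleR_sum_right)
    moreover have "K * norm ?v ^ 2 \<le> K * Cb ^ 2 * h ^ Suc q"
    proof -
      have "norm ?v ^ 2 \<le> (h ^ q * Cb) ^ 2" by (rule power_mono[OF v]) simp
      also have "\<dots> = Cb ^ 2 * h ^ (q + q)" by (simp add: power2_eq_square power_add mult_ac)
      also have "\<dots> \<le> Cb ^ 2 * h ^ Suc q"
        using h q Cb(1) by (intro mult_left_mono power_decreasing) auto
      finally show ?thesis using K(1) by (simp add: mult.assoc)
    qed
    ultimately show "norm (g (a h + ?v) - g (a h) - h ^ q *\<^sub>R frechet_derivative g (at (a h)) (b h)) \<le> K * Cb ^ 2 * h ^ Suc q"
      by (simp add: diff_diff_eq)
  qed simp
  from order_at_0_add[OF this lin] show ?thesis by (simp add: scaleR_diff_right)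
qed

section \<open>Expansions of a single function of the step size, and solutions of linear
  recurrences\<close>

definition has_expansion_at_0 :: "nat \<Rightarrow> (real \<Rightarrow> 'a::real_normed_vector) \<Rightarrow> bool" where
  "has_expansion_at_0 M \<phi> \<longleftrightarrow> (\<exists>c. order_at_0 M (\<lambda>h. \<phi> h - (\<Sum>i<M. h ^ i *\<^sub>R c i)))"

lemma has_expansion_at_0_diff:
  assumes "has_expansion_at_0 M \<phi>" "has_expansion_at_0 M \<psi>"
  shows "has_expansion_at_0 M (\<lambda>h. \<phi> h - \<psi> h)"
proof -
  obtain c d where "order_at_0 M (\<lambda>h. \<phi> h - (\<Sum>i<M. h ^ i *\<^sub>R c i))" "order_at_0 M (\<lambda>h. \<psi> h - (\<Sum>i<M. h ^ i *\<^sub>R d i))"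
    using assms unfolding has_expansion_at_0_def by blast
  from order_at_0_diff[OF this]
  have "order_at_0 M (\<lambda>h. \<phi> h - \<psi> h - (\<Sum>i<M. h ^ i *\<^sub>R (c i - d i)))"
    by (simp add: scaleR_diff_right sum_subtractf algebra_simps)
  then show ?thesis unfolding has_expansion_at_0_def by (rule exI[of _ "\<lambda>i. c i - d i"])
qed

lemma has_expansion_at_0_mono:
  assumes "has_expansion_at_0 M \<phi>" "K \<le> M"
  shows "has_expansion_at_0 K \<phi>"
proof -
  obtain c where c: "order_at_0 M (\<lambda>h. \<phi> h - (\<Sum>i<M. h ^ i *\<^sub>R c i))"
    using assms unfolding has_expansion_at_0_def by blast
  have "order_at_0 K (\<lambda>h. \<Sum>i\<in>{K..<M}. h ^ i *\<^sub>R c i)"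
  proof (rule order_at_0_sum)
    fix i assume "i \<in> {K..<M}"
    then show "order_at_0 K (\<lambda>h. h ^ i *\<^sub>R c i)"
      using order_at_0_mono[OF order_at_0_scaleR_power[OF order_at_0_const[of "c i"], of i], of K] by simp
  qed
  from order_at_0_add[OF order_at_0_mono[OF c assms(2)] this]
  have "order_at_0 K (\<lambda>h. \<phi> h - (\<Sum>i<M. h ^ i *\<^sub>R c i) + (\<Sum>i\<in>{K..<M}. h ^ i *\<^sub>R c i))" .
  moreover have "(\<Sum>i<M. h ^ i *\<^sub>R c i) = (\<Sum>i<K. h ^ i *\<^sub>R c i) + (\<Sum>i\<in>{K..<M}. h ^ i *\<^sub>R c i)" for h
    unfolding lessThan_atLeast0 by (rule sum.atLeastLessThan_concat[symmetric]) (use assms in auto)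
  ultimately have "order_at_0 K (\<lambda>h. \<phi> h - (\<Sum>i<K. h ^ i *\<^sub>R c i))" by simp
  then show ?thesis unfolding has_expansion_at_0_def by blast
qed

lemma has_expansion_at_0_leading_coefficient:
  assumes "has_expansion_at_0 (Suc q) \<phi>" "order_at_0 q \<phi>"
  obtains s where "order_at_0 (Suc q) (\<lambda>h. \<phi> h - h ^ q *\<^sub>R s)"
proof -
  obtain c where c: "order_at_0 (Suc q) (\<lambda>h. \<phi> h - (\<Sum>i<Suc q. h ^ i *\<^sub>R c i))"
    using assms unfolding has_expansion_at_0_def by blast
  have "order_at_0 q (\<lambda>h. \<phi> h - (\<phi> h - (\<Sum>i<Suc q. h ^ i *\<^sub>R c i)))"
    by (rule order_at_0_diff[OF assms(2) order_at_0_mono[OF c]]) simp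
  then have "order_at_0 q (\<lambda>h. \<Sum>i<Suc q. h ^ i *\<^sub>R c i)" by (simp del: sum.lessThan_Suc)
  then have "c i = 0" if "i < q" for i
    using order_at_0_coeff_eq_0[where q=q and M="Suc q" and c=c] that by (simp del: sum.lessThan_Suc)
  then have "(\<Sum>i<Suc q. h ^ i *\<^sub>R c i) = h ^ q *\<^sub>R c q" for h by simp
  then show ?thesis using c that by simp
qed

lemma expands_imp_has_expansion_at_0:
  assumes T: "0 < T"
  shows "expands T M w D \<Longrightarrow> has_expansion_at_0 M (\<lambda>h. D h n)"
proof (induction M arbitrary: D)
  case 0
  obtain C where "\<And>h n. 0 < h \<Longrightarrow> h \<le> 1 \<Longrightarrow> real n * h \<le> T \<Longrightarrow> norm (D h n) \<le> C * w n"
    using expands_0E[OF 0] by blast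
  then have "order_at_0 0 (\<lambda>h. D h n)" by (intro order_at_0_grid[OF T, of n _ "C * w n"]) simp
  then show ?case by (simp add: has_expansion_at_0_def)
next
  case (Suc M)
  obtain d C E where "\<And>n. norm (d n) \<le> C * w n" and E: "expands T M w E"
    "\<And>h n. 0 < h \<Longrightarrow> h \<le> 1 \<Longrightarrow> real n * h \<le> T \<Longrightarrow> D h n = d n + h *\<^sub>R E h n"
    using expands_SucE[OF Suc.prems] by blast
  obtain c where c: "order_at_0 M (\<lambda>h. E h n - (\<Sum>i<M. h ^ i *\<^sub>R c i))"
    using Suc.IH[OF E(1)] unfolding has_expansion_at_0_def by blast
  define c' where "c' i = (case i of 0 \<Rightarrow> d n | Suc i \<Rightarrow> c i)" for i
  have "order_at_0 (Suc M) (\<lambda>h. h *\<^sub>R (E h n - (\<Sum>i<M. h ^ i *\<^sub>R c i)))"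
    using order_at_0_scaleR_power[OF c, of 1] by simp
  then have "order_at_0 (Suc M) (\<lambda>h. D h n - (\<Sum>i<Suc M. h ^ i *\<^sub>R c' i))"
  proof (rule order_at_0_cong)
    show "0 < min 1 (T / (real n + 1))" using T by simp
    fix h assume h: "0 < h" "h < min 1 (T / (real n + 1))"
    have "real n * h \<le> (real n + 1) * h" using h by simp
    also have "\<dots> \<le> T" using h by (simp add: field_simps)
    finally show "h *\<^sub>R (E h n - (\<Sum>i<M. h ^ i *\<^sub>R c i)) = D h n - (\<Sum>i<Suc M. h ^ i *\<^sub>R c' i)"
      using E(2)[of h n] h unfolding sum.lessThan_Suc_shift
      by (simp add: c'_def scaleR_diff_right scaleR_sum_right)
  qed
  then show ?case unfolding has_expansion_at_0_def by (rule exI[of _ c'])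
qed

text \<open>Solves the constant-coefficient problem with freely chosen starting values, which later
  absorb the starting error.\<close>

fun linear_recurrence :: "nat \<Rightarrow> (nat \<Rightarrow> real) \<Rightarrow> (nat \<Rightarrow> 'a::real_vector) \<Rightarrow> (nat \<Rightarrow> 'a) \<Rightarrow> nat \<Rightarrow> 'a" where
  "linear_recurrence k \<alpha> s r n = (if n < k then s n else
     (r (n - k) - (\<Sum>j<k. \<alpha> j *\<^sub>R linear_recurrence k \<alpha> s r (n - k + j))) /\<^sub>R \<alpha> k)"

declare linear_recurrence.simps [simp del]

lemma linear_recurrence_start: "n < k \<Longrightarrow> linear_recurrence k \<alpha> s r n = s n"
  by (subst linear_recurrence.simps) simp

lemma linear_recurrence_step:
  assumes "\<alpha> k \<noteq> 0"
  shows "(\<Sum>j\<le>k. \<alpha> j *\<^sub>R linear_recurrence k \<alpha> s r (n + j)) = r n"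
proof -
  have "\<alpha> k *\<^sub>R linear_recurrence k \<alpha> s r (n + k) = r n - (\<Sum>j<k. \<alpha> j *\<^sub>R linear_recurrence k \<alpha> s r (n + j))"
    by (subst linear_recurrence.simps) (use assms in simp)
  then show ?thesis by (simp add: lessThan_Suc_atMost[symmetric])
qed

section \<open>Construction of the error expansion\<close>

lemma has_vector_derivative_affine_compose:
  assumes "(E has_vector_derivative E') (at t)"
  shows "((\<lambda>\<sigma>. E (t + real j * \<sigma>)) has_vector_derivative real j *\<^sub>R E') (at 0)"
proof -
  have "((\<lambda>\<sigma>. t + real j * \<sigma>) has_vector_derivative real j) (at 0)"
    by (auto intro!: derivative_eq_intros simp flip: has_real_derivative_iff_has_vector_derivative)
  moreover have "(E has_vector_derivative E') (at (t + real j * 0))" using assms by simp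
  ultimately show ?thesis using vector_diff_chain_at by (fastforce simp: o_def)
qed

text \<open>An autonomous problem on [0, T] whose error expansion is to stop at order
  \<open>N\<close>. Here \<open>Y\<close> enters only through its starting values; the recursion is
  added for the stability part.\<close>

locale lmm_autonomous =
  fixes k p N :: nat and \<alpha> \<beta> :: "nat \<Rightarrow> real" and g :: "'a::euclidean_space \<Rightarrow> 'a"
    and T :: real and X :: "real \<Rightarrow> 'a" and Y :: "real \<Rightarrow> nat \<Rightarrow> 'a"
  assumes k: "k \<ge> 1" and lead: "\<alpha> k \<noteq> 0" and eig: "eigenvalue_condition (companion k \<alpha>)"
    and p: "1 \<le> p" and pN: "p \<le> N"
    and sum_alpha: "(\<Sum>j\<le>k. \<alpha> j) = 0"
    and order_cond: "\<And>q. 1 \<le> q \<Longrightarrow> q \<le> p \<Longrightarrow>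
      (\<Sum>j\<le>k. \<alpha> j * real j ^ q) = real q * (\<Sum>j\<le>k. \<beta> j * real j ^ (q - 1))"
    and T: "0 < T" and g: "Ck ((N + 2) * (N + 2)) g" and X: "Ck ((N + 2) * (N + 2)) X"
    and ode: "\<And>t. t \<in> {0..T} \<Longrightarrow> (X has_vector_derivative g (X t)) (at t)"
    and start_order: "\<And>j. j < k \<Longrightarrow> order_at_0 p (\<lambda>h. Y h j - X (real j * h))"
    and start_exp: "\<And>j. j < k \<Longrightarrow> has_expansion_at_0 N (\<lambda>h. Y h j)"
begin

text \<open>The arguments are the step size and a continuous time, so that Taylor's theorem applies;
  the grid is recovered at t = n h.\<close>

definition smooth_residual :: "(real \<times> real \<Rightarrow> 'a) \<Rightarrow> real \<times> real \<Rightarrow> 'a" where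
  "smooth_residual A z = (\<Sum>j\<le>k. \<alpha> j *\<^sub>R A (fst z, snd z + real j * fst z)) -
     fst z *\<^sub>R (\<Sum>j\<le>k. \<beta> j *\<^sub>R g (A (fst z, snd z + real j * fst z)))"

text \<open>On the grid, the residual of \<open>A + B\<close> is \<open>smooth_residual A\<close>
  plus this term. The difference of values of \<open>g\<close> vanishes with \<open>B\<close>, which
  is why the term inherits the decay.\<close>

definition decaying_residual :: "(real \<times> real \<Rightarrow> 'a) \<Rightarrow> (real \<Rightarrow> nat \<Rightarrow> 'a) \<Rightarrow> real \<Rightarrow> nat \<Rightarrow> 'a" where
  "decaying_residual A B h n = (\<Sum>j\<le>k. \<alpha> j *\<^sub>R B h (n + j)) -
     h *\<^sub>R (\<Sum>j\<le>k. \<beta> j *\<^sub>R (g (A (h, real (n + j) * h) + B h (n + j)) - g (A (h, real (n + j) * h))))"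

text \<open>The class of the smooth part at stage q. A step spends \<open>N + 2\<close> derivatives,
  enough for the residual coefficient of order q + 1 and its remainder, and \<open>N + 2\<close> are
  still left at stage \<open>N\<close>.\<close>

definition regularity :: "nat \<Rightarrow> nat" where
  "regularity q = (N + 2) * (N + 1 - q)"

lemma regularity_Suc: "q < N \<Longrightarrow> regularity q = N + 2 + regularity (Suc q)"
  unfolding regularity_def by (simp add: Suc_diff_le flip: Suc_diff_Suc)

lemma regularity_ge: "q \<le> N \<Longrightarrow> N + 2 \<le> regularity q"
  unfolding regularity_def using mult_le_mono2[of 1 "N + 1 - q" "N + 2"] by simp

lemma regularity_le: "regularity q \<le> (N + 2) * (N + 2)"
  unfolding regularity_def by (intro mult_le_mono2) simp

lemma Ck_smooth_residual:
  assumes "Ck s A" "Ck s g"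
  shows "Ck s (smooth_residual A)"
proof -
  have "Ck s (\<lambda>z::real \<times> real. (fst z, snd z + real j * fst z))" for j
    by (intro Ck_bounded_linear bounded_linear_Pair bounded_linear_add bounded_linear_fst bounded_linear_snd
        bounded_linear_const_mult)
  note 1 = Ck_compose[OF this assms(1)]
  note 2 = Ck_compose[OF 1 assms(2)]
  show ?thesis
    unfolding smooth_residual_def[abs_def]
    by (intro Ck_diff Ck_sum Ck_scaleR Ck_const 1 2 Ck_bounded_linear bounded_linear_fst)
qed

lemma sum_beta: "(\<Sum>j\<le>k. \<alpha> j * real j) = (\<Sum>j\<le>k. \<beta> j)"
  using order_cond[of 1] p by simp

lemma sum_beta_nonzero: "(\<Sum>j\<le>k. \<beta> j) \<noteq> 0"
  using rho_poly_derivative_nonzero[where k=k and \<alpha>=\<alpha>, OF k lead eig] sum_beta by simp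

text \<open>With the derivative of X in place of g(X), the order conditions cancel the Taylor
  polynomials of both sums identically, and two remainders of order p + 1 are left.\<close>

lemma smooth_residual_solution:
  assumes t: "0 \<le> t" "t < T"
  shows "order_at_0 (Suc p) (\<lambda>\<sigma>. smooth_residual (\<lambda>z. X (snd z)) (\<sigma>, t))"
proof -
  define \<phi> where "\<phi> s = X (t + s)" for s
  define \<psi> where "\<psi> s = frechet_derivative \<phi> (at s) 1" for s
  define c where "c r = iter_deriv r \<phi> 0 1 /\<^sub>R fact r" for r
  have "Suc p \<le> (N + 2) * (N + 2)" using pN by simp
  then have "Ck (Suc p) X" by (rule Ck_mono[OF X])
  then have \<phi>: "Ck (Suc p) \<phi>"
    unfolding \<phi>_def[abs_def]
    by (rule Ck_compose[OF Ck_add[OF Ck_const Ck_bounded_linear[OF bounded_linear_ident]]])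
  have \<psi>: "Ck p \<psi>" unfolding \<psi>_def[abs_def] by (rule Ck_SucD(2)[OF \<phi>])
  have \<psi>_coeff: "iter_deriv r \<psi> 0 1 /\<^sub>R fact r = (1 + real r) *\<^sub>R c (Suc r)" for r
    by (simp add: c_def \<psi>_def[abs_def] divide_simps)
  have \<phi>_exp: "order_at_0 (Suc p) (\<lambda>\<sigma>. \<phi> (real j * \<sigma>) - (\<Sum>r<Suc p. (real j * \<sigma>) ^ r *\<^sub>R c r))" for j
    unfolding c_def by (rule smooth_taylor_at_0[OF \<phi>])
  have \<psi>_exp: "order_at_0 p (\<lambda>\<sigma>. \<psi> (real j * \<sigma>) - (\<Sum>r<p. (real j * \<sigma>) ^ r *\<^sub>R ((1 + real r) *\<^sub>R c (Suc r))))" for j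
    unfolding \<psi>_coeff[symmetric] by (rule smooth_taylor_at_0[OF \<psi>])
  have cancel: "(\<Sum>j\<le>k. \<alpha> j *\<^sub>R (\<Sum>r<Suc p. (real j * \<sigma>) ^ r *\<^sub>R c r)) =
      \<sigma> *\<^sub>R (\<Sum>j\<le>k. \<beta> j *\<^sub>R (\<Sum>r<p. (real j * \<sigma>) ^ r *\<^sub>R ((1 + real r) *\<^sub>R c (Suc r))))" for \<sigma>
  proof -
    have "(\<Sum>j\<le>k. \<alpha> j *\<^sub>R (\<Sum>r<Suc p. (real j * \<sigma>) ^ r *\<^sub>R c r)) =
        (\<Sum>r<Suc p. (\<Sum>j\<le>k. \<alpha> j * real j ^ r) *\<^sub>R (\<sigma> ^ r *\<^sub>R c r))"
      unfolding scaleR_sum_right scaleR_sum_left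
      by (subst sum.swap) (simp add: power_mult_distrib mult.assoc)
    also have "\<dots> = (\<Sum>r<p. (\<Sum>j\<le>k. \<alpha> j * real j ^ Suc r) *\<^sub>R (\<sigma> ^ Suc r *\<^sub>R c (Suc r)))"
      unfolding sum.lessThan_Suc_shift using sum_alpha by simp
    also have "\<dots> = (\<Sum>r<p. (real (Suc r) * (\<Sum>j\<le>k. \<beta> j * real j ^ r)) *\<^sub>R (\<sigma> ^ Suc r *\<^sub>R c (Suc r)))"
      by (intro sum.cong refl) (simp only: order_cond lessThan_iff Suc_le_eq[symmetric] le_add1 plus_1_eq_Suc[symmetric] add_diff_cancel_left')
    also have "\<dots> = \<sigma> *\<^sub>R (\<Sum>j\<le>k. \<beta> j *\<^sub>R (\<Sum>r<p. (real j * \<sigma>) ^ r *\<^sub>R ((1 + real r) *\<^sub>R c (Suc r))))"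
      unfolding scaleR_sum_right sum_distrib_left scaleR_sum_left
      by (subst sum.swap) (simp add: power_mult_distrib mult_ac)
    finally show ?thesis .
  qed
  have "order_at_0 (Suc p) (\<lambda>\<sigma>. (\<Sum>j\<le>k. \<alpha> j *\<^sub>R (\<phi> (real j * \<sigma>) - (\<Sum>r<Suc p. (real j * \<sigma>) ^ r *\<^sub>R c r))))"
    by (rule order_at_0_sum) (rule order_at_0_bounded_linear[OF bounded_linear_scaleR_right \<phi>_exp])
  moreover have "order_at_0 (1 + p) (\<lambda>\<sigma>. \<sigma> ^ 1 *\<^sub>R (\<Sum>j\<le>k. \<beta> j *\<^sub>R (\<psi> (real j * \<sigma>) -
      (\<Sum>r<p. (real j * \<sigma>) ^ r *\<^sub>R ((1 + real r) *\<^sub>R c (Suc r))))))"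
    by (rule order_at_0_scaleR_power, rule order_at_0_sum)
      (rule order_at_0_bounded_linear[OF bounded_linear_scaleR_right \<psi>_exp])
  ultimately have "order_at_0 (Suc p) (\<lambda>\<sigma>. (\<Sum>j\<le>k. \<alpha> j *\<^sub>R (\<phi> (real j * \<sigma>) - (\<Sum>r<Suc p. (real j * \<sigma>) ^ r *\<^sub>R c r)))
     - \<sigma> *\<^sub>R (\<Sum>j\<le>k. \<beta> j *\<^sub>R (\<psi> (real j * \<sigma>) - (\<Sum>r<p. (real j * \<sigma>) ^ r *\<^sub>R ((1 + real r) *\<^sub>R c (Suc r))))))"
    using order_at_0_diff by fastforce
  then have res: "order_at_0 (Suc p) (\<lambda>\<sigma>. (\<Sum>j\<le>k. \<alpha> j *\<^sub>R \<phi> (real j * \<sigma>)) - \<sigma> *\<^sub>R (\<Sum>j\<le>k. \<beta> j *\<^sub>R \<psi> (real j * \<sigma>)))"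
    unfolding scaleR_diff_right sum_subtractf cancel by simp
  show ?thesis
  proof (rule order_at_0_cong[OF res])
    \<comment> \<open>Below this bound all the times t + j \<sigma> with j up to k stay in [0, T],
      where the derivative of X may be exchanged for g(X).\<close>
    show "0 < (T - t) / (real k + 1)" using t by simp
    fix \<sigma> assume \<sigma>: "0 < \<sigma>" "\<sigma> < (T - t) / (real k + 1)"
    have "\<psi> (real j * \<sigma>) = g (X (t + real j * \<sigma>))" if j: "j \<le> k" for j
    proof -
      have "real j * \<sigma> \<le> (real k + 1) * \<sigma>" using j \<sigma> by (intro mult_right_mono) auto
      also have "\<dots> \<le> T - t" using \<sigma> by (simp add: field_simps)
      finally have "t + real j * \<sigma> \<in> {0..T}" using t \<sigma> by simp
      from ode[OF this] have "((\<lambda>s. X (t + real 1 * s)) has_vector_derivative g (X (t + real j * \<sigma>))) (at (real j * \<sigma>))"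
      proof -
        have "((\<lambda>s. t + s) has_vector_derivative 1) (at (real j * \<sigma>))"
          by (auto intro!: derivative_eq_intros simp flip: has_real_derivative_iff_has_vector_derivative)
        from vector_diff_chain_at[OF this ode[OF \<open>t + real j * \<sigma> \<in> {0..T}\<close>]] show ?thesis by (simp add: o_def)
      qed
      then show ?thesis unfolding \<psi>_def \<phi>_def[abs_def] by (intro frechet_derivative_real_eq) simp
    qed
    then show "(\<Sum>j\<le>k. \<alpha> j *\<^sub>R \<phi> (real j * \<sigma>)) - \<sigma> *\<^sub>R (\<Sum>j\<le>k. \<beta> j *\<^sub>R \<psi> (real j * \<sigma>)) =
        smooth_residual (\<lambda>z. X (snd z)) (\<sigma>, t)"
      by (simp add: smooth_residual_def \<phi>_def)
  qed
qed

text \<open>The variational equation along X with inhomogeneity \<open>- d\<close>. Linearity gives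
  a solution on all of [0, T]; the extension makes it global and one class smoother than
  \<open>d\<close>.\<close>

lemma transport_equation:
  assumes s: "Suc s \<le> (N + 2) * (N + 2)" and d: "Ck s d"
  obtains E where "Ck (Suc s) E" "E 0 = \<xi>"
    "\<And>t. t \<in> {0..T} \<Longrightarrow> (E has_vector_derivative frechet_derivative g (at (X t)) (E t) - d t) (at t)"
proof -
  define H where "H z = frechet_derivative g (at (X (fst z))) (snd z) - d (fst z)" for z
  have fst: "Ck s (fst :: real \<times> 'a \<Rightarrow> real)" and snd: "Ck s (snd :: real \<times> 'a \<Rightarrow> 'a)"
    by (rule Ck_bounded_linear, rule bounded_linear_fst bounded_linear_snd)+
  have gs: "Ck (Suc s) g" and Xs: "Ck s X" using Ck_mono[OF g s] Ck_mono[OF X, of s] s by simp_all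
  have D: "Ck s (\<lambda>z::real \<times> 'a. frechet_derivative g (at (X (fst z))) (snd z))"
    by (rule Ck_derivative_apply[OF gs Ck_compose[OF fst Xs] snd])
  have H: "Ck s H" unfolding H_def[abs_def] by (rule Ck_diff[OF D Ck_compose[OF fst d]])
  have "0 \<le> T" using T by simp
  moreover have "linear (frechet_derivative g (at (X t)))" for t by (rule Ck_derivative_linear[OF gs])
  ultimately obtain e where e: "e 0 = \<xi>"
    "\<And>t. t \<in> {0..T} \<Longrightarrow> (e has_vector_derivative frechet_derivative g (at (X t)) (e t) + (- d t)) (at t within {0..T})"
    by (rule linear_ode_solution[OF _ _ Ck_continuous[OF D] Ck_continuous[OF Ck_minus[OF d]]])
      (rule that; (assumption | simp))
  from e(2) have e_H: "(e has_vector_derivative H (t, e t)) (at t within {0..T})" if "t \<in> {0..T}" for t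
    using that by (simp add: H_def)
  from Ck_solution_extension[where e=e, OF \<open>0 \<le> T\<close> H e_H] obtain E where E: "Ck (Suc s) E" "\<And>t. t \<in> {0..T} \<Longrightarrow> E t = e t"
    "\<And>t. t \<in> {0..T} \<Longrightarrow> (E has_vector_derivative H (t, E t)) (at t)"
    by blast
  have "E 0 = \<xi>" using E(2)[of 0] e(1) T by simp
  with E(1) show ?thesis by (rule that) (use E(3) in \<open>simp add: H_def\<close>)
qed

text \<open>The equation for \<open>E\<close> is chosen so that the coefficients of \<open>\<sigma> ^ Suc q\<close> cancel.\<close>

lemma smooth_residual_step:
  assumes q: "1 \<le> q" and A: "Ck 2 A" and A0: "\<And>t. 0 \<le> t \<Longrightarrow> t < T \<Longrightarrow> A (0, t) = X t"
    and d: "order_at_0 (Suc (Suc q)) (\<lambda>\<sigma>. smooth_residual A (\<sigma>, t) - \<sigma> ^ Suc q *\<^sub>R d)"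
    and E: "Ck 2 E" "(E has_vector_derivative
      frechet_derivative g (at (X t)) (E t) - d /\<^sub>R (\<Sum>j\<le>k. \<beta> j)) (at t)"
    and t: "0 \<le> t" "t < T"
  shows "order_at_0 (Suc (Suc q)) (\<lambda>\<sigma>. smooth_residual (\<lambda>z. A z + fst z ^ q *\<^sub>R E (snd z)) (\<sigma>, t))"
proof -
  define G where "G = frechet_derivative g (at (X t)) (E t)"
  define E' where "E' = G - d /\<^sub>R (\<Sum>j\<le>k. \<beta> j)"
  define a where "a j \<sigma> = A (\<sigma>, t + real j * \<sigma>)" for j \<sigma>
  define b where "b j \<sigma> = E (t + real j * \<sigma>)" for j \<sigma>
  have g2: "Ck 2 g" by (rule Ck_mono[OF g]) simp
  have a: "Ck 2 (a j)" for j
    unfolding a_def[abs_def]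
    by (rule Ck_compose[OF Ck_Pair A])
      (intro Ck_add Ck_const Ck_bounded_linear bounded_linear_ident bounded_linear_const_mult)+
  have b: "Ck 2 (b j)" for j
    unfolding b_def[abs_def]
    by (rule Ck_compose[OF _ E(1)])
      (intro Ck_add Ck_const Ck_bounded_linear bounded_linear_ident bounded_linear_const_mult)+
  have b1: "order_at_0 2 (\<lambda>\<sigma>. b j \<sigma> - b j 0 - \<sigma> *\<^sub>R (real j *\<^sub>R E'))" for j
  proof (rule smooth_first_order[OF b])
    show "(b j has_vector_derivative real j *\<^sub>R E') (at 0)"
      unfolding b_def[abs_def] E'_def G_def by (rule has_vector_derivative_affine_compose[OF E(2)])
  qed
  have lin: "order_at_0 (Suc q) (\<lambda>\<sigma>. g (a j \<sigma> + \<sigma> ^ q *\<^sub>R b j \<sigma>) - g (a j \<sigma>) - \<sigma> ^ q *\<^sub>R G)" for j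
    using order_at_0_linearization[OF g2 Ck_mono[OF a] Ck_mono[OF b] q, of j j] A0[OF t]
    by (simp add: G_def a_def b_def)
  \<comment> \<open>Multiplication by the sum of the \<beta>_j undoes the division in the equation
    for \<open>E\<close>. Consistency equates that sum with the sum of the j \<alpha>_j, the factor
    of \<open>E'\<close> in the expansion of the left-hand side.\<close>
  have c1: "c *\<^sub>R E' = c *\<^sub>R G - d" if "c = (\<Sum>j\<le>k. \<beta> j)" for c
    using sum_beta_nonzero that by (simp add: E'_def scaleR_diff_right)
  have sumE: "(\<Sum>j\<le>k. \<alpha> j *\<^sub>R (b j \<sigma> - b j 0 - \<sigma> *\<^sub>R (real j *\<^sub>R E'))) =
      (\<Sum>j\<le>k. \<alpha> j *\<^sub>R b j \<sigma>) - \<sigma> *\<^sub>R ((\<Sum>j\<le>k. \<beta> j) *\<^sub>R G) + \<sigma> *\<^sub>R d" for \<sigma>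
  proof -
    have "(\<Sum>j\<le>k. \<alpha> j *\<^sub>R b j 0) = 0"
      using sum_alpha by (simp add: b_def flip: scaleR_sum_left)
    moreover have "(\<Sum>j\<le>k. \<alpha> j *\<^sub>R (\<sigma> *\<^sub>R (real j *\<^sub>R E'))) = \<sigma> *\<^sub>R ((\<Sum>j\<le>k. \<alpha> j * real j) *\<^sub>R E')"
      by (simp add: scaleR_sum_left scaleR_sum_right mult_ac)
    moreover have "\<sigma> *\<^sub>R ((\<Sum>j\<le>k. \<alpha> j * real j) *\<^sub>R E') = \<sigma> *\<^sub>R ((\<Sum>j\<le>k. \<beta> j) *\<^sub>R G) - \<sigma> *\<^sub>R d"
      unfolding c1[OF sum_beta] by (simp add: scaleR_diff_right sum_beta)
    ultimately show ?thesis
      by (simp only: scaleR_diff_right sum_subtractf) (simp add: algebra_simps)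
  qed
  have sumG: "(\<Sum>j\<le>k. \<beta> j *\<^sub>R (g (a j \<sigma> + \<sigma> ^ q *\<^sub>R b j \<sigma>) - g (a j \<sigma>) - \<sigma> ^ q *\<^sub>R G)) =
      (\<Sum>j\<le>k. \<beta> j *\<^sub>R g (a j \<sigma> + \<sigma> ^ q *\<^sub>R b j \<sigma>)) - (\<Sum>j\<le>k. \<beta> j *\<^sub>R g (a j \<sigma>))
        - \<sigma> ^ q *\<^sub>R ((\<Sum>j\<le>k. \<beta> j) *\<^sub>R G)" for \<sigma>
    by (simp add: scaleR_diff_right sum_subtractf scaleR_sum_left scaleR_sum_right mult.commute)
  have "order_at_0 (q + 2) (\<lambda>\<sigma>. \<sigma> ^ q *\<^sub>R (\<Sum>j\<le>k. \<alpha> j *\<^sub>R (b j \<sigma> - b j 0 - \<sigma> *\<^sub>R (real j *\<^sub>R E'))))"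
    by (rule order_at_0_scaleR_power, rule order_at_0_sum)
      (rule order_at_0_bounded_linear[OF bounded_linear_scaleR_right b1])
  then have 1: "order_at_0 (Suc (Suc q)) (\<lambda>\<sigma>. \<sigma> ^ q *\<^sub>R ((\<Sum>j\<le>k. \<alpha> j *\<^sub>R b j \<sigma>)
      - \<sigma> *\<^sub>R ((\<Sum>j\<le>k. \<beta> j) *\<^sub>R G) + \<sigma> *\<^sub>R d))"
    unfolding sumE by simp
  have "order_at_0 (1 + Suc q) (\<lambda>\<sigma>. \<sigma> ^ 1 *\<^sub>R (\<Sum>j\<le>k. \<beta> j *\<^sub>R (g (a j \<sigma> + \<sigma> ^ q *\<^sub>R b j \<sigma>) - g (a j \<sigma>) - \<sigma> ^ q *\<^sub>R G)))"
    by (rule order_at_0_scaleR_power, rule order_at_0_sum)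
      (rule order_at_0_bounded_linear[OF bounded_linear_scaleR_right lin])
  then have 2: "order_at_0 (Suc (Suc q)) (\<lambda>\<sigma>. \<sigma> *\<^sub>R ((\<Sum>j\<le>k. \<beta> j *\<^sub>R g (a j \<sigma> + \<sigma> ^ q *\<^sub>R b j \<sigma>))
      - (\<Sum>j\<le>k. \<beta> j *\<^sub>R g (a j \<sigma>)) - \<sigma> ^ q *\<^sub>R ((\<Sum>j\<le>k. \<beta> j) *\<^sub>R G)))"
    unfolding sumG by simp
  have "smooth_residual (\<lambda>z. A z + fst z ^ q *\<^sub>R E (snd z)) (\<sigma>, t) =
     (smooth_residual A (\<sigma>, t) - \<sigma> ^ Suc q *\<^sub>R d) +
     \<sigma> ^ q *\<^sub>R ((\<Sum>j\<le>k. \<alpha> j *\<^sub>R b j \<sigma>) - \<sigma> *\<^sub>R ((\<Sum>j\<le>k. \<beta> j) *\<^sub>R G) + \<sigma> *\<^sub>R d) -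
     \<sigma> *\<^sub>R ((\<Sum>j\<le>k. \<beta> j *\<^sub>R g (a j \<sigma> + \<sigma> ^ q *\<^sub>R b j \<sigma>)) - (\<Sum>j\<le>k. \<beta> j *\<^sub>R g (a j \<sigma>)) -
       \<sigma> ^ q *\<^sub>R ((\<Sum>j\<le>k. \<beta> j) *\<^sub>R G))" for \<sigma>
  proof -
    have "(\<Sum>j\<le>k. \<alpha> j *\<^sub>R (a j \<sigma> + \<sigma> ^ q *\<^sub>R b j \<sigma>)) =
        (\<Sum>j\<le>k. \<alpha> j *\<^sub>R a j \<sigma>) + \<sigma> ^ q *\<^sub>R (\<Sum>j\<le>k. \<alpha> j *\<^sub>R b j \<sigma>)"
      by (simp add: scaleR_add_right sum.distrib scaleR_sum_right mult.commute)
    then have 3: "smooth_residual (\<lambda>z. A z + fst z ^ q *\<^sub>R E (snd z)) (\<sigma>, t) =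
        (\<Sum>j\<le>k. \<alpha> j *\<^sub>R a j \<sigma>) + \<sigma> ^ q *\<^sub>R (\<Sum>j\<le>k. \<alpha> j *\<^sub>R b j \<sigma>) -
        \<sigma> *\<^sub>R (\<Sum>j\<le>k. \<beta> j *\<^sub>R g (a j \<sigma> + \<sigma> ^ q *\<^sub>R b j \<sigma>))"
      by (simp add: smooth_residual_def a_def b_def)
    have 4: "smooth_residual A (\<sigma>, t) = (\<Sum>j\<le>k. \<alpha> j *\<^sub>R a j \<sigma>) - \<sigma> *\<^sub>R (\<Sum>j\<le>k. \<beta> j *\<^sub>R g (a j \<sigma>))"
      by (simp add: smooth_residual_def a_def)
    \<comment> \<open>An identity for arbitrary vectors: the terms with \<open>S4\<close>,
      \<open>S5\<close> and \<open>d\<close> cancel in pairs.\<close>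
    have 5: "S1 + \<sigma> ^ q *\<^sub>R S2 - \<sigma> *\<^sub>R S3 = (S1 - \<sigma> *\<^sub>R S4 - \<sigma> ^ Suc q *\<^sub>R d) +
        \<sigma> ^ q *\<^sub>R (S2 - \<sigma> *\<^sub>R S5 + \<sigma> *\<^sub>R d) - \<sigma> *\<^sub>R (S3 - S4 - \<sigma> ^ q *\<^sub>R S5)" for S1 S2 S3 S4 S5 :: 'a
      by (simp add: algebra_simps)
    show ?thesis unfolding 3 4 by (rule 5)
  qed
  then show ?thesis
    using order_at_0_diff[OF order_at_0_add[OF d 1] 2] by simp
qed

text \<open>The residual at index n looks up to \<open>k\<close> indices ahead, hence the horizon
  \<open>T + real k\<close> for \<open>B\<close>.\<close>

lemma geo_expands_decaying_residual:
  assumes A: "Ck M A" and g': "Ck (M + M) g" and M: "1 \<le> M" and B: "geo_expands (T + real k) M B"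
    and ord: "\<And>n. order_at_0 1 (\<lambda>h. B h n)"
  shows "geo_expands T M (decaying_residual A B)"
proof -
  have Tk: "0 < T + real k" using T by simp
  have D: "geo_expands (T + real k) M (\<lambda>h n. g (A (h, real n * h) + B h n) - g (A (h, real n * h)))"
    by (rule geo_expands_compose_diff[OF g' A B Tk M ord])
  have le: "T + real j \<le> T + real k" if "j \<in> {..k}" for j using that by simp
  show ?thesis
    unfolding decaying_residual_def[abs_def]
    by (intro geo_expands_diff geo_expands_sum geo_expands_scaleR_right geo_expands_step_size
        geo_expands_shift[OF B le] geo_expands_shift[OF D le])
qed

lemma order_at_0_smooth_bounded: "Ck 0 A \<Longrightarrow> order_at_0 0 (\<lambda>h. A (h, real n * h))"
proof -
  assume A: "Ck 0 A"
  have "Ck 0 (\<lambda>h. A (h, real n * h))"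
    by (rule Ck_compose[OF Ck_bounded_linear A])
      (intro bounded_linear_Pair bounded_linear_ident bounded_linear_const_mult)
  then obtain C where "C > 0" "\<And>h. h \<in> {0..1} \<Longrightarrow> norm (A (h, real n * h)) \<le> C"
    using continuous_on_compact_norm_bound[OF Ck_continuous compact_Icc] by blast
  then show ?thesis by (intro order_at_0I[of 1 _ C]) auto
qed

text \<open>All interaction of the new terms with \<open>g\<close> carries a factor h and so is of
  order q + 1. At order q only the sum with the coefficients \<alpha>_j remains, and it meets a
  recurrence with constant coefficients.\<close>

lemma decaying_residual_step:
  assumes A: "Ck 1 A" and E: "Ck 1 E" and q: "1 \<le> q"
    and B: "\<And>n. order_at_0 1 (\<lambda>h. B h n)"
    and \<delta>: "order_at_0 (Suc q) (\<lambda>h. decaying_residual A B h n - h ^ q *\<^sub>R \<delta>)"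
    and \<epsilon>: "(\<Sum>j\<le>k. \<alpha> j *\<^sub>R \<epsilon> (n + j)) = - \<delta>"
  shows "order_at_0 (Suc q) (\<lambda>h. decaying_residual (\<lambda>z. A z + fst z ^ q *\<^sub>R E (snd z)) (\<lambda>h n. B h n + h ^ q *\<^sub>R \<epsilon> n) h n)"
proof -
  have g1: "Ck 1 g" by (rule Ck_mono[OF g]) simp
  define a where "a m h = A (h, real m * h)" for m h
  define b where "b m h = E (real m * h)" for m h
  have a0: "order_at_0 0 (a m)" for m
    unfolding a_def by (rule order_at_0_smooth_bounded[OF Ck_mono[OF A]]) simp
  have "Ck 0 (\<lambda>z::real \<times> real. E (snd z))"
    by (rule Ck_compose[OF Ck_bounded_linear[OF bounded_linear_snd] Ck_mono[OF E]]) simp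
  from order_at_0_smooth_bounded[OF this] have b0: "order_at_0 0 (b m)" for m by (simp add: b_def[abs_def])
  have B0: "order_at_0 0 (\<lambda>h. B h m)" for m by (rule order_at_0_mono[OF B]) simp
  have hq: "order_at_0 q (\<lambda>h. h ^ q *\<^sub>R \<psi> h)" if "order_at_0 0 \<psi>" for \<psi> :: "real \<Rightarrow> 'a"
    using order_at_0_scaleR_power[OF that, of q] by simp
  \<comment> \<open>The change that the new terms cause in g(A + B) - g(A). Grouped this way, both
    differences are O(h^q) by the Lipschitz property.\<close>
  define J where "J m h = (g (a m h + h ^ q *\<^sub>R b m h + (B h m + h ^ q *\<^sub>R \<epsilon> m)) - g (a m h + B h m))
      - (g (a m h + h ^ q *\<^sub>R b m h) - g (a m h))" for m h
  have J: "order_at_0 q (J m)" for m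
  proof -
    have "order_at_0 q (\<lambda>h. g (a m h + h ^ q *\<^sub>R b m h + (B h m + h ^ q *\<^sub>R \<epsilon> m)) - g (a m h + B h m))"
    proof (rule order_at_0_compose_diff[OF g1 order_at_0_add[OF a0 B0]])
      have "order_at_0 q (\<lambda>h. h ^ q *\<^sub>R (b m h + \<epsilon> m))"
        by (rule hq[OF order_at_0_add[OF b0 order_at_0_const]])
      then show "order_at_0 q (\<lambda>h. a m h + h ^ q *\<^sub>R b m h + (B h m + h ^ q *\<^sub>R \<epsilon> m) - (a m h + B h m))"
        by (simp add: scaleR_add_right add_ac)
    qed
    moreover have "order_at_0 q (\<lambda>h. g (a m h + h ^ q *\<^sub>R b m h) - g (a m h))"
      by (rule order_at_0_compose_diff[OF g1 a0]) (simp add: hq[OF b0])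
    ultimately show ?thesis unfolding J_def by (rule order_at_0_diff)
  qed
  have "order_at_0 (1 + q) (\<lambda>h. h ^ 1 *\<^sub>R (\<Sum>j\<le>k. \<beta> j *\<^sub>R J (n + j) h))"
    by (rule order_at_0_scaleR_power, rule order_at_0_sum)
      (rule order_at_0_bounded_linear[OF bounded_linear_scaleR_right J])
  then have 1: "order_at_0 (Suc q) (\<lambda>h. h *\<^sub>R (\<Sum>j\<le>k. \<beta> j *\<^sub>R J (n + j) h))" by simp
  have "decaying_residual (\<lambda>z. A z + fst z ^ q *\<^sub>R E (snd z)) (\<lambda>h n. B h n + h ^ q *\<^sub>R \<epsilon> n) h n =
      (decaying_residual A B h n - h ^ q *\<^sub>R \<delta>) - h *\<^sub>R (\<Sum>j\<le>k. \<beta> j *\<^sub>R J (n + j) h)" for h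
  proof -
    have "(\<Sum>j\<le>k. \<alpha> j *\<^sub>R (B h (n + j) + h ^ q *\<^sub>R \<epsilon> (n + j))) =
        (\<Sum>j\<le>k. \<alpha> j *\<^sub>R B h (n + j)) + h ^ q *\<^sub>R (\<Sum>j\<le>k. \<alpha> j *\<^sub>R \<epsilon> (n + j))"
      by (simp add: scaleR_add_right sum.distrib scaleR_sum_right mult.commute)
    moreover have "(\<Sum>j\<le>k. \<beta> j *\<^sub>R J (n + j) h) =
       (\<Sum>j\<le>k. \<beta> j *\<^sub>R (g (a (n + j) h + h ^ q *\<^sub>R b (n + j) h + (B h (n + j) + h ^ q *\<^sub>R \<epsilon> (n + j)))
          - g (a (n + j) h + h ^ q *\<^sub>R b (n + j) h)))
       - (\<Sum>j\<le>k. \<beta> j *\<^sub>R (g (a (n + j) h + B h (n + j)) - g (a (n + j) h)))"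
      unfolding J_def by (simp add: scaleR_diff_right sum_subtractf)
    ultimately show ?thesis
      by (simp add: decaying_residual_def \<epsilon> a_def b_def scaleR_diff_right)
  qed
  then show ?thesis using order_at_0_diff[OF \<delta> 1] by simp
qed

end

section \<open>The induction over the orders of the expansion\<close>

definition geometric :: "(nat \<Rightarrow> 'a::real_normed_vector) \<Rightarrow> bool" where
  "geometric e \<longleftrightarrow> (\<exists>C \<rho>. 0 < \<rho> \<and> \<rho> < 1 \<and> (\<forall>n. norm (e n) \<le> C * \<rho> ^ n))"

lemma geo_expands_geometric: "geometric e \<Longrightarrow> geo_expands T M (\<lambda>h n. h ^ i *\<^sub>R e n)"
  unfolding geometric_def by (auto intro!: geo_expandsI expands_power intro: expands_const)

text \<open>The sequence \<open>a * (1 + b) ^ n\<close> satisfies the relation with equality, and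
  comparison is monotone because b is nonnegative.\<close>

lemma discrete_gronwall:
  fixes w :: "nat \<Rightarrow> real"
  assumes "\<And>n. n \<le> M \<Longrightarrow> w n \<le> a + b * (\<Sum>m<n. w m)" "0 \<le> b"
  shows "w M \<le> a * (1 + b) ^ M"
  using assms(1)
proof (induction M rule: less_induct)
  case (less M)
  have geo: "a + b * (\<Sum>m<n. a * (1 + b) ^ m) = a * (1 + b) ^ n" for n
    by (induction n) (simp_all add: algebra_simps)
  have "w M \<le> a + b * (\<Sum>m<M. w m)" by (rule less.prems) simp
  also have "\<dots> \<le> a + b * (\<Sum>m<M. a * (1 + b) ^ m)"
    using less assms(2) by (intro add_left_mono mult_left_mono sum_mono) auto
  finally show ?case unfolding geo .
qed

context lmm_autonomous
begin

text \<open>The assumed expansion of the starting values enters here: their order alone would not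
  single out a coefficient.\<close>

lemma start_error_leading_coefficient:
  assumes q: "q < N" and A: "Ck (Suc q) A" and B: "geo_expands T (Suc q) B" and j: "j < k"
    and ord: "order_at_0 q (\<lambda>h. Y h j - (A (h, real j * h) + B h j))"
  shows "\<exists>s. order_at_0 (Suc q) (\<lambda>h. Y h j - (A (h, real j * h) + B h j) - h ^ q *\<^sub>R s)"
proof -
  obtain \<rho> where "expands T (Suc q) (\<lambda>n. \<rho> ^ n) B" using B unfolding geo_expands_def by blast
  then have Bj: "has_expansion_at_0 (Suc q) (\<lambda>h. B h j)" by (rule expands_imp_has_expansion_at_0[OF T])
  have Aj: "has_expansion_at_0 (Suc q) (\<lambda>h. A (h, real j * h))"
    by (rule expands_imp_has_expansion_at_0[OF T expands_smooth[OF A]])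
  have "Suc q \<le> N" using q by simp
  from has_expansion_at_0_diff[OF has_expansion_at_0_diff[OF has_expansion_at_0_mono[OF start_exp[OF j] this] Aj] Bj]
  have "has_expansion_at_0 (Suc q) (\<lambda>h. Y h j - (A (h, real j * h) + B h j))" by (simp add: diff_diff_eq)
  then show ?thesis using has_expansion_at_0_leading_coefficient[OF _ ord] by blast
qed

text \<open>The invariant of the construction. The exponents \<open>Suc q\<close> and
  \<open>q\<close> of the two residuals differ because smooth residuals accumulate over about 1/h
  steps while decaying ones are summable. The condition at h = 0 keeps later linearisations centred
  at the exact solution. \<open>B\<close> expands to every order \<open>M\<close>, as each stage
  reads off one coefficient more.\<close>

definition stage :: "nat \<Rightarrow> (real \<times> real \<Rightarrow> 'a) \<Rightarrow> (real \<Rightarrow> nat \<Rightarrow> 'a) \<Rightarrow> bool" where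
  "stage q A B \<longleftrightarrow> Ck (regularity q) A \<and> (\<forall>t. 0 \<le> t \<longrightarrow> t < T \<longrightarrow> A (0, t) = X t) \<and>
     (\<forall>M. geo_expands (T + real k) M B) \<and> (\<forall>n. order_at_0 1 (\<lambda>h. B h n)) \<and>
     (\<forall>t. 0 \<le> t \<longrightarrow> t < T \<longrightarrow> order_at_0 (Suc q) (\<lambda>\<sigma>. smooth_residual A (\<sigma>, t))) \<and>
     (\<forall>n. order_at_0 q (\<lambda>h. decaying_residual A B h n)) \<and>
     (\<forall>j<k. order_at_0 q (\<lambda>h. Y h j - (A (h, real j * h) + B h j)))"

lemma stage_step:
  assumes st: "stage q A B" and q: "1 \<le> q" "q < N"
  shows "\<exists>E \<epsilon>. geometric \<epsilon> \<and>
    stage (Suc q) (\<lambda>z. A z + fst z ^ q *\<^sub>R E (snd z)) (\<lambda>h n. B h n + h ^ q *\<^sub>R \<epsilon> n)"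
proof -
  from st have A: "Ck (regularity q) A" and A0: "\<And>t. 0 \<le> t \<Longrightarrow> t < T \<Longrightarrow> A (0, t) = X t"
    and B: "\<And>M. geo_expands (T + real k) M B" and B1: "\<And>n. order_at_0 1 (\<lambda>h. B h n)"
    and RA: "\<And>t. 0 \<le> t \<Longrightarrow> t < T \<Longrightarrow> order_at_0 (Suc q) (\<lambda>\<sigma>. smooth_residual A (\<sigma>, t))"
    and RB: "\<And>n. order_at_0 q (\<lambda>h. decaying_residual A B h n)"
    and start: "\<And>j. j < k \<Longrightarrow> order_at_0 q (\<lambda>h. Y h j - (A (h, real j * h) + B h j))"
    unfolding stage_def by auto
  have Bn: "geo_expands T M B" for M
    using geo_expands_shift[OF B, of T 0 M] by simp
  have reg: "regularity q = N + 2 + regularity (Suc q)" by (rule regularity_Suc[OF q(2)])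
  have regS: "N + 2 \<le> regularity (Suc q)" by (rule regularity_ge) (use q in simp)
  have As: "Ck s A" if "s \<le> N + 2 + regularity (Suc q)" for s
    by (rule Ck_mono[OF A]) (use that reg in simp)
  have gs: "Ck s g" if "s \<le> (N + 2) * (N + 2)" for s by (rule Ck_mono[OF g that])
  have "Ck (regularity q) (smooth_residual A)"
    by (rule Ck_smooth_residual[OF A gs[OF regularity_le]])
  then have "Ck (Suc (Suc q) + regularity (Suc q)) (smooth_residual A)"
    by (rule Ck_mono) (use reg q in simp)
  then obtain d where d: "Ck (regularity (Suc q)) d" "\<And>t. 0 \<le> t \<Longrightarrow> t < T \<Longrightarrow>
      order_at_0 (Suc (Suc q)) (\<lambda>\<sigma>. smooth_residual A (\<sigma>, t) - \<sigma> ^ Suc q *\<^sub>R d t)"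
    using smooth_leading_coefficient[OF _ RA] by blast
  have qq: "Suc q + Suc q \<le> (N + 2) * (N + 2)"
  proof -
    have "Suc q + Suc q \<le> 2 * (N + 2)" using q by simp
    also have "\<dots> \<le> (N + 2) * (N + 2)" by (intro mult_le_mono1) simp
    finally show ?thesis .
  qed
  have geo_res: "geo_expands T (Suc q) (decaying_residual A B)"
  proof (rule geo_expands_decaying_residual[OF As gs[OF qq] _ B B1])
    show "Suc q \<le> N + 2 + regularity (Suc q)" using q by simp
  qed simp
  obtain \<delta> C \<rho> where \<delta>: "0 < \<rho>" "\<rho> < 1" "\<And>n. norm (\<delta> n) \<le> C * \<rho> ^ n"
    "\<And>n. order_at_0 (Suc q) (\<lambda>h. decaying_residual A B h n - h ^ q *\<^sub>R \<delta> n)"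
    by (rule geo_expands_leading_coefficient[OF geo_res T RB]) (rule that; (assumption | simp))
  have "\<forall>j. \<exists>s. j < k \<longrightarrow> order_at_0 (Suc q) (\<lambda>h. Y h j - (A (h, real j * h) + B h j) - h ^ q *\<^sub>R s)"
    using start_error_leading_coefficient[OF q(2) Ck_mono[OF A] Bn _ start] q(2) reg by simp
  then obtain s where s: "\<And>j. j < k \<Longrightarrow>
      order_at_0 (Suc q) (\<lambda>h. Y h j - (A (h, real j * h) + B h j) - h ^ q *\<^sub>R s j)" by metis
  \<comment> \<open>This sequence removes both the decaying residual and the starting error, but its
    limit need not be 0.\<close>
  define v where "v = linear_recurrence k \<alpha> s (\<lambda>n. - \<delta> n)"
  have v: "(\<Sum>j\<le>k. \<alpha> j *\<^sub>R v (n + j)) = - \<delta> n" for n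
    unfolding v_def by (rule linear_recurrence_step[where \<alpha>=\<alpha> and k=k, OF lead])
  have "norm (\<Sum>j\<le>k. \<alpha> j *\<^sub>R v (n + j)) \<le> C * \<rho> ^ n" for n using \<delta>(3) by (simp add: v)
  from recurrence_limit[where k=k and \<alpha>=\<alpha>, OF k lead eig this] \<delta>(1,2)
  obtain \<xi> C' \<rho>' where \<xi>: "0 < \<rho>'" "\<rho>' < 1" "\<And>n. norm (v n - \<xi>) \<le> C' * \<rho>' ^ n" by auto
  define \<epsilon> where "\<epsilon> n = v n - \<xi>" for n
  have \<epsilon>_geo: "geometric \<epsilon>" unfolding geometric_def \<epsilon>_def using \<xi> by blast
  \<comment> \<open>Constant sequences solve the homogeneous recurrence because the \<alpha>_j sum
    to 0.\<close>
  have \<epsilon>: "(\<Sum>j\<le>k. \<alpha> j *\<^sub>R \<epsilon> (n + j)) = - \<delta> n" for n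
  proof -
    have "(\<Sum>j\<le>k. \<alpha> j *\<^sub>R \<epsilon> (n + j)) = (\<Sum>j\<le>k. \<alpha> j *\<^sub>R v (n + j)) - (\<Sum>j\<le>k. \<alpha> j) *\<^sub>R \<xi>"
      by (simp add: \<epsilon>_def scaleR_diff_right sum_subtractf scaleR_sum_left)
    then show ?thesis by (simp add: v sum_alpha)
  qed
  have "Suc (regularity (Suc q)) \<le> (N + 2) * (N + 2)" using reg regularity_le[of q] by linarith
  from transport_equation[OF this Ck_bounded_linear_compose[OF bounded_linear_scaleR_right[of "inverse (\<Sum>j\<le>k. \<beta> j)"] d(1)]]
  obtain E where E: "Ck (Suc (regularity (Suc q))) E" "E 0 = \<xi>"
    "\<And>t. t \<in> {0..T} \<Longrightarrow> (E has_vector_derivative frechet_derivative g (at (X t)) (E t) - d t /\<^sub>R (\<Sum>j\<le>k. \<beta> j)) (at t)"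
    by blast
  have Es: "Ck r E" if "r \<le> regularity (Suc q)" for r by (rule Ck_mono[OF E(1)]) (use that in simp)
  let ?A = "\<lambda>z. A z + fst z ^ q *\<^sub>R E (snd z)" and ?B = "\<lambda>h n. B h n + h ^ q *\<^sub>R \<epsilon> n"
  have "stage (Suc q) ?A ?B"
    unfolding stage_def
  proof (intro conjI allI impI)
    have fst: "Ck r (fst :: real \<times> real \<Rightarrow> real)" and snd: "Ck r (snd :: real \<times> real \<Rightarrow> real)" for r
      by (rule Ck_bounded_linear, rule bounded_linear_fst bounded_linear_snd)+
    show "Ck (regularity (Suc q)) ?A"
      by (rule Ck_add[OF As Ck_scaleR[OF Ck_power[OF fst] Ck_compose[OF snd Es]]]) auto
    show "A (0, t) + fst (0::real, t) ^ q *\<^sub>R E (snd (0::real, t)) = X t" if "0 \<le> t" "t < T" for t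
      using A0[OF that] q by simp
    show "geo_expands (T + real k) M ?B" for M
      by (rule geo_expands_add[OF B geo_expands_geometric[OF \<epsilon>_geo]])
    show "order_at_0 1 (\<lambda>h. B h n + h ^ q *\<^sub>R \<epsilon> n)" for n
    proof (rule order_at_0_add[OF B1])
      show "order_at_0 1 (\<lambda>h. h ^ q *\<^sub>R \<epsilon> n)"
        using order_at_0_mono[OF order_at_0_scaleR_power[OF order_at_0_const[of "\<epsilon> n"], of q], of 1] q by simp
    qed
    show "order_at_0 (Suc (Suc q)) (\<lambda>\<sigma>. smooth_residual ?A (\<sigma>, t))" if t: "0 \<le> t" "t < T" for t
    proof (rule smooth_residual_step[OF q(1) _ A0 d(2)[OF t] _ E(3) t])
      show "Ck 2 A" "Ck 2 E" using regS by (auto intro!: As Es simp del: Ck.simps)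
    qed (use t in auto)
    show "order_at_0 (Suc q) (\<lambda>h. decaying_residual ?A ?B h n)" for n
    proof (rule decaying_residual_step[OF _ _ q(1) B1 \<delta>(4) \<epsilon>])
      show "Ck 1 A" "Ck 1 E" using regS by (auto intro!: As Es simp del: Ck.simps)
    qed
    show "order_at_0 (Suc q) (\<lambda>h. Y h j - (A (h, real j * h) + fst (h, real j * h) ^ q *\<^sub>R E (snd (h, real j * h)) +
        (B h j + h ^ q *\<^sub>R \<epsilon> j)))" if j: "j < k" for j
    proof -
      have "Ck 1 (\<lambda>h. E (real j * h))"
        by (rule Ck_compose[OF Ck_bounded_linear[OF bounded_linear_mult_right] Es]) (use regS in simp)
      from order_at_0_scaleR_power[OF smooth_zeroth_order[OF this], of q]
      have 1: "order_at_0 (Suc q) (\<lambda>h. h ^ q *\<^sub>R (E (real j * h) - \<xi>))" by (simp add: E(2))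
      \<comment> \<open>At t = 0 the smooth term contributes \<xi> and the decaying one
        \<open>s j - \<xi>\<close>; together they match the starting error coefficient.\<close>
      have \<epsilon>j: "\<epsilon> j = s j - \<xi>" unfolding \<epsilon>_def v_def using j by (simp add: linear_recurrence_start)
      have "Y h j - (A (h, real j * h) + h ^ q *\<^sub>R E (real j * h) + (B h j + h ^ q *\<^sub>R \<epsilon> j)) =
          Y h j - (A (h, real j * h) + B h j) - h ^ q *\<^sub>R s j - h ^ q *\<^sub>R (E (real j * h) - \<xi>)" for h
        unfolding \<epsilon>j by (simp add: algebra_simps)
      then show ?thesis
        using order_at_0_diff[OF s[OF j] 1] by (simp only: fst_conv snd_conv)
    qed
  qed
  then show ?thesis using \<epsilon>_geo by blast
qed

text \<open>At stage p the smooth residual is controlled by the order of the method and the starting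
  error by assumption, while a decaying residual is still absent.\<close>

lemma stage_exists:
  assumes "p \<le> q" "q \<le> N"
  shows "\<exists>e \<epsilon>. (\<forall>i. geometric (\<epsilon> i)) \<and>
    stage q (\<lambda>z. X (snd z) + (\<Sum>i\<in>{p..<q}. fst z ^ i *\<^sub>R e i (snd z))) (\<lambda>h n. \<Sum>i\<in>{p..<q}. h ^ i *\<^sub>R \<epsilon> i n)"
  using assms
proof (induction q rule: dec_induct)
  case base
  have "geometric (\<lambda>n::nat. 0::'a)" unfolding geometric_def by (intro exI[of _ 0] exI[of _ "1/2"]) auto
  moreover have "stage p (\<lambda>z. X (snd z)) (\<lambda>h n. 0)"
    unfolding stage_def
  proof (intro conjI allI impI)
    show "Ck (regularity p) (\<lambda>z::real \<times> real. X (snd z))"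
      by (rule Ck_compose[OF Ck_bounded_linear[OF bounded_linear_snd] Ck_mono[OF X regularity_le]])
    show "order_at_0 p (\<lambda>h. decaying_residual (\<lambda>z. X (snd z)) (\<lambda>h n. 0) h n)" for n
      by (simp add: decaying_residual_def order_at_0_zero)
  qed (use smooth_residual_solution start_order in \<open>auto simp: geo_expands_zero order_at_0_zero\<close>)
  ultimately show ?case by (intro exI[of _ "\<lambda>_ _. 0"]) simp
next
  case (step q)
  then obtain e \<epsilon> where e: "\<And>i. geometric (\<epsilon> i)"
    "stage q (\<lambda>z. X (snd z) + (\<Sum>i\<in>{p..<q}. fst z ^ i *\<^sub>R e i (snd z))) (\<lambda>h n. \<Sum>i\<in>{p..<q}. h ^ i *\<^sub>R \<epsilon> i n)"
    by auto
  obtain E \<eta> where E: "geometric \<eta>" "stage (Suc q)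
     (\<lambda>z. X (snd z) + (\<Sum>i\<in>{p..<q}. fst z ^ i *\<^sub>R e i (snd z)) + fst z ^ q *\<^sub>R E (snd z))
     (\<lambda>h n. (\<Sum>i\<in>{p..<q}. h ^ i *\<^sub>R \<epsilon> i n) + h ^ q *\<^sub>R \<eta> n)"
    using stage_step[OF e(2)] step p by auto
  have 1: "(\<Sum>i\<in>{p..<Suc q}. fst z ^ i *\<^sub>R (e(q := E)) i (snd z)) =
      (\<Sum>i\<in>{p..<q}. fst z ^ i *\<^sub>R e i (snd z)) + fst z ^ q *\<^sub>R E (snd z)" for z :: "real \<times> real"
    using step(1) by (simp add: sum.atLeastLessThan_Suc)
  have 2: "(\<Sum>i\<in>{p..<Suc q}. h ^ i *\<^sub>R (\<epsilon>(q := \<eta>)) i n) =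
      (\<Sum>i\<in>{p..<q}. h ^ i *\<^sub>R \<epsilon> i n) + h ^ q *\<^sub>R \<eta> n" for h :: real and n
    using step(1) by (simp add: sum.atLeastLessThan_Suc)
  show ?case
  proof (intro exI conjI)
    show "\<forall>i. geometric ((\<epsilon>(q := \<eta>)) i)" using e(1) E(1) by simp
    show "stage (Suc q) (\<lambda>z. X (snd z) + (\<Sum>i\<in>{p..<Suc q}. fst z ^ i *\<^sub>R (e(q := E)) i (snd z)))
        (\<lambda>h n. \<Sum>i\<in>{p..<Suc q}. h ^ i *\<^sub>R (\<epsilon>(q := \<eta>)) i n)"
      unfolding 1 2 using E(2) by (simp add: add.assoc)
  qed
qed

end

section \<open>Stability\<close>

text \<open>\<open>tube\<close> confines the newest value of an implicit method to a ball on which g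
  is Lipschitz; earlier values are confined by the error bound already proved for them.\<close>

locale lmm_autonomous_family = lmm_autonomous +
  fixes h0 :: real
  assumes h0: "0 < h0"
    and recursion: "\<And>h n. 0 < h \<Longrightarrow> h \<le> h0 \<Longrightarrow> real (n + k) * h \<le> T \<Longrightarrow>
      (\<Sum>j\<le>k. \<alpha> j *\<^sub>R Y h (n + j)) = h *\<^sub>R (\<Sum>j\<le>k. \<beta> j *\<^sub>R g (Y h (n + j)))"
    and tube: "\<beta> k \<noteq> 0 \<Longrightarrow> \<exists>R. \<forall>h n. 0 < h \<longrightarrow> h \<le> h0 \<longrightarrow> real n * h \<le> T \<longrightarrow>
      norm (Y h n - X (real n * h)) \<le> R"
begin

text \<open>An explicit method never evaluates \<open>g\<close> at the newest value, so nothing about \<open>\<Delta> M\<close> is needed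
  when \<open>\<beta> k = 0\<close>.\<close>

lemma recurrence_error_bound:
  fixes W :: "nat \<Rightarrow> 'a"
  assumes C0: "0 \<le> C0" "\<And>(w :: nat \<Rightarrow> 'a) S M. (\<forall>j<k. norm (w j) \<le> S) \<Longrightarrow>
      norm (w M) \<le> C0 * (S + (\<Sum>i<M + 1 - k. norm (\<Sum>j\<le>k. \<alpha> j *\<^sub>R w (i + j))))"
    and h: "0 < h" and L: "0 \<le> L"
    and start: "\<And>j. j < k \<Longrightarrow> norm (W j) \<le> S"
    and rec: "\<And>i. i + k \<le> M \<Longrightarrow> (\<Sum>j\<le>k. \<alpha> j *\<^sub>R W (i + j)) = h *\<^sub>R (\<Sum>j\<le>k. \<beta> j *\<^sub>R \<Delta> (i + j)) - r i"
    and lip: "\<And>m. m < M \<Longrightarrow> norm (\<Delta> m) \<le> L * norm (W m)"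
      "\<beta> k \<noteq> 0 \<Longrightarrow> norm (\<Delta> M) \<le> L * norm (W M)"
    and res: "(\<Sum>i<M + 1 - k. norm (r i)) \<le> \<rho>"
    and small: "C0 * h * L * (\<Sum>j\<le>k. \<bar>\<beta> j\<bar>) \<le> 1 / 2"
  shows "norm (W M) \<le> 2 * C0 * (S + \<rho>) + 2 * C0 * h * L * (\<Sum>j\<le>k. \<bar>\<beta> j\<bar>) * (\<Sum>m<M. norm (W m))"
proof -
  define b where "b = (\<Sum>j\<le>k. \<bar>\<beta> j\<bar>)"
  define \<omega> where "\<omega> m = norm (W m)" for m
  have b: "0 \<le> b" by (simp add: b_def sum_nonneg)
  have summand: "norm (\<beta> j *\<^sub>R \<Delta> (i + j)) \<le> L * (\<bar>\<beta> j\<bar> * \<omega> (i + j))" if "i + k \<le> M" "j \<le> k" for i j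
  proof (cases "i + j < M \<or> \<beta> k \<noteq> 0")
    case True
    then have "norm (\<Delta> (i + j)) \<le> L * \<omega> (i + j)"
      using lip that unfolding \<omega>_def by (cases "i + j = M") auto
    then have "\<bar>\<beta> j\<bar> * norm (\<Delta> (i + j)) \<le> \<bar>\<beta> j\<bar> * (L * \<omega> (i + j))" by (rule mult_left_mono) simp
    then show ?thesis by (simp add: mult_ac)
  next
    case False
    then have "j = k" using that by simp
    then show ?thesis using False L by (simp add: \<omega>_def)
  qed
  have "norm (\<Sum>j\<le>k. \<alpha> j *\<^sub>R W (i + j)) \<le> h * (L * (\<Sum>j\<le>k. \<bar>\<beta> j\<bar> * \<omega> (i + j))) + norm (r i)"
    if "i < M + 1 - k" for i
  proof -
    have i: "i + k \<le> M" using that by simp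
    have "norm (\<Sum>j\<le>k. \<beta> j *\<^sub>R \<Delta> (i + j)) \<le> (\<Sum>j\<le>k. L * (\<bar>\<beta> j\<bar> * \<omega> (i + j)))"
      by (rule sum_norm_le) (use summand[OF i] in auto)
    then have le: "h * norm (\<Sum>j\<le>k. \<beta> j *\<^sub>R \<Delta> (i + j)) \<le> h * (L * (\<Sum>j\<le>k. \<bar>\<beta> j\<bar> * \<omega> (i + j)))"
      using h by (intro mult_left_mono) (auto simp: sum_distrib_left)
    have "norm (h *\<^sub>R (\<Sum>j\<le>k. \<beta> j *\<^sub>R \<Delta> (i + j)) - r i) \<le>
        h * norm (\<Sum>j\<le>k. \<beta> j *\<^sub>R \<Delta> (i + j)) + norm (r i)"
      using norm_triangle_ineq4[of "h *\<^sub>R (\<Sum>j\<le>k. \<beta> j *\<^sub>R \<Delta> (i + j))" "r i"] h by simp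
    then show ?thesis unfolding rec[OF i] using le by linarith
  qed
  then have "(\<Sum>i<M + 1 - k. norm (\<Sum>j\<le>k. \<alpha> j *\<^sub>R W (i + j))) \<le>
      (\<Sum>i<M + 1 - k. h * (L * (\<Sum>j\<le>k. \<bar>\<beta> j\<bar> * \<omega> (i + j))) + norm (r i))"
    by (intro sum_mono) auto
  also have "\<dots> = h * (L * (\<Sum>j\<le>k. \<bar>\<beta> j\<bar> * (\<Sum>i<M + 1 - k. \<omega> (i + j)))) + (\<Sum>i<M + 1 - k. norm (r i))"
    unfolding sum.distrib sum_distrib_left by (subst sum.swap) simp
  also have "\<dots> \<le> h * (L * (\<Sum>j\<le>k. \<bar>\<beta> j\<bar> * (\<Sum>m\<le>M. \<omega> m))) + \<rho>"
  proof (intro add_mono mult_left_mono sum_mono res)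
    fix j assume j: "j \<in> {..k}"
    \<comment> \<open>For fixed j the windows meet distinct indices up to \<open>M\<close>, so every
      j contributes at most one full sum.\<close>
    have "(\<Sum>i<M + 1 - k. \<omega> (i + j)) = (\<Sum>m\<in>(\<lambda>i. i + j) ` {..<M + 1 - k}. \<omega> m)"
      by (subst sum.reindex) (auto simp: inj_on_def)
    also have "\<dots> \<le> (\<Sum>m\<le>M. \<omega> m)"
      using j by (intro sum_mono2) (auto simp: \<omega>_def)
    finally show "(\<Sum>i<M + 1 - k. \<omega> (i + j)) \<le> (\<Sum>m\<le>M. \<omega> m)" .
  qed (use h L in auto)
  also have "\<dots> = h * L * b * (\<Sum>m\<le>M. \<omega> m) + \<rho>"
    by (simp add: b_def sum_distrib_right mult.assoc)
  finally have sum_le: "(\<Sum>i<M + 1 - k. norm (\<Sum>j\<le>k. \<alpha> j *\<^sub>R W (i + j))) \<le> h * L * b * (\<Sum>m\<le>M. \<omega> m) + \<rho>" .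
  have "\<omega> M \<le> C0 * (S + (\<Sum>i<M + 1 - k. norm (\<Sum>j\<le>k. \<alpha> j *\<^sub>R W (i + j))))"
    unfolding \<omega>_def by (rule C0(2)) (use start in simp)
  also have "\<dots> \<le> C0 * (S + (h * L * b * (\<Sum>m\<le>M. \<omega> m) + \<rho>))"
    using sum_le C0(1) by (intro mult_left_mono add_left_mono) auto
  also have "\<dots> = C0 * (S + \<rho>) + C0 * h * L * b * (\<Sum>m<M. \<omega> m) + (C0 * h * L * b) * \<omega> M"
    by (simp add: algebra_simps flip: lessThan_Suc_atMost)
  \<comment> \<open>The newest error appears on both sides. At most half of it remains on the right
    and is moved to the left, whence the factors 2 in the conclusion.\<close>
  also have "\<dots> \<le> C0 * (S + \<rho>) + C0 * h * L * b * (\<Sum>m<M. \<omega> m) + (1 / 2) * \<omega> M"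
    using small by (intro add_left_mono mult_right_mono) (auto simp: b_def \<omega>_def)
  finally show ?thesis by (simp add: \<omega>_def b_def)
qed

text \<open>The difference \<open>W\<close> between \<open>Y\<close> and the last stage starts at
  O(h^N) and is driven by residuals whose sum is O(h^N): at most T / h terms of size h^(N+1) and a
  geometric series. Only a plain geometric bound on \<open>B\<close> is recorded here.\<close>

lemma error_expansion:
  obtains e C \<rho> h1 where "0 \<le> C" "0 < \<rho>" "\<rho> < 1" "0 < h1"
    "\<And>h n. 0 < h \<Longrightarrow> h \<le> h1 \<Longrightarrow> real n * h \<le> T \<Longrightarrow>
      norm (Y h n - (X (real n * h) + (\<Sum>i\<in>{p..<N}. h ^ i *\<^sub>R e i (real n * h)))) \<le> C * (h ^ N + \<rho> ^ n)"
proof -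
  obtain e \<epsilon> where "stage N (\<lambda>z. X (snd z) + (\<Sum>i\<in>{p..<N}. fst z ^ i *\<^sub>R e i (snd z))) (\<lambda>h n. \<Sum>i\<in>{p..<N}. h ^ i *\<^sub>R \<epsilon> i n)"
    using stage_exists[OF pN order_refl] by auto
  then obtain A B where st: "stage N A B" and A_def: "A = (\<lambda>z. X (snd z) + (\<Sum>i\<in>{p..<N}. fst z ^ i *\<^sub>R e i (snd z)))"
    by blast
  define u where "u h n = A (h, real n * h) + B h n" for h n
  define W where "W h n = Y h n - u h n" for h n
  have N1: "1 \<le> N" using p pN by simp
  have A: "Ck (N + 2) A" using st regularity_ge[of N] by (auto simp: stage_def intro: Ck_mono simp del: Ck.simps)
  have B: "geo_expands T M B" for M
    using st geo_expands_shift[of "T + real k" M B T 0] by (simp add: stage_def)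
  have gs: "Ck s g" if "s \<le> (N + 2) * (N + 2)" for s by (rule Ck_mono[OF g that])
  have NN: "N + N \<le> (N + 2) * (N + 2)"
  proof -
    have "N + N \<le> 2 * (N + 2)" by simp
    also have "\<dots> \<le> (N + 2) * (N + 2)" by (intro mult_le_mono1) simp
    finally show ?thesis .
  qed
  have "Ck (Suc N) (smooth_residual A)"
    by (rule Ck_smooth_residual[OF Ck_mono[OF A] gs]) (use NN N1 in auto)
  moreover have "order_at_0 (Suc N) (\<lambda>\<sigma>. smooth_residual A (\<sigma>, t))" if "0 \<le> t" "t < T" for t
    using st that by (simp add: stage_def)
  ultimately have "\<exists>C\<ge>0. \<forall>t h. 0 \<le> t \<longrightarrow> t < T \<longrightarrow> 0 \<le> h \<longrightarrow> h \<le> 1 \<longrightarrow>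
      norm (smooth_residual A (h, t)) \<le> C * h ^ Suc N"
    by (rule smooth_uniform_order)
  then obtain C1 where C1: "0 \<le> C1" "\<And>t h. 0 \<le> t \<Longrightarrow> t < T \<Longrightarrow> 0 \<le> h \<Longrightarrow> h \<le> 1 \<Longrightarrow>
      norm (smooth_residual A (h, t)) \<le> C1 * h ^ Suc N" by blast
  have "geo_expands T N (decaying_residual A B)"
    using st by (intro geo_expands_decaying_residual Ck_mono[OF A] gs NN N1) (auto simp: stage_def)
  moreover have "order_at_0 N (\<lambda>h. decaying_residual A B h n)" for n using st by (simp add: stage_def)
  ultimately obtain C2 \<rho>2 where C2: "0 \<le> C2" "0 < \<rho>2" "\<rho>2 < 1"
    "\<And>h n. 0 < h \<Longrightarrow> h \<le> 1 \<Longrightarrow> real n * h \<le> T \<Longrightarrow> norm (decaying_residual A B h n) \<le> C2 * h ^ N * \<rho>2 ^ n"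
    using geo_expands_order[where D="decaying_residual A B" and q=N and M=N, OF _ T _ order_refl] by blast
  have "order_at_0 1 (\<lambda>h. B h n)" for n using st by (simp add: stage_def)
  then have B0: "order_at_0 0 (\<lambda>h. B h n)" for n by (rule order_at_0_mono) simp
  obtain C3 \<rho> where C3': "0 \<le> C3" and \<rho>: "0 < \<rho>" "\<rho> < 1"
    and B_bound: "\<And>h n. 0 < h \<Longrightarrow> h \<le> 1 \<Longrightarrow> real n * h \<le> T \<Longrightarrow> norm (B h n) \<le> C3 * h ^ 0 * \<rho> ^ n"
    by (rule geo_expands_order[where q=0 and M=0, OF B T B0 order_refl]) (rule that; (assumption | simp))
  have C3: "0 \<le> C3" "norm (B h n) \<le> C3 * \<rho> ^ n" if "0 < h" "h \<le> 1" "real n * h \<le> T" for h n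
    using C3' B_bound[OF that] by simp_all
  have "\<forall>j. \<exists>C b. j < k \<longrightarrow> 0 \<le> C \<and> 0 < b \<and> (\<forall>h. 0 < h \<longrightarrow> h < b \<longrightarrow> norm (W h j) \<le> C * h ^ N)"
  proof (intro allI)
    fix j
    show "\<exists>C b. j < k \<longrightarrow> 0 \<le> C \<and> 0 < b \<and> (\<forall>h. 0 < h \<longrightarrow> h < b \<longrightarrow> norm (W h j) \<le> C * h ^ N)"
    proof (cases "j < k")
      case True
      then have "order_at_0 N (\<lambda>h. W h j)" using st by (simp add: stage_def W_def u_def)
      then show ?thesis using order_at_0D[of N "\<lambda>h. W h j"] by metis
    qed simp
  qed
  then obtain Cs bs where Cs: "\<And>j. j < k \<Longrightarrow> 0 \<le> Cs j \<and> 0 < bs j \<and> (\<forall>h. 0 < h \<longrightarrow> h < bs j \<longrightarrow> norm (W h j) \<le> Cs j * h ^ N)"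
    by metis
  define C4 where "C4 = (\<Sum>j<k. Cs j)"
  have C4: "0 \<le> C4" unfolding C4_def by (rule sum_nonneg) (use Cs in auto)
  define hs where "hs = Min (bs ` {..<k})"
  have hs: "0 < hs" unfolding hs_def using Cs k by (subst Min_gr_iff) (auto simp: lessThan_empty_iff)
  have start: "norm (W h j) \<le> C4 * h ^ N" if "0 < h" "h < hs" "j < k" for h j
  proof -
    have "hs \<le> bs j" unfolding hs_def using that by (intro Min_le) auto
    then have "norm (W h j) \<le> Cs j * h ^ N" using Cs[OF that(3)] that by auto
    also have "Cs j \<le> C4" unfolding C4_def by (rule member_le_sum) (use Cs that in auto)
    finally show ?thesis using that by (simp add: mult_right_mono)
  qed
  obtain C0 where C0: "0 \<le> C0" "\<forall>(w :: nat \<Rightarrow> 'a) S M. (\<forall>j<k. norm (w j) \<le> S) \<longrightarrow>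
      norm (w M) \<le> C0 * (S + (\<Sum>i<M + 1 - k. norm (\<Sum>j\<le>k. \<alpha> j *\<^sub>R w (i + j))))"
    using recurrence_stability[where k=k and \<alpha>=\<alpha>, OF k lead eig] by blast
  note stability = C0(2)[THEN spec, THEN spec, THEN spec, THEN mp]
  have "\<exists>R. 0 \<le> R \<and> (\<beta> k \<noteq> 0 \<longrightarrow> (\<forall>h n. 0 < h \<longrightarrow> h \<le> h0 \<longrightarrow> real n * h \<le> T \<longrightarrow> norm (Y h n - X (real n * h)) \<le> R))"
  proof (cases "\<beta> k = 0")
    case False
    then obtain R where R: "\<forall>h n. 0 < h \<longrightarrow> h \<le> h0 \<longrightarrow> real n * h \<le> T \<longrightarrow> norm (Y h n - X (real n * h)) \<le> R"
      using tube by blast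
    have "norm (Y h0 0 - X (real 0 * h0)) \<le> R" using R[rule_format, of h0 0] h0 T by simp
    then have "0 \<le> R" using norm_ge_zero order_trans by blast
    then show ?thesis using R by blast
  qed auto
  then obtain R where R: "0 \<le> R" "\<And>h n. \<beta> k \<noteq> 0 \<Longrightarrow> 0 < h \<Longrightarrow> h \<le> h0 \<Longrightarrow> real n * h \<le> T \<Longrightarrow>
      norm (Y h n - X (real n * h)) \<le> R" by blast
  obtain CA where CA: "CA > 0" "\<And>x. x \<in> {0..1} \<times> {0..T} \<Longrightarrow> norm (A x) \<le> CA"
    using continuous_on_compact_norm_bound[OF Ck_continuous[OF A] compact_Times[OF compact_Icc compact_Icc]] by blast
  obtain CX where CX: "CX > 0" "\<And>t. t \<in> {0..T} \<Longrightarrow> norm (X t) \<le> CX"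
    using continuous_on_compact_norm_bound[OF Ck_continuous[OF X] compact_Icc] by blast
  \<comment> \<open>Radius of a ball containing all arguments of g: \<open>CA + C3 + 1\<close>
    covers values with error at most 1, and \<open>CX + R\<close> covers those known only from the
    tube.\<close>
  define Rb where "Rb = CA + C3 + 1 + CX + R"
  have "Ck 1 g" by (rule gs) simp
  then obtain L where L: "0 < L" "\<forall>x y. norm x \<le> Rb \<longrightarrow> norm y \<le> Rb \<longrightarrow> norm (g y - g x) \<le> L * norm (y - x)"
    using Ck_lipschitz_on_ball by blast
  have u_bound: "norm (u h n) \<le> CA + C3" if "0 < h" "h \<le> 1" "real n * h \<le> T" for h n
  proof -
    have "norm (A (h, real n * h)) \<le> CA" using that by (intro CA(2)) auto
    moreover have "norm (B h n) \<le> C3"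
      using order_trans[OF C3(2)[OF that] mult_left_mono[OF power_le_one C3']] \<rho> by simp
    ultimately show ?thesis unfolding u_def by (rule norm_triangle_mono)
  qed
  define b where "b = (\<Sum>j\<le>k. \<bar>\<beta> j\<bar>)"
  have b: "0 \<le> b" by (simp add: b_def sum_nonneg)
  define c where "c = 2 * C0 * L * b"
  have c: "0 \<le> c" using C0 L b by (simp add: c_def)
  \<comment> \<open>Collects the starting error, the accumulated smooth residuals and the geometric
    series of the decaying ones.\<close>
  define D0 where "D0 = 2 * C0 * (C4 + (C1 * T + C2 / (1 - \<rho>2)))"
  have D0: "0 \<le> D0" using C0(1) C4 C1(1) C2 T by (simp add: D0_def)
  define D where "D = D0 * exp (c * T)"
  have D: "0 \<le> D" using D0 by (simp add: D_def)
  \<comment> \<open>\<open>1 / (c + 1)\<close> gives \<open>c * h \<le> 1\<close>, which allows the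
    absorption of the newest error; \<open>1 / (D + 1)\<close> gives
    \<open>D * h ^ N \<le> 1\<close>; half of \<open>hs\<close> makes the bound
    \<open>h < hs\<close> strict.\<close>
  define h1 where "h1 = min (min (1 / 2) h0) (min (hs / 2) (min (1 / (c + 1)) (1 / (D + 1))))"
  have h1: "0 < h1" using h0 hs c D by (simp add: h1_def)
  have W_bound: "norm (W h M) \<le> D * h ^ N" if h: "0 < h" "h \<le> h1" and M: "real M * h \<le> T" for h M
  proof -
    have h': "h \<le> 1" "h \<le> h0" "h < hs" "h \<le> 1 / (c + 1)" "h \<le> 1 / (D + 1)"
      using h hs unfolding h1_def by auto
    have ch: "c * h \<le> 1"
    proof -
      have "(c + 1) * h \<le> 1" using h'(4) c by (simp add: field_simps)
      then show ?thesis using h(1) by (simp add: distrib_right)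
    qed
    have Dh: "D * h ^ N \<le> 1"
    proof -
      have "h ^ N \<le> h ^ 1" using h(1) h' N1 by (intro power_decreasing) auto
      then have "D * h ^ N \<le> D * h" using D by (simp add: mult_left_mono)
      also have "(D + 1) * h \<le> 1" using h'(5) D by (simp add: field_simps)
      then have "D * h \<le> 1" using h(1) by (simp add: distrib_right)
      finally show ?thesis .
    qed
    have recW: "(\<Sum>j\<le>k. \<alpha> j *\<^sub>R W h (i + j)) = h *\<^sub>R (\<Sum>j\<le>k. \<beta> j *\<^sub>R (g (Y h (i + j)) - g (u h (i + j)))) -
        (smooth_residual A (h, real i * h) + decaying_residual A B h i)" if "real (i + k) * h \<le> T" for i
    proof -
      have eq: "real i * h + real j * h = real (i + j) * h" for j by (simp add: distrib_right)
      have "smooth_residual A (h, real i * h) + decaying_residual A B h i =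
          (\<Sum>j\<le>k. \<alpha> j *\<^sub>R u h (i + j)) - h *\<^sub>R (\<Sum>j\<le>k. \<beta> j *\<^sub>R g (u h (i + j)))"
        unfolding smooth_residual_def decaying_residual_def u_def fst_conv snd_conv eq
        by (simp add: scaleR_add_right scaleR_diff_right sum.distrib sum_subtractf)
      then show ?thesis
        using recursion[OF h(1) h'(2) that]
        by (simp add: W_def scaleR_diff_right sum_subtractf)
    qed
    have res: "norm (smooth_residual A (h, real i * h) + decaying_residual A B h i) \<le>
        C1 * h ^ Suc N + C2 * h ^ N * \<rho>2 ^ i" if "real (i + k) * h \<le> T" for i
    proof (rule norm_triangle_mono)
      have "0 < real k * h" using k h by simp
      then have i: "real i * h < T" using that by (simp add: distrib_right)
      then show "norm (smooth_residual A (h, real i * h)) \<le> C1 * h ^ Suc N" using h h' by (intro C1(2)) auto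
      show "norm (decaying_residual A B h i) \<le> C2 * h ^ N * \<rho>2 ^ i" using h h' i by (intro C2(4)) auto
    qed
    \<comment> \<open>Both bounds advance together: the second one at earlier indices keeps those
      values in the Lipschitz ball, this yields the first at n, and the Gronwall lemma then gives
      the second at n.\<close>
    have "norm (W h n) \<le> D0 * h ^ N + c * h * (\<Sum>m<n. norm (W h m)) \<and> norm (W h n) \<le> D * h ^ N"
      if "real n * h \<le> T" for n
      using that
    proof (induction n rule: less_induct)
      case (less n)
      have mh: "real m * h \<le> T" if "m \<le> n" for m
      proof -
        have "real m * h \<le> real n * h" using that h by (intro mult_right_mono) auto
        then show ?thesis using less.prems by simp
      qed
      have "(\<Sum>i<n + 1 - k. norm (smooth_residual A (h, real i * h) + decaying_residual A B h i)) \<le>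
          (\<Sum>i<n + 1 - k. C1 * h ^ Suc N + C2 * h ^ N * \<rho>2 ^ i)"
        by (intro sum_mono res mh) auto
      also have "\<dots> = (real (n + 1 - k) * h) * (C1 * h ^ N) + C2 * h ^ N * (\<Sum>i<n + 1 - k. \<rho>2 ^ i)"
        by (simp add: sum.distrib sum_distrib_left mult_ac)
      also have "\<dots> \<le> T * (C1 * h ^ N) + C2 * h ^ N * (1 / (1 - \<rho>2))"
      proof (intro add_mono mult_right_mono mult_left_mono)
        \<comment> \<open>Since k is at least 1, there are at most n windows.\<close>
        show "real (n + 1 - k) * h \<le> T" using k by (intro mh) simp
        show "(\<Sum>i<n + 1 - k. \<rho>2 ^ i) \<le> 1 / (1 - \<rho>2)"
          unfolding sum_gp_strict using C2(2,3) by (auto intro: divide_right_mono)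
      qed (use C1(1) C2(1) h in auto)
      finally have res_sum: "(\<Sum>i<n + 1 - k. norm (smooth_residual A (h, real i * h) + decaying_residual A B h i)) \<le>
          (C1 * T + C2 / (1 - \<rho>2)) * h ^ N" by (simp add: algebra_simps)
      have "norm (W h n) \<le> 2 * C0 * (C4 * h ^ N + (C1 * T + C2 / (1 - \<rho>2)) * h ^ N) +
          2 * C0 * h * L * (\<Sum>j\<le>k. \<bar>\<beta> j\<bar>) * (\<Sum>m<n. norm (W h m))"
      proof (rule recurrence_error_bound[where \<Delta>="\<lambda>m. g (Y h m) - g (u h m)", OF C0(1) stability h(1) _ _ recW _ _ res_sum])
        show "0 \<le> L" using L by simp
        show "norm (W h j) \<le> C4 * h ^ N" if "j < k" for j by (rule start[OF h(1) h'(3) that])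
        show "real (i + k) * h \<le> T" if "i + k \<le> n" for i by (rule mh[OF that])
        show "norm (g (Y h m) - g (u h m)) \<le> L * norm (W h m)" if m: "m < n" for m
        proof -
          have mT: "real m * h \<le> T" using m by (intro mh) simp
          have um: "norm (u h m) \<le> CA + C3" using u_bound[OF h(1) h'(1) mT] .
          have "norm (W h m) \<le> 1" using less.IH[OF m mT] Dh by simp
          then have "norm (u h m + W h m) \<le> CA + C3 + 1" using um by (intro norm_triangle_mono)
          then show ?thesis using L(2)[rule_format, of "u h m" "Y h m"] um R(1) CX(1) unfolding W_def Rb_def by simp
        qed
        show "norm (g (Y h n) - g (u h n)) \<le> L * norm (W h n)" if "\<beta> k \<noteq> 0"
        proof -
          have un: "norm (u h n) \<le> CA + C3" using u_bound[OF h(1) h'(1) less.prems] .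
          have "norm (X (real n * h)) \<le> CX" using less.prems h by (intro CX(2)) auto
          then have "norm (X (real n * h) + (Y h n - X (real n * h))) \<le> CX + R"
            using R(2)[OF that h(1) h'(2) less.prems] by (rule norm_triangle_mono)
          then show ?thesis using L(2)[rule_format, of "u h n" "Y h n"] un R(1) CX(1) CA(1) C3' unfolding W_def Rb_def by simp
        qed
        show "C0 * h * L * (\<Sum>j\<le>k. \<bar>\<beta> j\<bar>) \<le> 1 / 2"
          using ch unfolding c_def b_def by (simp add: mult_ac)
      qed
      then have ineq: "norm (W h n) \<le> D0 * h ^ N + c * h * (\<Sum>m<n. norm (W h m))"
        by (simp add: D0_def c_def b_def algebra_simps)
      have "norm (W h n) \<le> D0 * h ^ N * (1 + c * h) ^ n"
      proof (rule discrete_gronwall)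
        show "norm (W h m) \<le> D0 * h ^ N + c * h * (\<Sum>i<m. norm (W h i))" if "m \<le> n" for m
          using ineq less.IH[of m] mh[OF that] that by (cases "m = n") auto
      qed (use c h in simp)
      also have "\<dots> \<le> D0 * h ^ N * exp (c * T)"
      proof (rule mult_left_mono)
        have "(1 + c * h) ^ n \<le> exp (c * h) ^ n"
          using c h by (intro power_mono exp_ge_add_one_self) simp
        also have "\<dots> = exp (c * (real n * h))" by (simp add: mult_ac flip: exp_of_nat_mult)
        also have "\<dots> \<le> exp (c * T)" using less.prems c by (simp add: mult_left_mono)
        finally show "(1 + c * h) ^ n \<le> exp (c * T)" .
      qed (use D0 h in simp)
      finally show ?case using ineq by (simp add: D_def mult_ac)
    qed
    then show ?thesis using M by blast
  qed
  show ?thesis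
  proof
    show "0 \<le> D + C3" using D C3' by simp
    fix h n assume h: "0 < h" "h \<le> h1" "real n * h \<le> T"
    have h': "h \<le> 1" using h unfolding h1_def by auto
    have "Y h n - (X (real n * h) + (\<Sum>i\<in>{p..<N}. h ^ i *\<^sub>R e i (real n * h))) = W h n + B h n"
      by (simp add: W_def u_def A_def)
    also have "norm \<dots> \<le> D * h ^ N + C3 * \<rho> ^ n"
      by (rule norm_triangle_mono[OF W_bound[OF h] C3(2)[OF h(1) h' h(3)]])
    also have "\<dots> \<le> (D + C3) * (h ^ N + \<rho> ^ n)"
      using D C3' h(1) \<rho> by (simp add: algebra_simps)
    finally show "norm (Y h n - (X (real n * h) + (\<Sum>i\<in>{p..<N}. h ^ i *\<^sub>R e i (real n * h)))) \<le>
        (D + C3) * (h ^ N + \<rho> ^ n)" .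
  qed (use \<rho> h1 in auto)
qed

end

section \<open>Extrapolation\<close>

text \<open>At a fixed time the coefficients \<open>e i\<close> are common to all the step sizes.
  Each is multiplied by \<open>h ^ i\<close> times a sum that the weights annihilate, while weights
  of sum 1 preserve \<open>x\<close>.\<close>

lemma rgre_error:
  assumes w: "rgre_weights p l N \<gamma>" and N: "\<And>j. j \<in> {1..l+1} \<Longrightarrow> 1 \<le> N j" and C: "0 \<le> C"
    and exp: "\<And>h n. 0 < h \<Longrightarrow> h \<le> h1 \<Longrightarrow> real n * h = \<tau> \<Longrightarrow>
      norm (Y h n - (x + (\<Sum>i\<in>{p..<p+l}. h ^ i *\<^sub>R e i))) \<le> C * h ^ (p + l)"
    and h: "0 < h" "h \<le> h1" "real n * h = \<tau>"
  shows "norm (rgre l N \<gamma> Y n h - x) \<le> (\<Sum>j=1..l+1. \<bar>\<gamma> j\<bar>) * C * h ^ (p + l)"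
proof -
  define H where "H j = h / real (N j)" for j
  define r where "r j = Y (H j) (N j * n) - (x + (\<Sum>i\<in>{p..<p+l}. H j ^ i *\<^sub>R e i))" for j
  have H: "0 < H j" "H j \<le> h" "real (N j * n) * H j = \<tau>" if "j \<in> {1..l+1}" for j
    using N[OF that] h by (auto simp: H_def divide_le_eq mult_le_cancel_left1)
  have r: "norm (r j) \<le> C * h ^ (p + l)" if j: "j \<in> {1..l+1}" for j
  proof -
    have "norm (r j) \<le> C * H j ^ (p + l)"
      unfolding r_def by (rule exp) (use H[OF j] h in auto)
    also have "\<dots> \<le> C * h ^ (p + l)"
      using C H[OF j] by (intro mult_left_mono power_mono) auto
    finally show ?thesis .
  qed
  have cancel: "(\<Sum>j=1..l+1. \<gamma> j * H j ^ i) = 0" if i: "i \<in> {p..<p+l}" for i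
  proof -
    have "i - p < l" using i by auto
    then have "(\<Sum>j=1..l+1. \<gamma> j / real (N j) ^ (p + (i - p))) = 0"
      using w unfolding rgre_weights_def by blast
    then have "h ^ i * (\<Sum>j=1..l+1. \<gamma> j / real (N j) ^ i) = 0" using i by simp
    then show ?thesis unfolding sum_distrib_left H_def by (simp add: power_divide mult_ac)
  qed
  have "rgre l N \<gamma> Y n h = (\<Sum>j=1..l+1. \<gamma> j *\<^sub>R (x + (\<Sum>i\<in>{p..<p+l}. H j ^ i *\<^sub>R e i) + r j))"
    unfolding rgre_def by (simp add: r_def H_def)
  also have "\<dots> = (\<Sum>j=1..l+1. \<gamma> j) *\<^sub>R x + (\<Sum>i\<in>{p..<p+l}. (\<Sum>j=1..l+1. \<gamma> j * H j ^ i) *\<^sub>R e i)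
      + (\<Sum>j=1..l+1. \<gamma> j *\<^sub>R r j)"
    unfolding scaleR_add_right sum.distrib scaleR_sum_left scaleR_sum_right
    by (subst (2) sum.swap) simp
  also have "\<dots> = x + (\<Sum>j=1..l+1. \<gamma> j *\<^sub>R r j)"
    using w cancel by (simp add: rgre_weights_def)
  finally have "norm (rgre l N \<gamma> Y n h - x) = norm (\<Sum>j=1..l+1. \<gamma> j *\<^sub>R r j)" by simp
  also have "\<dots> \<le> (\<Sum>j=1..l+1. \<bar>\<gamma> j\<bar> * (C * h ^ (p + l)))"
  proof (rule sum_norm_le)
    show "norm (\<gamma> j *\<^sub>R r j) \<le> \<bar>\<gamma> j\<bar> * (C * h ^ (p + l))" if "j \<in> {1..l+1}" for j
      using r[OF that] by (simp add: mult_left_mono)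
  qed
  finally show ?thesis by (simp only: sum_distrib_right mult.assoc)
qed

text \<open>Here n = \<tau> / h, so \<tau> is at most (1 + n) h, and a power of n absorbed by the
  geometric factor becomes a power of h. Positivity of \<tau> is essential: at \<tau> = 0 the index
  stays 0.\<close>

lemma geometric_le_power_step:
  assumes "0 < \<rho>" "\<rho> < 1" "0 < \<tau>"
  shows "\<exists>C\<ge>0. \<forall>h n. 0 < h \<longrightarrow> real n * h = \<tau> \<longrightarrow> \<rho> ^ n \<le> C * h ^ M"
proof -
  obtain C \<sigma> where C: "0 \<le> C" "0 < \<sigma>" "\<sigma> < 1" "\<forall>n. (1 + real n) ^ M * \<rho> ^ n \<le> C * \<sigma> ^ n"
    using polynomial_times_geometric[OF assms(1,2)] by blast
  have "\<rho> ^ n \<le> C / \<tau> ^ M * h ^ M" if "0 < h" "real n * h = \<tau>" for h n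
  proof -
    have "\<tau> ^ M * \<rho> ^ n \<le> ((1 + real n) * h) ^ M * \<rho> ^ n"
      using that assms by (intro mult_right_mono power_mono) (auto simp: distrib_right)
    also have "\<dots> = h ^ M * ((1 + real n) ^ M * \<rho> ^ n)" by (simp add: power_mult_distrib)
    also have "\<dots> \<le> h ^ M * (C * \<sigma> ^ n)" using C(4) that by (intro mult_left_mono) auto
    also have "\<dots> \<le> h ^ M * (C * 1)"
      using C that by (intro mult_left_mono) (auto simp: power_le_one)
    finally show ?thesis using assms(3) by (simp add: field_simps)
  qed
  then show ?thesis using C(1) assms(3) by (intro exI[of _ "C / \<tau> ^ M"]) auto
qed

text \<open>At \<tau> = 0 the decaying terms are present at full size for every h. The computed
  value is then a starting value, and its own expansion is used instead.\<close>

lemma (in lmm_autonomous_family) error_expansion_fixed_point: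
  assumes "\<tau> \<in> {0..T}"
  obtains e C h1 where "0 \<le> C" "0 < h1"
    "\<And>h n. 0 < h \<Longrightarrow> h \<le> h1 \<Longrightarrow> real n * h = \<tau> \<Longrightarrow>
      norm (Y h n - (X \<tau> + (\<Sum>i\<in>{p..<N}. h ^ i *\<^sub>R e i))) \<le> C * h ^ N"
proof (cases "\<tau> = 0")
  case True
  have 0: "0 < k" using k by simp
  obtain c where c: "order_at_0 N (\<lambda>h. Y h 0 - (\<Sum>i<N. h ^ i *\<^sub>R c i))"
    using start_exp[OF 0] unfolding has_expansion_at_0_def by blast
  \<comment> \<open>Expansion coefficients of the starting error; its order p makes those below p
    vanish, so the required range of exponents remains.\<close>
  define d where "d i = (if i = 0 then c 0 - X 0 else c i)" for i
  have N: "{..<N} = insert 0 {1..<N}" using p pN by auto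
  have d_sum: "(\<Sum>i<N. h ^ i *\<^sub>R d i) = (\<Sum>i<N. h ^ i *\<^sub>R c i) - X 0" for h
    unfolding N by (simp add: d_def)
  have rem: "order_at_0 N (\<lambda>h. Y h 0 - X 0 - (\<Sum>i<N. h ^ i *\<^sub>R d i))"
    using c by (simp add: d_sum)
  have "order_at_0 p (\<lambda>h. Y h 0 - X 0)" using start_order[OF 0] by simp
  from order_at_0_diff[OF this order_at_0_mono[OF rem pN]]
  have "order_at_0 p (\<lambda>h. (Y h 0 - X 0) - (Y h 0 - X 0 - (\<Sum>i<N. h ^ i *\<^sub>R d i)))" .
  then have "order_at_0 p (\<lambda>h. \<Sum>i<N. h ^ i *\<^sub>R d i)" by simp
  then have d0: "d i = 0" if "i < p" for i
    using order_at_0_coeff_eq_0[where q=p and M=N and c=d] that pN by simp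
  have d_sum': "(\<Sum>i<N. h ^ i *\<^sub>R d i) = (\<Sum>i\<in>{p..<N}. h ^ i *\<^sub>R d i)" for h :: real
    by (rule sum.mono_neutral_right) (use d0 in auto)
  obtain C b where C: "0 \<le> C" "0 < b" "b \<le> 1"
    "\<And>h. 0 < h \<Longrightarrow> h < b \<Longrightarrow> norm (Y h 0 - X 0 - (\<Sum>i<N. h ^ i *\<^sub>R d i)) \<le> C * h ^ N"
    by (rule order_at_0D[OF rem]) (rule that; (assumption | simp))
  show ?thesis
  proof (rule that[OF C(1), of "b / 2" d])
    fix h n assume h: "0 < h" "h \<le> b / 2" "real n * h = \<tau>"
    then have "n = 0" using True by simp
    then show "norm (Y h n - (X \<tau> + (\<Sum>i\<in>{p..<N}. h ^ i *\<^sub>R d i))) \<le> C * h ^ N"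
      using C(4)[of h] h True C(2) by (simp add: d_sum' diff_diff_eq)
  qed (use C in simp)
next
  case False
  then have \<tau>: "0 < \<tau>" "\<tau> \<le> T" using assms by auto
  obtain e C \<rho> h1 where e: "0 \<le> C" "0 < \<rho>" "\<rho> < 1" "0 < h1"
    "\<And>h n. 0 < h \<Longrightarrow> h \<le> h1 \<Longrightarrow> real n * h \<le> T \<Longrightarrow>
      norm (Y h n - (X (real n * h) + (\<Sum>i\<in>{p..<N}. h ^ i *\<^sub>R e i (real n * h)))) \<le> C * (h ^ N + \<rho> ^ n)"
    by (rule error_expansion) (rule that; (assumption | simp))
  obtain K where K: "0 \<le> K" "\<forall>h n. 0 < h \<longrightarrow> real n * h = \<tau> \<longrightarrow> \<rho> ^ n \<le> K * h ^ N"
    using geometric_le_power_step[OF e(2,3) \<tau>(1)] by blast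
  show ?thesis
  proof (rule that[of "C * (1 + K)" h1 "\<lambda>i. e i \<tau>"])
    fix h n assume h: "0 < h" "h \<le> h1" "real n * h = \<tau>"
    have "norm (Y h n - (X \<tau> + (\<Sum>i\<in>{p..<N}. h ^ i *\<^sub>R e i \<tau>))) \<le> C * (h ^ N + \<rho> ^ n)"
      using e(5)[of h n] h \<tau>(2) by simp
    also have "\<dots> \<le> C * (h ^ N + K * h ^ N)"
      using K(2) h e(1) by (intro mult_left_mono add_left_mono) auto
    finally show "norm (Y h n - (X \<tau> + (\<Sum>i\<in>{p..<N}. h ^ i *\<^sub>R e i \<tau>))) \<le> C * (1 + K) * h ^ N"
      by (simp add: algebra_simps)
  qed (use e K in auto)
qed

section \<open>Reduction of the initial-value problem to the autonomous setting\<close>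

lemma sum_Pair: "(\<Sum>i\<in>I. (a i, b i)) = (\<Sum>i\<in>I. a i, \<Sum>i\<in>I. b i)"
  by (simp add: prod_eq_iff fst_sum snd_sum)

lemma starting_values_expand_order:
  assumes "starting_values_expand k N Y" "j < k"
  shows "has_expansion_at_0 N (\<lambda>h. Y h j)"
proof -
  obtain c where "(\<lambda>h. norm (Y h j - (\<Sum>i<N. h ^ i *\<^sub>R c i))) \<in> O[at_right 0](\<lambda>h. h ^ N)"
    using assms unfolding starting_values_expand_def by blast
  then obtain C where "\<forall>\<^sub>F h in at_right 0. norm (norm (Y h j - (\<Sum>i<N. h ^ i *\<^sub>R c i))) \<le> C * norm (h ^ N)"
    by (rule landau_o.bigE)
  moreover have "\<forall>\<^sub>F h::real in at_right 0. 0 < h" by (rule eventually_at_right_less)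
  ultimately have "\<forall>\<^sub>F h in at_right 0. norm (Y h j - (\<Sum>i<N. h ^ i *\<^sub>R c i)) \<le> C * h ^ N"
    by eventually_elim simp
  then show ?thesis unfolding has_expansion_at_0_def order_at_0_def by blast
qed

text \<open>Adjoining \<open>t\<close> to the state makes the problem autonomous; consistency makes the method
  reproduce the grid points exactly.\<close>

lemma autonomous_family:
  fixes f :: "real \<Rightarrow> real ^ 'm \<Rightarrow> real ^ 'm"
  assumes k: "k \<ge> 1" "\<alpha> k \<noteq> 0" "eigenvalue_condition (companion k \<alpha>)"
    and p: "1 \<le> p" "lmm_order k \<alpha> \<beta> p" and l: "1 \<le> l"
    and f: "Ck ((p + l + 2) * (p + l + 2)) (\<lambda>(t, x). f t x)" and t0: "t0 < tf"
    and y: "ivp_solution f t0 tf y0 y" and h0: "0 < h0"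
    and Y: "lmm_solution f t0 tf y k \<alpha> \<beta> h0 Y"
    and close: "starting_values_close t0 tf y k p h0 Y"
    and expand: "starting_values_expand k (p + l) Y"
  obtains X where "\<And>\<tau>. \<tau> \<in> {0..tf - t0} \<Longrightarrow> X \<tau> = (t0 + \<tau>, y (t0 + \<tau>))"
    "lmm_autonomous_family k p (p + l) \<alpha> \<beta> (\<lambda>z. (1, f (fst z) (snd z))) (tf - t0) X
       (\<lambda>h n. (t0 + real n * h, Y h n)) h0"
proof -
  define T where "T = tf - t0"
  define g where "g z = (1 :: real, f (fst z) (snd z))" for z
  define x where "x \<tau> = (t0 + \<tau>, y (t0 + \<tau>))" for \<tau>
  have T: "0 < T" "0 \<le> T" using t0 by (auto simp: T_def)
  have g: "Ck ((p + l + 2) * (p + l + 2)) g"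
    unfolding g_def[abs_def] using f by (intro Ck_Pair Ck_const) (simp add: case_prod_unfold)
  have x: "(x has_vector_derivative g (x \<tau>)) (at \<tau> within {0..T})" if \<tau>: "\<tau> \<in> {0..T}" for \<tau>
  proof -
    have shift: "((\<lambda>\<tau>. t0 + \<tau>) has_vector_derivative 1) (at \<tau> within {0..T})"
      by (auto intro!: derivative_eq_intros simp flip: has_real_derivative_iff_has_vector_derivative)
    have "(\<lambda>\<tau>. t0 + \<tau>) ` {0..T} = {t0..tf}" by (simp add: T_def)
    moreover have "t0 + \<tau> \<in> {t0..tf}" using \<tau> by (simp add: T_def)
    ultimately have "(y has_vector_derivative f (t0 + \<tau>) (y (t0 + \<tau>))) (at (t0 + \<tau>) within (\<lambda>\<tau>. t0 + \<tau>) ` {0..T})"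
      using y by (simp add: ivp_solution_def)
    from vector_diff_chain_within[OF shift this]
    have "((\<lambda>\<tau>. y (t0 + \<tau>)) has_vector_derivative f (t0 + \<tau>) (y (t0 + \<tau>))) (at \<tau> within {0..T})"
      by (simp add: o_def)
    from has_vector_derivative_Pair[OF shift this] show ?thesis
      by (simp add: x_def[abs_def] g_def)
  qed
  \<comment> \<open>The extension result allows a time-dependent right-hand side; here the time
    argument is ignored.\<close>
  have "Ck ((p + l + 2) * (p + l + 2)) (\<lambda>z::real \<times> real \<times> (real ^ 'm). g (snd z))"
    by (rule Ck_compose[OF Ck_bounded_linear[OF bounded_linear_snd] g])
  from Ck_solution_extension[where e=x, OF T(2) this] x
  obtain X where X: "Ck (Suc ((p + l + 2) * (p + l + 2))) X" "\<And>\<tau>. \<tau> \<in> {0..T} \<Longrightarrow> X \<tau> = x \<tau>"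
    "\<And>\<tau>. \<tau> \<in> {0..T} \<Longrightarrow> (X has_vector_derivative g (X \<tau>)) (at \<tau>)"
    by auto
  have sum_alpha: "(\<Sum>j\<le>k. \<alpha> j) = 0" using p(2) by (simp add: lmm_order_def atLeast0AtMost)
  have order: "(\<Sum>j\<le>k. \<alpha> j * real j ^ q) = real q * (\<Sum>j\<le>k. \<beta> j * real j ^ (q - 1))" if "1 \<le> q" "q \<le> p" for q
    using p(2) that by (simp add: lmm_order_def atLeast0AtMost)
  have sum_beta: "(\<Sum>j\<le>k. \<alpha> j * real j) = (\<Sum>j\<le>k. \<beta> j)" using order[of 1] p(1) by simp
  obtain Cs where Cs: "\<And>h j. h \<in> {0..h0} \<Longrightarrow> j < k \<Longrightarrow> t0 + real j * h \<le> tf \<Longrightarrow>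
      norm (Y h j - y (t0 + real j * h)) \<le> Cs * h ^ p"
    using close unfolding starting_values_close_def by blast
  have grid: "real n * h \<le> T \<longleftrightarrow> t0 + real n * h \<le> tf" for n h by (auto simp: T_def)
  have "lmm_autonomous_family k p (p + l) \<alpha> \<beta> g T X (\<lambda>h n. (t0 + real n * h, Y h n)) h0"
  proof unfold_locales
    show "order_at_0 p (\<lambda>h. (t0 + real j * h, Y h j) - X (real j * h))" if j: "j < k" for j
    proof (rule order_at_0I[of "min h0 (T / (real j + 1))" _ Cs])
      fix h assume h: "0 < h" "h < min h0 (T / (real j + 1))"
      have "real j * h \<le> (real j + 1) * h" using h by simp
      also have "\<dots> \<le> T" using h by (simp add: field_simps)
      finally have jh: "real j * h \<le> T" .
      then have "norm (Y h j - y (t0 + real j * h)) \<le> Cs * h ^ p" using h j grid by (intro Cs) auto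
      moreover have "X (real j * h) = x (real j * h)" using h jh by (intro X(2)) simp
      ultimately show "norm ((t0 + real j * h, Y h j) - X (real j * h)) \<le> Cs * h ^ p"
        by (simp add: x_def norm_Pair)
    qed (use h0 T in simp)
    show "has_expansion_at_0 (p + l) (\<lambda>h. (t0 + real j * h, Y h j))" if j: "j < k" for j
    proof -
      obtain c where c: "order_at_0 (p + l) (\<lambda>h. Y h j - (\<Sum>i<p+l. h ^ i *\<^sub>R c i))"
        using starting_values_expand_order[OF expand j] unfolding has_expansion_at_0_def by blast
      \<comment> \<open>Coefficients of the adjoined time component \<open>t0 + real j * h\<close>;
        both of its terms fit because \<open>p + l\<close> is at least 2.\<close>
      define a where "a i = (if i = 0 then t0 else if i = 1 then real j else 0)" for i :: nat
      obtain M where M: "p + l = Suc (Suc M)" using p(1) l by (metis add_Suc_right add_Suc le_Suc_ex plus_1_eq_Suc)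
      have a: "(\<Sum>i<p+l. h ^ i * a i) = t0 + real j * h" for h
        unfolding M sum.lessThan_Suc_shift by (simp add: a_def)
      have "(t0 + real j * h, Y h j) - (\<Sum>i<p+l. h ^ i *\<^sub>R (a i, c i)) = (0, Y h j - (\<Sum>i<p+l. h ^ i *\<^sub>R c i))" for h
        by (simp add: sum_Pair a)
      moreover have "order_at_0 (p + l) (\<lambda>h. (0 :: real, Y h j - (\<Sum>i<p+l. h ^ i *\<^sub>R c i)))"
        by (rule order_at_0_bounded_linear[OF bounded_linear_Pair[OF bounded_linear_zero bounded_linear_ident] c])
      ultimately show ?thesis
        unfolding has_expansion_at_0_def by (intro exI[of _ "\<lambda>i. (a i, c i)"]) simp
    qed
    show "(\<Sum>j\<le>k. \<alpha> j *\<^sub>R (t0 + real (n + j) * h, Y h (n + j))) =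
        h *\<^sub>R (\<Sum>j\<le>k. \<beta> j *\<^sub>R g (t0 + real (n + j) * h, Y h (n + j)))"
      if h: "0 < h" "h \<le> h0" "real (n + k) * h \<le> T" for h n
    proof -
      have "(\<Sum>j\<le>k. \<alpha> j *\<^sub>R Y h (n + j)) = (\<Sum>j\<le>k. (h * \<beta> j) *\<^sub>R f (t0 + real (n + j) * h) (Y h (n + j)))"
        using Y h grid[of "n + k" h] unfolding lmm_solution_def lmm_sequence_def by (simp add: atLeast0AtMost)
      moreover have "(\<Sum>j\<le>k. \<alpha> j * (t0 + real (n + j) * h)) = h * (\<Sum>j\<le>k. \<beta> j)"
      proof -
        have "(\<Sum>j\<le>k. \<alpha> j * (t0 + real (n + j) * h)) =
            (\<Sum>j\<le>k. \<alpha> j) * (t0 + real n * h) + (\<Sum>j\<le>k. \<alpha> j * real j) * h"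
          unfolding sum_distrib_right sum.distrib[symmetric] by (rule sum.cong) (simp_all add: algebra_simps)
        then show ?thesis by (simp add: sum_alpha sum_beta)
      qed
      ultimately show ?thesis by (simp add: g_def sum_Pair scaleR_sum_right)
    qed
    show "\<exists>R. \<forall>h n. 0 < h \<longrightarrow> h \<le> h0 \<longrightarrow> real n * h \<le> T \<longrightarrow>
        norm ((t0 + real n * h, Y h n) - X (real n * h)) \<le> R" if bk: "\<beta> k \<noteq> 0"
    proof -
      obtain R where R: "\<And>h n. h \<in> {0<..h0} \<Longrightarrow> t0 + real n * h \<le> tf \<Longrightarrow> norm (Y h n - y (t0 + real n * h)) \<le> R"
        using Y bk unfolding lmm_solution_def by blast
      have "norm ((t0 + real n * h, Y h n) - X (real n * h)) \<le> R" if "0 < h" "h \<le> h0" "real n * h \<le> T" for h n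
        using R[of h n] that grid[of n h] X(2)[of "real n * h"] by (simp add: x_def norm_Pair)
      then show ?thesis by blast
    qed
    show "Ck ((p + l + 2) * (p + l + 2)) X" by (rule Ck_Suc_imp_Ck[OF X(1)])
  qed (use k p l T g X order sum_alpha h0 in auto)
  then show ?thesis
    using X(2) by (intro that[of X]) (simp_all add: g_def[abs_def] T_def x_def)
qed

text \<open>Only finitely many indices fit with steps of size at least \<open>h1\<close>, and each
  determines h = \<tau> / n, so the values form a finite set.\<close>

lemma bounded_for_large_steps:
  fixes E :: "nat \<Rightarrow> real \<Rightarrow> 'a::real_normed_vector"
  assumes "0 < \<tau>" "0 < h1"
  shows "\<exists>K. \<forall>n h. h1 \<le> h \<longrightarrow> real n * h = \<tau> \<longrightarrow> norm (E n h) \<le> K"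
proof -
  define m where "m = nat \<lceil>\<tau> / h1\<rceil>"
  have "norm (E n h) \<le> (\<Sum>i\<le>m. norm (E i (\<tau> / real i)))" if "h1 \<le> h" "real n * h = \<tau>" for n h
  proof -
    have "0 < n" using that assms by (cases n) auto
    then have n: "0 < n" "h = \<tau> / real n" using that(2) by (simp_all add: eq_divide_eq mult.commute)
    have "real n * h1 \<le> \<tau>" using that by (metis mult_left_mono of_nat_0_le_iff)
    then have "real n \<le> \<tau> / h1" using assms(2) by (simp add: field_simps)
    then have "n \<le> m" unfolding m_def by linarith
    then have "norm (E n (\<tau> / real n)) \<le> (\<Sum>i\<le>m. norm (E i (\<tau> / real i)))"
      by (intro member_le_sum[where f="\<lambda>i. norm (E i (\<tau> / real i))"]) auto
    then show ?thesis using n by simp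
  qed
  then show ?thesis by blast
qed

theorem theorem2p4:
  fixes k p l :: nat and \<alpha> \<beta> \<gamma> :: "nat \<Rightarrow> real" and N :: "nat \<Rightarrow> nat"
  assumes "l \<ge> 1" and "N 1 = 1" and "strict_mono_on {1..l+1} N"
    and "k \<ge> 1" and "\<alpha> k \<noteq> 0"
    and "p \<ge> 1" and "lmm_order k \<alpha> \<beta> p"
    and "eigenvalue_condition (companion k \<alpha>)"
    and "rgre_weights p l N \<gamma>"
  shows "\<exists>s. \<forall>(f :: real \<Rightarrow> real ^ 'm \<Rightarrow> real ^ 'm) t0 tf y0 y h0 Y.
    Ck s (\<lambda>(t, x). f t x) \<longrightarrow>
    t0 < tf \<longrightarrow>
    unique_ivp_solution f t0 tf y0 y \<longrightarrow>
    h0 > 0 \<longrightarrow>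
    lmm_solution f t0 tf y k \<alpha> \<beta> h0 Y \<longrightarrow>
    starting_values_close t0 tf y k p h0 Y \<longrightarrow>
    starting_values_expand k (p + l) Y \<longrightarrow>
    (\<forall>tstar\<in>{t0..tf}. \<exists>C. \<forall>n h. 0 < h \<longrightarrow> h \<le> h0 \<longrightarrow> tstar = t0 + real n * h \<longrightarrow>
       norm (rgre l N \<gamma> Y n h - y tstar) \<le> C * h ^ (p + l))"
proof (rule exI[of _ "(p + l + 2) * (p + l + 2)"], intro allI impI ballI)
  fix f :: "real \<Rightarrow> real ^ 'm \<Rightarrow> real ^ 'm" and t0 tf y0 y h0 Y tstar
  \<comment> \<open>The smoothness class chosen as witness is the one the autonomous construction
    asks for with \<open>N = p + l\<close>; it depends on p and l only.\<close>
  assume f: "Ck ((p + l + 2) * (p + l + 2)) (\<lambda>(t, x). f t x)" and t0: "t0 < tf"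
    and y: "unique_ivp_solution f t0 tf y0 y" and h0: "0 < h0"
    and Y: "lmm_solution f t0 tf y k \<alpha> \<beta> h0 Y"
    and close: "starting_values_close t0 tf y k p h0 Y"
    and expand: "starting_values_expand k (p + l) Y"
    and tstar: "tstar \<in> {t0..tf}"
  define \<tau> where "\<tau> = tstar - t0"
  have \<tau>: "\<tau> \<in> {0..tf - t0}" using tstar by (simp add: \<tau>_def)
  have "ivp_solution f t0 tf y0 y" using y by (simp add: unique_ivp_solution_def)
  then obtain X where X: "\<And>\<tau>. \<tau> \<in> {0..tf - t0} \<Longrightarrow> X \<tau> = (t0 + \<tau>, y (t0 + \<tau>))"
    and fam: "lmm_autonomous_family k p (p + l) \<alpha> \<beta> (\<lambda>z. (1, f (fst z) (snd z))) (tf - t0) X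
       (\<lambda>h n. (t0 + real n * h, Y h n)) h0"
    by (rule autonomous_family[where k=k and \<alpha>=\<alpha>, OF assms(4,5,8,6,7,1) f t0 _ h0 Y close expand])
      (rule that; (assumption | simp))
  obtain e C h1 where C: "0 \<le> C" and h1: "0 < h1" and e: "\<And>h n. 0 < h \<Longrightarrow> h \<le> h1 \<Longrightarrow> real n * h = \<tau> \<Longrightarrow>
      norm ((t0 + real n * h, Y h n) - (X \<tau> + (\<Sum>i\<in>{p..<p+l}. h ^ i *\<^sub>R e i))) \<le> C * h ^ (p + l)"
    by (rule lmm_autonomous_family.error_expansion_fixed_point[OF fam \<tau>]) (rule that; (assumption | simp))
  have e': "norm (Y h n - (y tstar + (\<Sum>i\<in>{p..<p+l}. h ^ i *\<^sub>R snd (e i)))) \<le> C * h ^ (p + l)"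
    if "0 < h" "h \<le> h1" "real n * h = \<tau>" for h n
  proof -
    have eq: "snd ((t0 + real n * h, Y h n) - (X \<tau> + (\<Sum>i\<in>{p..<p+l}. h ^ i *\<^sub>R e i))) =
        Y h n - (y tstar + (\<Sum>i\<in>{p..<p+l}. h ^ i *\<^sub>R snd (e i)))"
      using X[OF \<tau>] by (simp add: snd_sum \<tau>_def)
    have snd_le: "norm (snd z) \<le> norm z" for z :: "real \<times> (real ^ 'm)"
      by (cases z) (simp add: norm_snd_le)
    show ?thesis unfolding eq[symmetric] by (rule order_trans[OF snd_le e[OF that]])
  qed
  have N: "1 \<le> N j" if "j \<in> {1..l+1}" for j
  proof (cases "j = 1")
    case False
    then have "N 1 < N j" using assms(3) that by (intro strict_mono_onD[of "{1..l+1}" N]) auto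
    then show ?thesis by simp
  qed (use assms(2) in simp)
  define G where "G = (\<Sum>j=1..l+1. \<bar>\<gamma> j\<bar>)"
  have G: "0 \<le> G" unfolding G_def by (rule sum_nonneg) simp
  have small: "norm (rgre l N \<gamma> Y n h - y tstar) \<le> G * C * h ^ (p + l)"
    if "0 < h" "h \<le> h1" "real n * h = \<tau>" for n h
    unfolding G_def using rgre_error[OF assms(9) N C e' that] .
  \<comment> \<open>The expansion covers small steps only. Between \<open>h1\<close> and
    \<open>h0\<close> a plain bound suffices, because \<open>h ^ (p + l)\<close> is bounded below by
    \<open>h1 ^ (p + l)\<close> there.\<close>
  have "\<exists>K. \<forall>n h. h1 \<le> h \<longrightarrow> h \<le> h0 \<longrightarrow> real n * h = \<tau> \<longrightarrow> norm (rgre l N \<gamma> Y n h - y tstar) \<le> K"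
  proof (cases "\<tau> = 0")
    case False
    then have "0 < \<tau>" using \<tau> by simp
    from bounded_for_large_steps[OF this h1, of "\<lambda>n h. rgre l N \<gamma> Y n h - y tstar"] show ?thesis by blast
  next
    case True
    obtain Cs where Cs: "\<forall>h\<in>{0..h0}. \<forall>j<k. t0 + real j * h \<le> tf \<longrightarrow> norm (Y h j - y (t0 + real j * h)) \<le> Cs * h ^ p"
      using close unfolding starting_values_close_def by blast
    have "norm (rgre l N \<gamma> Y n h - y tstar) \<le> (\<Sum>j=1..l+1. \<bar>\<gamma> j\<bar> * (\<bar>Cs\<bar> * h0 ^ p))"
      if h: "h1 \<le> h" "h \<le> h0" "real n * h = \<tau>" for n h
    proof -
      have n: "n = 0" using h h1 True by simp
      have "rgre l N \<gamma> Y n h - y tstar = (\<Sum>j=1..l+1. \<gamma> j *\<^sub>R (Y (h / real (N j)) 0 - y t0))"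
        using assms(9) True n
        by (simp add: rgre_def rgre_weights_def scaleR_diff_right sum_subtractf \<tau>_def flip: scaleR_sum_left)
      also have "norm \<dots> \<le> (\<Sum>j=1..l+1. \<bar>\<gamma> j\<bar> * (\<bar>Cs\<bar> * h0 ^ p))"
      proof (rule sum_norm_le)
        fix j assume j: "j \<in> {1..l+1}"
        have H: "0 \<le> h / real (N j)" "h / real (N j) \<le> h0"
          using N[OF j] h h1 by (auto simp: divide_le_eq intro: order_trans[OF h(2)] simp: mult_le_cancel_left1 h0)
        have "norm (Y (h / real (N j)) 0 - y t0) \<le> Cs * (h / real (N j)) ^ p"
          using Cs[rule_format, of "h / real (N j)" 0] H assms(4) t0 by simp
        also have "\<dots> \<le> \<bar>Cs\<bar> * h0 ^ p" using H by (intro mult_mono power_mono) auto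
        finally show "norm (\<gamma> j *\<^sub>R (Y (h / real (N j)) 0 - y t0)) \<le> \<bar>\<gamma> j\<bar> * (\<bar>Cs\<bar> * h0 ^ p)"
          by (simp add: mult_left_mono)
      qed
      finally show ?thesis .
    qed
    then show ?thesis by blast
  qed
  then obtain K where K: "\<And>n h. h1 \<le> h \<Longrightarrow> h \<le> h0 \<Longrightarrow> real n * h = \<tau> \<Longrightarrow> norm (rgre l N \<gamma> Y n h - y tstar) \<le> K"
    by blast
  have "norm (rgre l N \<gamma> Y n h - y tstar) \<le> (G * C + \<bar>K\<bar> / h1 ^ (p + l)) * h ^ (p + l)"
    if h: "0 < h" "h \<le> h0" "tstar = t0 + real n * h" for n h
  proof -
    have nh: "real n * h = \<tau>" using h(3) by (simp add: \<tau>_def)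
    show ?thesis
    proof (cases "h \<le> h1")
      case True
      have "0 \<le> \<bar>K\<bar> / h1 ^ (p + l) * h ^ (p + l)" using h1 h by simp
      then show ?thesis using small[OF h(1) True nh] by (simp add: distrib_right)
    next
      case False
      have "norm (rgre l N \<gamma> Y n h - y tstar) \<le> \<bar>K\<bar>" using K[of h n] False h nh by simp
      also have "\<dots> = \<bar>K\<bar> / h1 ^ (p + l) * h1 ^ (p + l)" using h1 by simp
      also have "\<dots> \<le> \<bar>K\<bar> / h1 ^ (p + l) * h ^ (p + l)"
        using h1 False by (intro mult_left_mono power_mono) auto
      finally show ?thesis using G C h by (simp add: distrib_right add_increasing)
    qed
  qed
  then show "\<exists>C. \<forall>n h. 0 < h \<longrightarrow> h \<le> h0 \<longrightarrow> tstar = t0 + real n * h \<longrightarrow>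
      norm (rgre l N \<gamma> Y n h - y tstar) \<le> C * h ^ (p + l)" by blast
qed

end
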